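(* Suppose: (i) the directed graph $\mathcal G$ is strongly connected and $W=[w_{ij}]\in\mathbb R^{n\times n}$ is a nonnegative doubly stochastic weight matrix for it ($W\mathbf 1_n=\mathbf 1_n$, $\mathbf 1_n^TW=\mathbf 1_n^T$, $w_{ii}>0$ for all $i$, and for $i\neq j$, $w_{ij}>0$ if agent $i$ can receive information from agent $j$ and $w_{ij}=0$ otherwise); (ii) there is $L_f>0$ with $\|\nabla F_i(X)-\nabla F_i(Y)\|\le L_f\|X-Y\|$ for all $X,Y\in\mathbb R^d$ and all $i\in\mathcal V$; (iii) the compressor $\mathcal C:\mathbb R^d\to\mathbb R^d$ satisfies, for some constants $r>0$ and $\psi\in(0,1]$, $\mathbf E_{\mathcal C}\big[\|\mathcal C(X)/r-X\|^2\big]\le(1-\psi)\|X\|^2$ for all $X\in\mathbb R^d$. Let $\varphi_X,\varphi_Y\in(0,\frac1r)$, $c_1=\frac{\varphi_X\psi r}{2}$, $c_2=\frac{\varphi_Y\psi r}{2}$, $C=2r^2(1-\psi)+2(1-r)^2$, $\phi=\frac{(1-\sigma)^2}{320L_f^2}$, $\hat\phi=\frac{0.1}{C}\min\{c_1(2c_1+1),c_2(2c_2+1)\}$, and $$\Pi=\min\Big\{\tfrac{1-\sigma}{160(1+c_1^{-1})},\tfrac{1-\sigma}{40000(1+c_2^{-1})L_f^2},\tfrac{c_1(1-\sigma)}{40C},\tfrac{c_1}{8\sqrt C},\tfrac{c_1}{10L_f\sqrt{C(1+c_2^{-1})}},\tfrac{c_2L_f^2}{C},\tfrac{c_2}{10\sqrt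 C}\Big\}.$$ Let every agent run Algorithm 2 (defined in the context) with these $\varphi_X,\varphi_Y$ and with $$\gamma\in\Big(0,\min\Big\{\tfrac{c_1(1-\sigma)}{160C},\tfrac{c_1}{16\sqrt C},\tfrac{c_1}{20L_f\sqrt{C(1+c_2^{-1})}},\tfrac{c_2L_f^2}{4C},\tfrac{c_2}{20\sqrt C},\tfrac{1}{4(1+c_1^{-1})+5(1+c_2^{-1})L_f^2},\tfrac{(1-\sigma)\hat\phi}{4(16(1+4\phi L_f^2)+8(1-\sigma))},\tfrac1{5(1+c_2^{-1})},\tfrac{(1-\sigma)\hat\phi}{32(2\phi+(1-\sigma))},\Pi\Big\}\Big),$$ $$\eta\in\Big(0,\min\Big\{\tfrac{(1-\sigma)^2\gamma}{40L_f},\tfrac{0.4(1-\sigma)\gamma}{L_f^2},\tfrac{(1-\sigma)^2}{80L_f}\sqrt{\tfrac{\gamma}{1+c_1^{-1}}},\tfrac{9}{40(4(1+c_1^{-1})+5(1+c_2^{-1}))},\tfrac1{2L_f},\gamma\Big\}\Big),$$ $$\varsigma\in\Big(0,\min\Big\{\tfrac1{2\sqrt C},\tfrac1{\sqrt{2C+1}}\Big\}\Big).$$ Then for every $k\ge0$, $$\sum_{t=0}^{k}\mathbf E_{\mathcal C}\big[\|\boldsymbol X(t)-\bar{\boldsymbol X}(t)\|^2+n\|\nabla F(\bar X(t))\|^2\big]\le\frac{\hat U(0)}{\hat\theta_1}$$ and $$\mathbf E_{\mathcal C}\big[n(F(\bar X(k))-F^\star)\big]\le\mathbf E_{\mathcal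 C}[\hat U(k)]<\hat U(0),$$ where $\hat\theta_1=\min\{\theta_2,\hat\theta_2\}$, $\hat\theta_2=\min\{0.07(1-\sigma)\gamma,\ 0.24c_1(2c_1+1),\ 0.57c_2(2c_2+1),\ 0.25\}$, $\theta_2=\frac\eta4-(\phi\varepsilon_1+\varepsilon_2+\varepsilon_3)$, $\varepsilon_1=\frac{8L_f^2}{(1-\sigma)\gamma}\eta^2$, $\varepsilon_2=4(1+c_1^{-1})\eta^2$, $\varepsilon_3=5(1+c_2^{-1})\eta^2$.
   Context: Problem. A group of $n$ agents $\mathcal V=\{1,\dots,n\}$ communicates over a directed graph $\mathcal G=(\mathcal V,\mathcal E)$. Agent $i$ has a differentiable (possibly nonconvex) cost $F_i:\mathbb R^d\to\mathbb R$; $F=\frac1n\sum_{i=1}^nF_i$; the set $\operatorname{argmin}F$ is nonempty and $F^\star=\min F>-\infty$. $\|\cdot\|$ is the Euclidean norm (spectral norm for matrices). $\sigma\in(0,1)$ denotes the spectral norm of $W-\frac1n\mathbf 1_n\mathbf 1_n^T$. Compressor. $\mathcal C$ is a possibly randomized map; $\mathbf E_{\mathcal C}$ is expectation over its internal randomness. Each application of $\mathcal C$ in the algorithm uses fresh randomness, independent of the past. Algorithm 2 (error feedback). Parameters $\gamma,\eta,\varphi_X,\varphi_Y,\varsigma>0$. Initialization for each $i\in\mathcal V$: $X_i(0)\in\mathbb R^d$ arbitrary, $Y_i(0)=\nabla F_i(X_i(0))$, $A_i(0)=B_i(0)=C_i(0)=D_i(0)=\mathbf 0_d$, $E_i^X(0)=E_i^Y(0)=\mathbf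 0_d$, $Q_i^X(0)=\hat Q_i^X(0)=\mathcal C(X_i(0))$, $Q_i^Y(0)=\hat Q_i^Y(0)=\mathcal C(Y_i(0))$. For $k\ge0$ and each $i$: $A_i(k+1)=A_i(k)+\varphi_XQ_i^X(k)$; $B_i(k+1)=B_i(k)+\varphi_X\big(Q_i^X(k)-\sum_jw_{ij}Q_j^X(k)\big)$; $C_i(k+1)=C_i(k)+\varphi_YQ_i^Y(k)$; $D_i(k+1)=D_i(k)+\varphi_Y\big(Q_i^Y(k)-\sum_jw_{ij}Q_j^Y(k)\big)$; $X_i(k+1)=X_i(k)-\gamma\big[B_i(k)+\hat Q_i^X(k)-\sum_jw_{ij}\hat Q_j^X(k)\big]-\eta Y_i(k)$; $Y_i(k+1)=Y_i(k)-\gamma\big[D_i(k)+\hat Q_i^Y(k)-\sum_jw_{ij}\hat Q_j^Y(k)\big]+\nabla F_i(X_i(k+1))-\nabla F_i(X_i(k))$; $Q_i^X(k+1)=\mathcal C(X_i(k+1)-A_i(k+1))$; $Q_i^Y(k+1)=\mathcal C(Y_i(k+1)-C_i(k+1))$; $E_i^X(k+1)=\varsigma E_i^X(k)+X_i(k)-A_i(k)-\hat Q_i^X(k)$; $E_i^Y(k+1)=\varsigma E_i^Y(k)+Y_i(k)-C_i(k)-\hat Q_i^Y(k)$; $\hat Q_i^X(k+1)=\mathcal C(\varsigma E_i^X(k+1)+X_i(k+1)-A_i(k+1))$; $\hat Q_i^Y(k+1)=\mathcal C(\varsigma E_i^Y(k+1)+Y_i(k+1)-C_i(k+1))$. Notation.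 $\boldsymbol X,\boldsymbol Y,\boldsymbol A,\boldsymbol C,\boldsymbol E^X,\boldsymbol E^Y\in\mathbb R^{nd}$ are the stacked vectors of $X_i,Y_i,A_i,C_i,E_i^X,E_i^Y$; $\bar X(k)=\frac1n\sum_iX_i(k)$; $\bar{\boldsymbol X}(k)=\mathbf 1_n\otimes\bar X(k)$; $\bar{\boldsymbol Y}(k)=\mathbf 1_n\otimes\frac1n\sum_iY_i(k)$. With $\phi,\hat\phi$ as in the claim, $$V(k)=\|\boldsymbol X(k)-\bar{\boldsymbol X}(k)\|^2+\phi\|\boldsymbol Y(k)-\bar{\boldsymbol Y}(k)\|^2+\|\boldsymbol X(k)-\boldsymbol A(k)\|^2+\|\boldsymbol Y(k)-\boldsymbol C(k)\|^2,$$ $$\hat V(k)=V(k)+\hat\phi\big(\|\boldsymbol E^X(k)\|^2+\|\boldsymbol E^Y(k)\|^2\big),\qquad \hat U(k)=\hat V(k)+n(F(\bar X(k))-F^\star).$$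
   Formalization: The strict bound E[Û(k)] < Û(0) is false for k = 0, and for all k when V(0) = 0 (all X_i(0) = 0 and ∇F_i(0) = 0, so nothing moves); proved instead: E[Û(k)] ≤ Û(0) for every k ≥ 0, strict for k ≥ 1 whenever V(0) > 0. *)

theory Defs
  imports "HOL-Probability.Probability"
begin

text \<open>
  The agents are the elements of a finite type \<open>'n\<close>, so \<open>n = CARD('n)\<close>, and stacked vectors have
  type \<open>real^'d^'n\<close>: the norm of this type is the Euclidean norm of the stacked vector in dimension
  \<open>n * d\<close>, and \<open>v $ i\<close> is the block of agent \<open>i\<close>.
\<close>

text \<open>\<open>(j, i) \<in> E\<close> means that agent \<open>i\<close> can receive information from agent \<open>j\<close>.\<close>

definition strongly_connected_graph :: "('n \<times> 'n) set \<Rightarrow> bool" where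
  "strongly_connected_graph E \<longleftrightarrow> (\<forall>i j. (i, j) \<in> E\<^sup>*)"

definition doubly_stochastic_weights :: "('n::finite \<times> 'n) set \<Rightarrow> real^'n^'n \<Rightarrow> bool" where
  "doubly_stochastic_weights E W \<longleftrightarrow>
     (\<forall>i j. 0 \<le> W $ i $ j) \<and> W *v 1 = 1 \<and> 1 v* W = 1 \<and>
     (\<forall>i. 0 < W $ i $ i) \<and>
     (\<forall>i j. i \<noteq> j \<longrightarrow> (if (j, i) \<in> E then 0 < W $ i $ j else W $ i $ j = 0))"

definition mixing_norm :: "real^'n^'n \<Rightarrow> real" where
  "mixing_norm W = onorm (\<lambda>v. (W - (\<chi> i j. 1 / real CARD('n))) *v v)"

definition average :: "real^'d^'n \<Rightarrow> real^'d" where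
  "average v = (1 / real CARD('n)) *\<^sub>R (\<Sum>i\<in>UNIV. v $ i)"

definition consensus :: "real^'d^'n \<Rightarrow> real^'d^'n" where
  "consensus v = (\<chi> i. average v)"

definition disagreement :: "real^'n^'n \<Rightarrow> real^'d^'n \<Rightarrow> real^'d^'n" where
  "disagreement W v = (\<chi> i. v $ i - (\<Sum>j\<in>UNIV. W $ i $ j *\<^sub>R v $ j))"

text \<open>Meaningful only at points of differentiability, where the gradient is unique.\<close>

definition grad :: "('a::real_inner \<Rightarrow> real) \<Rightarrow> 'a \<Rightarrow> 'a" where
  "grad f x = (THE D. GDERIV f x :> D)"

definition stacked_grad :: "('n::finite \<Rightarrow> real^'d \<Rightarrow> real) \<Rightarrow> real^'d^'n \<Rightarrow> real^'d^'n" where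
  "stacked_grad F v = (\<chi> i. grad (F i) (v $ i))"

definition avg_cost :: "('n::finite \<Rightarrow> real^'d \<Rightarrow> real) \<Rightarrow> real^'d \<Rightarrow> real" where
  "avg_cost F x = (1 / real CARD('n)) * (\<Sum>i\<in>UNIV. F i x)"

definition opt_value :: "('n::finite \<Rightarrow> real^'d \<Rightarrow> real) \<Rightarrow> real" where
  "opt_value F = (INF x. avg_cost F x)"

text \<open>
  A randomized map is a function \<open>\<C> s x\<close> of its input \<open>x\<close> and of a random seed \<open>s\<close> whose law is the
  probability measure \<open>S\<close>; the joint measurability makes the iterates below random variables.
  Integrability is required explicitly because the Bochner integral of a non-integrable function
  is 0.
\<close>

definition compressor ::
  "'s measure \<Rightarrow> ('s \<Rightarrow> real^'d \<Rightarrow> real^'d) \<Rightarrow> real \<Rightarrow> real \<Rightarrow> bool" where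
  "compressor S \<C> r \<psi> \<longleftrightarrow>
     prob_space S \<and>
     (\<lambda>(s, x). \<C> s x) \<in> S \<Otimes>\<^sub>M borel \<rightarrow>\<^sub>M borel \<and>
     (\<forall>x. integrable S (\<lambda>s. (norm (\<C> s x /\<^sub>R r - x))\<^sup>2) \<and>
          (\<integral>s. (norm (\<C> s x /\<^sub>R r - x))\<^sup>2 \<partial>S) \<le> (1 - \<psi>) * (norm x)\<^sup>2)"

text \<open>Blockwise compression, agent \<open>i\<close> using the seed \<open>u i\<close>.\<close>

definition compress ::
  "('s \<Rightarrow> real^'d \<Rightarrow> real^'d) \<Rightarrow> ('n \<Rightarrow> 's) \<Rightarrow> real^'d^'n \<Rightarrow> real^'d^'n" where
  "compress \<C> u v = (\<chi> i. \<C> (u i) (v $ i))"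

record ('d::finite, 'n::finite) ef_state =
  stX :: "real^'d^'n"
  stY :: "real^'d^'n"
  stA :: "real^'d^'n"
  stB :: "real^'d^'n"
  stC :: "real^'d^'n"
  stD :: "real^'d^'n"
  stEX :: "real^'d^'n"
  stEY :: "real^'d^'n"
  stQX :: "real^'d^'n"
  stQY :: "real^'d^'n"
  stQhX :: "real^'d^'n"
  stQhY :: "real^'d^'n"

datatype channel = ChQX | ChQY | ChQhX | ChQhY

text \<open>
  The seed \<open>u (k, c, i)\<close> is used by agent \<open>i\<close> for the variable \<open>c\<close> at time \<open>k\<close>. At time 0 the hatted
  variables are by definition equal to the unhatted ones, so that the hatted seeds of time 0 are
  not used.
\<close>

definition ef_init ::
  "('s \<Rightarrow> real^'d \<Rightarrow> real^'d) \<Rightarrow> ('n::finite \<Rightarrow> real^'d \<Rightarrow> real) \<Rightarrow> real^'d^'n \<Rightarrow>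
   (nat \<times> channel \<times> 'n \<Rightarrow> 's) \<Rightarrow> ('d, 'n) ef_state" where
  "ef_init \<C> F x0 u =
     (let y0 = stacked_grad F x0;
          qX = compress \<C> (\<lambda>i. u (0, ChQX, i)) x0;
          qY = compress \<C> (\<lambda>i. u (0, ChQY, i)) y0
      in \<lparr>stX = x0, stY = y0, stA = 0, stB = 0, stC = 0, stD = 0, stEX = 0, stEY = 0,
          stQX = qX, stQY = qY, stQhX = qX, stQhY = qY\<rparr>)"

text \<open>Unprimed components belong to time \<open>k\<close>, primed ones to time \<open>k + 1\<close>.\<close>

definition ef_step ::
  "('s \<Rightarrow> real^'d \<Rightarrow> real^'d) \<Rightarrow> ('n::finite \<Rightarrow> real^'d \<Rightarrow> real) \<Rightarrow> real^'n^'n \<Rightarrow>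
   real \<Rightarrow> real \<Rightarrow> real \<Rightarrow> real \<Rightarrow> real \<Rightarrow>
   (nat \<times> channel \<times> 'n \<Rightarrow> 's) \<Rightarrow> nat \<Rightarrow> ('d, 'n) ef_state \<Rightarrow> ('d, 'n) ef_state" where
  "ef_step \<C> F W \<gamma> \<eta> \<phi>X \<phi>Y vs u k st =
     (let X = stX st; Y = stY st; A = stA st; B = stB st; C = stC st; D = stD st;
          ErX = stEX st; ErY = stEY st;
          QX = stQX st; QY = stQY st; QhX = stQhX st; QhY = stQhY st;
          A' = A + \<phi>X *\<^sub>R QX;
          B' = B + \<phi>X *\<^sub>R disagreement W QX;
          C' = C + \<phi>Y *\<^sub>R QY;
          D' = D + \<phi>Y *\<^sub>R disagreement W QY;
          X' = X - \<gamma> *\<^sub>R (B + disagreement W QhX) - \<eta> *\<^sub>R Y;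
          Y' = Y - \<gamma> *\<^sub>R (D + disagreement W QhY) + stacked_grad F X' - stacked_grad F X;
          QX' = compress \<C> (\<lambda>i. u (Suc k, ChQX, i)) (X' - A');
          QY' = compress \<C> (\<lambda>i. u (Suc k, ChQY, i)) (Y' - C');
          ErX' = vs *\<^sub>R ErX + X - A - QhX;
          ErY' = vs *\<^sub>R ErY + Y - C - QhY;
          QhX' = compress \<C> (\<lambda>i. u (Suc k, ChQhX, i)) (vs *\<^sub>R ErX' + X' - A');
          QhY' = compress \<C> (\<lambda>i. u (Suc k, ChQhY, i)) (vs *\<^sub>R ErY' + Y' - C')
      in \<lparr>stX = X', stY = Y', stA = A', stB = B', stC = C', stD = D', stEX = ErX', stEY = ErY',
          stQX = QX', stQY = QY', stQhX = QhX', stQhY = QhY'\<rparr>)"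

primrec ef_run ::
  "('s \<Rightarrow> real^'d \<Rightarrow> real^'d) \<Rightarrow> ('n::finite \<Rightarrow> real^'d \<Rightarrow> real) \<Rightarrow> real^'n^'n \<Rightarrow>
   real \<Rightarrow> real \<Rightarrow> real \<Rightarrow> real \<Rightarrow> real \<Rightarrow> real^'d^'n \<Rightarrow>
   (nat \<times> channel \<times> 'n \<Rightarrow> 's) \<Rightarrow> nat \<Rightarrow> ('d, 'n) ef_state" where
  "ef_run \<C> F W \<gamma> \<eta> \<phi>X \<phi>Y vs x0 u 0 = ef_init \<C> F x0 u"
| "ef_run \<C> F W \<gamma> \<eta> \<phi>X \<phi>Y vs x0 u (Suc k) =
     ef_step \<C> F W \<gamma> \<eta> \<phi>X \<phi>Y vs u k (ef_run \<C> F W \<gamma> \<eta> \<phi>X \<phi>Y vs x0 u k)"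

definition lyap_V :: "real \<Rightarrow> ('d::finite, 'n::finite) ef_state \<Rightarrow> real" where
  "lyap_V \<phi> st =
     (norm (stX st - consensus (stX st)))\<^sup>2 + \<phi> * (norm (stY st - consensus (stY st)))\<^sup>2 +
     (norm (stX st - stA st))\<^sup>2 + (norm (stY st - stC st))\<^sup>2"

definition lyap_Vhat :: "real \<Rightarrow> real \<Rightarrow> ('d::finite, 'n::finite) ef_state \<Rightarrow> real" where
  "lyap_Vhat \<phi> \<phi>h st = lyap_V \<phi> st + \<phi>h * ((norm (stEX st))\<^sup>2 + (norm (stEY st))\<^sup>2)"

definition lyap_Uhat ::
  "('n::finite \<Rightarrow> real^'d \<Rightarrow> real) \<Rightarrow> real \<Rightarrow> real \<Rightarrow> ('d, 'n) ef_state \<Rightarrow> real" where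
  "lyap_Uhat F \<phi> \<phi>h st =
     lyap_Vhat \<phi> \<phi>h st + real CARD('n) * (avg_cost F (average (stX st)) - opt_value F)"

text \<open>
  The initial state is random only through the compressed variables, so the Lyapunov functions
  take a deterministic value at time 0.
\<close>

lemma lyap_ef_init:
  "lyap_V \<phi> (ef_init \<C> F x0 u) = lyap_V \<phi> (ef_init \<C> F x0 u')"
  "lyap_Uhat F \<phi> \<phi>h (ef_init \<C> F x0 u) = lyap_Uhat F \<phi> \<phi>h (ef_init \<C> F x0 u')"
  by (simp_all add: lyap_V_def lyap_Vhat_def lyap_Uhat_def ef_init_def Let_def)

end

theory Submission
  imports Defs
begin

text \<open>
  Let \<open>P\<close> be the expected Lyapunov function \<open>Uhat\<close>. A one-step decrease of \<open>P\<close> can fail when \<open>1 - \<sigma>\<close> is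
  small: the consensus error \<open>y\<close> of \<open>Y\<close> has the weight \<open>\<phi>\<close>, of order \<open>(1 - \<sigma>)\<^sup>2\<close>, and feeds into
  \<open>pY = (norm (Y - C))\<^sup>2\<close>, whose weight is 1, a noise that the decrease of \<open>\<phi> * y\<close> does not absorb;
  one only gets \<open>P' \<le> P + b * (y - pY) - (dissipation)\<close>. Let \<open>Q = P + t * (y - pY)\<close> for a suitable \<open>t\<close>
  in \<open>(0, 1)\<close>. Doubly stochastic \<open>W\<close> satisfies \<open>(norm ((I - W) v))\<^sup>2 \<le> 2 * inner v ((I - W) v)\<close>, so that
  each gossip step also dissipates \<open>(norm ((I - W) Y))\<^sup>2\<close>, at a rate without the factor \<open>1 - \<sigma>\<close>. With the
  extra weight \<open>t\<close> on \<open>y\<close> this absorbs the noise, hence \<open>Q\<close> does decrease. As \<open>b = q * t\<close> with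
  \<open>0 \<le> q \<le> 1\<close>, \<open>P'\<close> is at most the convex combination \<open>(1 - q) * P + q * Q\<close> minus the dissipation.
  Since \<open>C\<close> vanishes at time 0, \<open>Q\<close> starts below \<open>P\<close>, so both stay below the initial value of \<open>P\<close>.
\<close>

section \<open>Averages and gossip\<close>

text \<open>Randomness enters only through second moments: each compressed vector is a function of
  the seeds of earlier times, so the compressor bound integrates over its law. What remains are
  inequalities between real numbers. Write \<open>m2 = 1 + 1 / c2\<close>. In \<open>Q\<close> the
  weight of \<open>pY\<close> is \<open>1 - t\<close>, so the noise is
  \<open>3 * (1 - t) * m2 * \<gamma>\<^sup>2\<close> and the dissipation bought by the extra weight
  is \<open>0.396 * \<gamma> * t\<close>, both times \<open>NY\<close>. They balance once
  \<open>t / (1 - t)\<close> exceeds about \<open>7.6 * m2 * \<gamma>\<close>; the choice is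
  \<open>8 * m2 * \<gamma>\<close>. In \<open>P\<close> itself, \<open>NY \<le> 4 * y\<close> leaves
  \<open>b = 12 * m2 * \<gamma>\<^sup>2\<close>, and the contraction of \<open>pY\<close> can spare
  the same multiple of \<open>pY\<close>, which makes the defect a multiple of \<open>Q - P\<close>.
  The extra weight has a price: \<open>y\<close> receives the increment of \<open>X\<close> with a
  factor of order \<open>1 / (\<gamma> * (1 - \<sigma>))\<close>, and \<open>t\<close>, unlike
  \<open>\<phi>\<close>, has no factor \<open>(1 - \<sigma>)\<^sup>2\<close> to offset it. What the
  bounds on \<open>\<gamma>\<close> leave over is absorbed by the dissipation of \<open>NX\<close>,
  so the gossip step of \<open>X\<close> is interpolated as well.\<close>

lemma average_add: "average (u + v) = average u + average v"
  by (simp add: average_def sum.distrib scaleR_add_right)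

lemma average_scaleR: "average (c *\<^sub>R u) = c *\<^sub>R average u"
  by (simp add: average_def scaleR_sum_right[symmetric])

lemma average_diff: "average (u - v) = average u - average v"
  by (simp add: average_def sum_subtractf scaleR_diff_right)

lemma average_consensus [simp]: "average (consensus v) = average v"
  by (simp add: consensus_def average_def sum_constant_scaleR del: sum_constant)

lemma consensus_add: "consensus (u + v) = consensus u + consensus v"
  by (simp add: consensus_def average_add vec_eq_iff)

lemma consensus_diff: "consensus (u - v) = consensus u - consensus v"
  by (simp add: consensus_def average_diff vec_eq_iff)

lemma consensus_scaleR: "consensus (c *\<^sub>R u) = c *\<^sub>R consensus u"
  by (simp add: consensus_def average_scaleR vec_eq_iff)

lemma consensus_eq_0: "average v = 0 \<Longrightarrow> consensus v = 0"
  by (simp add: consensus_def vec_eq_iff)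

lemma norm_vec_power2: "(norm (v :: 'a::real_inner^'n))\<^sup>2 = (\<Sum>i\<in>UNIV. (norm (v $ i))\<^sup>2)"
  by (simp add: power2_norm_eq_inner inner_vec_def)

lemma norm_consensus_power2:
  "(norm (consensus (v :: real^'d^'n)))\<^sup>2 = real CARD('n) * (norm (average v))\<^sup>2"
  by (simp add: norm_vec_power2 consensus_def)

lemma inner_consensus_0:
  assumes "average v = 0"
  shows "inner v (consensus w) = 0"
proof -
  have "inner v (consensus w) = inner (\<Sum>i\<in>UNIV. v $ i) (average w)"
    by (simp add: inner_vec_def[of v] consensus_def inner_sum_left)
  also have "(\<Sum>i\<in>UNIV. v $ i) = 0"
    using assms by (simp add: average_def)
  finally show ?thesis by simp
qed

lemma norm_consensus_decomp:
  "(norm v)\<^sup>2 = (norm (v - consensus v))\<^sup>2 + (norm (consensus v))\<^sup>2"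
proof -
  have "inner (v - consensus v) (consensus v) = 0"
    by (rule inner_consensus_0) (simp add: average_diff)
  then show ?thesis
    by (simp add: power2_norm_eq_inner inner_diff_left inner_diff_right inner_commute)
qed

lemma norm_diff_consensus_le: "norm (v - consensus v) \<le> norm v"
  by (rule power2_le_imp_le) (simp_all add: norm_consensus_decomp[of v])

lemma norm_consensus_le: "norm (consensus v) \<le> norm v"
  by (rule power2_le_imp_le) (simp_all add: norm_consensus_decomp[of v])

section \<open>Multiplication by the weight matrix, and the operator \<open>I - W\<close>\<close>

definition mix :: "real^'n^'n \<Rightarrow> real^'d^'n \<Rightarrow> real^'d^'n" where
  "mix W v = (\<chi> i. \<Sum>j\<in>UNIV. W $ i $ j *\<^sub>R v $ j)"

lemma disagreement_eq_mix: "disagreement W v = v - mix W v"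
  by (simp add: disagreement_def mix_def vec_eq_iff)

lemma mix_add: "mix W (u + v) = mix W u + mix W v"
  by (simp add: mix_def vec_eq_iff sum.distrib algebra_simps)

lemma mix_diff: "mix W (u - v) = mix W u - mix W v"
  by (simp add: mix_def vec_eq_iff sum_subtractf algebra_simps)

lemma mix_scaleR: "mix W (c *\<^sub>R v) = c *\<^sub>R mix W v"
  by (simp add: mix_def vec_eq_iff sum_distrib_left algebra_simps)

lemma disagreement_add: "disagreement W (u + v) = disagreement W u + disagreement W v"
  by (simp add: disagreement_eq_mix mix_add)

lemma disagreement_diff: "disagreement W (u - v) = disagreement W u - disagreement W v"
  by (simp add: disagreement_eq_mix mix_diff)

lemma disagreement_scaleR: "disagreement W (c *\<^sub>R v) = c *\<^sub>R disagreement W v"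
  by (simp add: disagreement_eq_mix mix_scaleR scaleR_diff_right)

lemma disagreement_0 [simp]: "disagreement W 0 = 0"
  using disagreement_scaleR[of W 0 0] by simp

locale mixing =
  fixes E :: "('n::finite \<times> 'n) set" and W :: "real^'n^'n" and \<sigma> :: real
  assumes weights: "doubly_stochastic_weights E W"
    and sigma: "\<sigma> = mixing_norm W" "0 < \<sigma>" "\<sigma> < 1"
begin

lemma row_sum: "(\<Sum>j\<in>UNIV. W $ i $ j) = 1"
proof -
  have "(W *v 1) $ i = (1 :: real^'n) $ i"
    using weights by (simp add: doubly_stochastic_weights_def)
  then show ?thesis
    by (simp add: matrix_vector_mult_def)
qed

lemma col_sum: "(\<Sum>i\<in>UNIV. W $ i $ j) = 1"
proof -
  have "(1 v* W) $ j = (1 :: real^'n) $ j"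
    using weights by (simp add: doubly_stochastic_weights_def)
  then show ?thesis
    by (simp add: vector_matrix_mult_def)
qed

lemma mix_consensus: "mix W (consensus v) = consensus v"
  by (simp add: mix_def consensus_def scaleR_sum_left[symmetric] row_sum)

lemma average_mix: "average (mix W v) = average v"
proof -
  have "(\<Sum>i\<in>UNIV. \<Sum>j\<in>UNIV. W $ i $ j *\<^sub>R v $ j) = (\<Sum>j\<in>UNIV. \<Sum>i\<in>UNIV. W $ i $ j *\<^sub>R v $ j)"
    by (rule sum.swap)
  also have "\<dots> = (\<Sum>j\<in>UNIV. v $ j)"
    by (simp add: scaleR_sum_left[symmetric] col_sum)
  finally show ?thesis
    by (simp add: mix_def average_def)
qed

lemma average_disagreement [simp]: "average (disagreement W v) = 0"
  by (simp add: disagreement_eq_mix average_diff average_mix)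

lemma disagreement_consensus [simp]: "disagreement W (consensus v) = 0"
  by (simp add: disagreement_eq_mix mix_consensus)

lemma disagreement_diff_consensus: "disagreement W (v - consensus v) = disagreement W v"
  by (simp add: disagreement_diff)

text \<open>The averaging matrix annihilates a mean-free \<open>v\<close>, so \<open>mix W\<close>
  acts on it like the matrix whose norm is \<open>\<sigma>\<close>. That norm concerns one real
  number per agent; it is applied to each coordinate of the blocks separately, and the squares are
  summed.\<close>

lemma norm_mix_le_sigma:
  fixes v :: "real^'d^'n"
  assumes "average v = 0"
  shows "norm (mix W v) \<le> \<sigma> * norm v"
proof (rule power2_le_imp_le)
  let ?J = "(\<chi> i j. 1 / real CARD('n)) :: real^'n^'n"
  let ?c = "\<lambda>k. (\<chi> j. v $ j $ k) :: real^'n"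
  have sum0: "(\<Sum>j\<in>UNIV. v $ j $ k) = 0" for k
  proof -
    have "average v $ k = 0" using assms by simp
    then show ?thesis by (simp add: average_def)
  qed
  have comp: "mix W v $ i $ k = ((W - ?J) *v ?c k) $ i" for i k
    using sum0[of k]
    by (simp add: mix_def matrix_vector_mult_def left_diff_distrib sum_subtractf
        sum_divide_distrib[symmetric])
  have "(norm (mix W v))\<^sup>2 = (\<Sum>i\<in>UNIV. \<Sum>k\<in>UNIV. (mix W v $ i $ k)\<^sup>2)"
    by (simp add: norm_vec_power2)
  also have "\<dots> = (\<Sum>k\<in>UNIV. \<Sum>i\<in>UNIV. (mix W v $ i $ k)\<^sup>2)"
    by (rule sum.swap)
  also have "\<dots> = (\<Sum>k\<in>UNIV. (norm ((W - ?J) *v ?c k))\<^sup>2)"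
    by (simp add: comp norm_vec_power2)
  also have "\<dots> \<le> (\<Sum>k\<in>UNIV. (\<sigma> * norm (?c k))\<^sup>2)"
    unfolding sigma(1) mixing_norm_def
    by (intro sum_mono power_mono onorm) auto
  also have "\<dots> = \<sigma>\<^sup>2 * (\<Sum>k\<in>UNIV. \<Sum>i\<in>UNIV. (v $ i $ k)\<^sup>2)"
    by (simp add: power_mult_distrib sum_distrib_left norm_vec_power2)
  also have "(\<Sum>k\<in>UNIV. \<Sum>i\<in>UNIV. (v $ i $ k)\<^sup>2) = (\<Sum>i\<in>UNIV. \<Sum>k\<in>UNIV. (v $ i $ k)\<^sup>2)"
    by (rule sum.swap)
  also have "\<dots> = (norm v)\<^sup>2"
    by (simp add: norm_vec_power2)
  finally show "(norm (mix W v))\<^sup>2 \<le> (\<sigma> * norm v)\<^sup>2"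
    by (simp add: power_mult_distrib)
qed (use sigma in simp)

text \<open>Gossip fixes the consensus part and contracts the orthogonal mean-free part; Pythagoras
  recombines them.\<close>

lemma norm_mix_le: "norm (mix W v) \<le> norm v"
proof (rule power2_le_imp_le)
  have avg: "average (v - consensus v) = 0"
    by (simp add: average_diff)
  have "norm (mix W (v - consensus v)) \<le> \<sigma> * norm (v - consensus v)"
    by (rule norm_mix_le_sigma) (fact avg)
  also have "\<dots> \<le> 1 * norm (v - consensus v)"
    using sigma by (intro mult_right_mono) auto
  finally have "norm (mix W v - consensus v) \<le> norm (v - consensus v)"
    by (simp add: mix_diff mix_consensus)
  moreover have "(norm (mix W v))\<^sup>2 = (norm (mix W v - consensus v))\<^sup>2 + (norm (consensus v))\<^sup>2"
    using norm_consensus_decomp[of "mix W v"] by (simp add: consensus_def average_mix)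
  ultimately show "(norm (mix W v))\<^sup>2 \<le> (norm v)\<^sup>2"
    by (simp add: norm_consensus_decomp[of v] power_mono)
qed simp

lemma norm_disagreement_le: "norm (disagreement W v) \<le> 2 * norm v"
  using norm_triangle_ineq4[of v "mix W v"] norm_mix_le[of v] by (simp add: disagreement_eq_mix)

lemma norm_disagreement_power2_le: "(norm (disagreement W v))\<^sup>2 \<le> 4 * (norm v)\<^sup>2"
  using power_mono[OF norm_disagreement_le[of v], of 2] by (simp add: power_mult_distrib)

text \<open>After expanding the square of \<open>v - mix W v\<close>, this is the nonexpansiveness
  of \<open>mix W\<close>. It therefore covers nonsymmetric \<open>W\<close>.\<close>

lemma norm_disagreement_power2_le_inner:
  "(norm (disagreement W v))\<^sup>2 \<le> 2 * inner v (disagreement W v)"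
proof -
  have "(norm (mix W v))\<^sup>2 \<le> (norm v)\<^sup>2"
    using norm_mix_le[of v] by (simp add: power_mono)
  then show ?thesis
    by (simp add: disagreement_eq_mix power2_norm_eq_inner inner_diff_left inner_diff_right
        inner_commute)
qed

end

text \<open>Convexity of the squared norm: \<open>u + z\<close> is the combination, with weights
  \<open>1 - \<alpha>\<close> and \<open>\<alpha>\<close>, of \<open>u\<close> divided by
  \<open>1 - \<alpha>\<close> and \<open>z\<close> divided by \<open>\<alpha>\<close>.\<close>

lemma norm_add_power2_le_weighted:
  fixes u z :: "'a::real_inner"
  assumes "0 < \<alpha>" "\<alpha> < 1"
  shows "(norm (u + z))\<^sup>2 \<le> (norm u)\<^sup>2 / (1 - \<alpha>) + (norm z)\<^sup>2 / \<alpha>"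
proof -
  have "0 \<le> (norm (\<alpha> *\<^sub>R u - (1 - \<alpha>) *\<^sub>R z))\<^sup>2" by simp
  also have "\<dots> = \<alpha>\<^sup>2 * (norm u)\<^sup>2 + (1 - \<alpha>)\<^sup>2 * (norm z)\<^sup>2 - 2 * (\<alpha> * (1 - \<alpha>)) * inner u z"
    unfolding power2_norm_eq_inner
    unfolding inner_diff_left inner_diff_right inner_scaleR_left
      inner_scaleR_right inner_commute[of z u] power2_eq_square by algebra
  finally have *: "2 * (\<alpha> * (1 - \<alpha>)) * inner u z \<le> \<alpha>\<^sup>2 * (norm u)\<^sup>2 + (1 - \<alpha>)\<^sup>2 * (norm z)\<^sup>2" by simp
  have pos: "0 < \<alpha> * (1 - \<alpha>)" using assms by simp
  have "2 * inner u z = 2 * (\<alpha> * (1 - \<alpha>)) * inner u z / (\<alpha> * (1 - \<alpha>))"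
    using assms by simp
  also have "\<dots> \<le> (\<alpha>\<^sup>2 * (norm u)\<^sup>2 + (1 - \<alpha>)\<^sup>2 * (norm z)\<^sup>2) / (\<alpha> * (1 - \<alpha>))"
    using * pos by (intro divide_right_mono) auto
  also have "\<dots> = \<alpha> / (1 - \<alpha>) * (norm u)\<^sup>2 + (1 - \<alpha>) / \<alpha> * (norm z)\<^sup>2"
    using assms by (simp add: add_divide_distrib power2_eq_square)
  also have "\<dots> = (norm u)\<^sup>2 / (1 - \<alpha>) + (norm z)\<^sup>2 / \<alpha> - (norm u)\<^sup>2 - (norm z)\<^sup>2"
    using assms by (simp add: field_simps)
  finally show ?thesis
    by (simp add: power2_norm_eq_inner inner_add_left inner_add_right inner_commute)
qed

context mixing
begin

text \<open>
  Interpolates, with weight \<open>\<nu>\<close>, between the spectral contraction by \<open>1 - \<gamma> * (1 - \<sigma>)\<close> and the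
  energy dissipation \<open>\<gamma> * (norm (disagreement W v))\<^sup>2\<close>.
\<close>

lemma gossip_contraction:
  fixes v z :: "real^'d^'n"
  assumes avg: "average v = 0" and \<gamma>: "0 < \<gamma>" "\<gamma> \<le> 1 / 400" and \<nu>: "0 \<le> \<nu>" "\<nu> \<le> 1"
    and \<alpha>: "\<alpha> = \<gamma> * (1 - \<sigma>)"
  shows "(norm (v - \<gamma> *\<^sub>R disagreement W v + z))\<^sup>2 \<le>
    (1 - (1 - 201 / 100 * \<nu>) * \<alpha>) * (norm v)\<^sup>2 - 99 / 100 * \<nu> * \<gamma> * (norm (disagreement W v))\<^sup>2
      + (norm z)\<^sup>2 / \<alpha>"
proof -
  let ?u = "v - \<gamma> *\<^sub>R disagreement W v" and ?N = "(norm (disagreement W v))\<^sup>2"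
  have \<alpha>01: "0 < \<alpha>" "\<alpha> < 1" "\<alpha> \<le> 1 / 400"
  proof -
    show "0 < \<alpha>" using \<gamma> sigma by (simp add: \<alpha>)
    have "\<gamma> * (1 - \<sigma>) \<le> \<gamma> * 1" using \<gamma> sigma by (intro mult_left_mono) auto
    then show "\<alpha> \<le> 1 / 400" using \<gamma> unfolding \<alpha> by linarith
    then show "\<alpha> < 1" by simp
  qed
  \<comment> \<open>Two bounds on \<open>?u\<close> follow, each divided by
    \<open>1 - \<alpha>\<close> because the perturbation \<open>z\<close> will be split off with
    that weight. The first is spectral: the squared factor \<open>1 - \<alpha>\<close> loses one
    power.\<close>
  have "?u = (1 - \<gamma>) *\<^sub>R v + \<gamma> *\<^sub>R mix W v"
    by (simp add: disagreement_eq_mix algebra_simps)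
  then have "norm ?u \<le> (1 - \<gamma>) * norm v + \<gamma> * norm (mix W v)"
    using \<gamma> norm_triangle_ineq[of "(1 - \<gamma>) *\<^sub>R v" "\<gamma> *\<^sub>R mix W v"] by simp
  also have "\<dots> \<le> (1 - \<gamma>) * norm v + \<gamma> * (\<sigma> * norm v)"
    using \<gamma> norm_mix_le_sigma[OF avg] by simp
  also have "\<dots> = (1 - \<alpha>) * norm v"
    by (simp add: \<alpha> algebra_simps)
  finally have "(norm ?u)\<^sup>2 \<le> ((1 - \<alpha>) * norm v)\<^sup>2"
    by (rule power_mono) simp
  then have "(norm ?u)\<^sup>2 / (1 - \<alpha>) \<le> ((1 - \<alpha>) * norm v)\<^sup>2 / (1 - \<alpha>)"
    using \<alpha>01 by (intro divide_right_mono) auto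
  then have 1: "(norm ?u)\<^sup>2 / (1 - \<alpha>) \<le> (1 - \<alpha>) * (norm v)\<^sup>2"
    using \<alpha>01 by (simp add: power2_eq_square mult_ac)
  \<comment> \<open>The second bound gives up contraction, and even a growth by
    \<open>101 / 100 * \<alpha>\<close>, in exchange for the dissipation of the
    disagreement.\<close>
  have "(norm ?u)\<^sup>2 = (norm v)\<^sup>2 - \<gamma> * (2 * inner v (disagreement W v)) + \<gamma>\<^sup>2 * ?N"
    unfolding power2_norm_eq_inner
    unfolding inner_diff_left inner_diff_right inner_scaleR_left inner_scaleR_right
      inner_commute[of "disagreement W v" v] power2_eq_square by algebra
  also have "\<dots> \<le> (norm v)\<^sup>2 - \<gamma> * ?N + \<gamma>\<^sup>2 * ?N"
    using \<gamma> norm_disagreement_power2_le_inner[of v] by simp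
  also have "\<dots> = (norm v)\<^sup>2 - \<gamma> * (1 - \<gamma>) * ?N"
    by (simp add: algebra_simps power2_eq_square)
  also have "\<dots> \<le> (norm v)\<^sup>2 - \<gamma> * 99 / 100 * ?N"
    using \<gamma> by (intro diff_left_mono mult_right_mono mult_left_mono) auto
  finally have a: "(norm ?u)\<^sup>2 \<le> (norm v)\<^sup>2 - \<gamma> * 99 / 100 * ?N" .
  have "(norm ?u)\<^sup>2 / (1 - \<alpha>) \<le> (norm v)\<^sup>2 / (1 - \<alpha>) - \<gamma> * 99 / 100 * ?N / (1 - \<alpha>)"
    unfolding diff_divide_distrib[symmetric] using a \<alpha>01 by (intro divide_right_mono) auto
  also have "\<dots> \<le> (1 + 101 / 100 * \<alpha>) * (norm v)\<^sup>2 - \<gamma> * 99 / 100 * ?N"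
  proof (intro diff_mono)
    have "1 / (1 - \<alpha>) \<le> 1 + 101 / 100 * \<alpha>"
    proof -
      have "\<alpha> * (101 / 100 * \<alpha>) \<le> \<alpha> * (1 / 100)" using \<alpha>01 by (intro mult_left_mono) auto
      then have "1 \<le> (1 + 101 / 100 * \<alpha>) * (1 - \<alpha>)" by (simp add: algebra_simps)
      then show ?thesis using \<alpha>01 by (simp add: pos_divide_le_eq)
    qed
    then have "1 / (1 - \<alpha>) * (norm v)\<^sup>2 \<le> (1 + 101 / 100 * \<alpha>) * (norm v)\<^sup>2"
      by (intro mult_right_mono) auto
    then show "(norm v)\<^sup>2 / (1 - \<alpha>) \<le> (1 + 101 / 100 * \<alpha>) * (norm v)\<^sup>2" by simp
    have "\<gamma> * 99 / 100 * ?N / 1 \<le> \<gamma> * 99 / 100 * ?N / (1 - \<alpha>)"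
      using \<alpha>01 \<gamma> by (intro divide_left_mono) auto
    then show "\<gamma> * 99 / 100 * ?N \<le> \<gamma> * 99 / 100 * ?N / (1 - \<alpha>)" by simp
  qed
  finally have 2: "(norm ?u)\<^sup>2 / (1 - \<alpha>) \<le> (1 + 101 / 100 * \<alpha>) * (norm v)\<^sup>2 - \<gamma> * 99 / 100 * ?N" .
  \<comment> \<open>Averaging the factors \<open>1 - \<alpha>\<close> and
    \<open>1 + 101 / 100 * \<alpha>\<close> is the origin of
    \<open>201 / 100 * \<nu>\<close>.\<close>
  have "(norm ?u)\<^sup>2 / (1 - \<alpha>) = (1 - \<nu>) * ((norm ?u)\<^sup>2 / (1 - \<alpha>)) + \<nu> * ((norm ?u)\<^sup>2 / (1 - \<alpha>))"
    unfolding left_diff_distrib by simp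
  also have "\<dots> \<le> (1 - \<nu>) * ((1 - \<alpha>) * (norm v)\<^sup>2)
      + \<nu> * ((1 + 101 / 100 * \<alpha>) * (norm v)\<^sup>2 - \<gamma> * 99 / 100 * ?N)"
    using 1 2 \<nu> by (intro add_mono mult_left_mono) auto
  also have "\<dots> = (1 - (1 - 201 / 100 * \<nu>) * \<alpha>) * (norm v)\<^sup>2 - 99 / 100 * \<nu> * \<gamma> * ?N"
    by (simp add: algebra_simps)
  finally show ?thesis
    using norm_add_power2_le_weighted[OF \<alpha>01(1,2), of ?u z] by simp
qed

end

section \<open>Costs and gradients\<close>

lemma grad_eqI:
  assumes "GDERIV f x :> D"
  shows "grad f x = D"
proof -
  have "D' = D" if "GDERIV f x :> D'" for D'
  proof -
    have "(\<lambda>h. inner h D') = (\<lambda>h. inner h D)"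
      using that assms unfolding gderiv_def by (rule has_derivative_unique)
    then show ?thesis
      by (metis vector_eq_ldot)
  qed
  then show ?thesis
    unfolding grad_def using assms by blast
qed

text \<open>The adjoint of the derivative, evaluated at 1, is its Riesz representative; uniqueness
  identifies it with \<open>grad\<close>.\<close>

lemma GDERIV_grad:
  fixes f :: "'a::euclidean_space \<Rightarrow> real"
  assumes "f differentiable (at x)"
  shows "GDERIV f x :> grad f x"
proof -
  obtain f' where f': "(f has_derivative f') (at x)"
    using assms unfolding differentiable_def by blast
  interpret bounded_linear f' using f' by (rule has_derivative_bounded_linear)
  have "f' = (\<lambda>h. inner h (adjoint f' 1))"
    using adjoint_works[OF linear, of _ 1] by auto
  then have "GDERIV f x :> adjoint f' 1"
    using f' unfolding gderiv_def by metis
  then show ?thesis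
    using grad_eqI by metis
qed

lemma descent_inequality:
  fixes f :: "'a::euclidean_space \<Rightarrow> real"
  assumes diff: "\<And>x. f differentiable (at x)"
    and lip: "\<And>x y. norm (grad f x - grad f y) \<le> L * norm (x - y)"
  shows "f (x + d) \<le> f x + inner (grad f x) d + L / 2 * (norm d)\<^sup>2"
proof -
  \<comment> \<open>The defect of the claimed inequality along the segment. Lipschitz continuity
    makes its derivative nonpositive, so comparing the endpoints suffices.\<close>
  let ?g = "\<lambda>t. f (x + t *\<^sub>R d) - t * inner (grad f x) d - L / 2 * t\<^sup>2 * (norm d)\<^sup>2"
  let ?g' = "\<lambda>t. inner d (grad f (x + t *\<^sub>R d)) - inner (grad f x) d - L * t * (norm d)\<^sup>2"
  have "?g 1 \<le> ?g 0"
  proof (rule DERIV_nonpos_imp_nonincreasing[of 0 1 ?g])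
    fix t :: real assume t: "0 \<le> t" "t \<le> 1"
    have "((\<lambda>t. f (x + t *\<^sub>R d)) has_derivative (\<lambda>s. inner (s *\<^sub>R d) (grad f (x + t *\<^sub>R d)))) (at t)"
      by (rule has_derivative_compose[of "\<lambda>t. x + t *\<^sub>R d" "\<lambda>s. s *\<^sub>R d"])
        (use GDERIV_grad[OF diff, of "x + t *\<^sub>R d"] in
          \<open>auto intro!: derivative_eq_intros simp: gderiv_def\<close>)
    then have "((\<lambda>t. f (x + t *\<^sub>R d)) has_real_derivative inner d (grad f (x + t *\<^sub>R d))) (at t)"
      by (simp add: has_field_derivative_def mult_commute_abs)
    then have "(?g has_real_derivative ?g' t) (at t)"
      by (auto intro!: derivative_eq_intros)
    moreover have "?g' t \<le> 0"
    proof -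
      have "inner d (grad f (x + t *\<^sub>R d)) - inner (grad f x) d
          = inner (grad f (x + t *\<^sub>R d) - grad f x) d"
        by (simp add: inner_diff_left inner_commute[of d])
      also have "\<dots> \<le> norm (grad f (x + t *\<^sub>R d) - grad f x) * norm d"
        by (rule norm_cauchy_schwarz)
      also have "\<dots> \<le> L * norm (t *\<^sub>R d) * norm d"
        using lip[of "x + t *\<^sub>R d" x] by (intro mult_right_mono) auto
      finally show ?thesis
        using t by (simp add: power2_eq_square mult_ac)
    qed
    ultimately show "\<exists>y. (?g has_real_derivative y) (at t) \<and> y \<le> 0" by blast
  qed simp
  then show ?thesis by simp
qed

locale costs =
  fixes F :: "'n::finite \<Rightarrow> real^'d \<Rightarrow> real" and Lf :: real
  assumes differentiable: "\<And>i x. F i differentiable (at x)"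
    and argmin: "\<exists>x. is_arg_min (avg_cost F) (\<lambda>_. True) x"
    and Lf: "0 < Lf"
    and Lipschitz: "\<And>i x y. norm (grad (F i) x - grad (F i) y) \<le> Lf * norm (x - y)"
begin

text \<open>The minimizer makes the range bounded below; without that the real infimum would carry
  no information.\<close>

lemma opt_value_le: "opt_value F \<le> avg_cost F x"
proof -
  obtain x0 where "is_arg_min (avg_cost F) (\<lambda>_. True) x0" using argmin by blast
  then have "avg_cost F x0 \<le> avg_cost F y" for y
    by (simp add: is_arg_min_linorder)
  then have "bdd_below (range (avg_cost F))" by (meson bdd_belowI2)
  then show ?thesis
    unfolding opt_value_def by (rule cINF_lower) simp
qed

lemma GDERIV_avg_cost:
  "GDERIV (avg_cost F) x :> average (\<chi> i. grad (F i) x)"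
proof -
  have "(F i has_derivative (\<lambda>h. inner h (grad (F i) x))) (at x)" for i
    using GDERIV_grad[OF differentiable] by (simp add: gderiv_def)
  then have "((\<lambda>x. (1 / real CARD('n)) * (\<Sum>i\<in>UNIV. F i x)) has_derivative
      (\<lambda>h. (1 / real CARD('n)) * (\<Sum>i\<in>UNIV. inner h (grad (F i) x)))) (at x)"
    by (intro has_derivative_mult_right has_derivative_sum)
  then show ?thesis
    unfolding gderiv_def avg_cost_def[abs_def] average_def
    by (simp add: inner_sum_right)
qed

lemma avg_cost_differentiable: "avg_cost F differentiable (at x)"
  using GDERIV_avg_cost unfolding gderiv_def differentiable_def by blast

lemma grad_avg_cost: "grad (avg_cost F) x = average (\<chi> i. grad (F i) x)"
  by (rule grad_eqI) (rule GDERIV_avg_cost)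

lemma norm_stacked_grad_diff_le:
  "norm (stacked_grad F u - stacked_grad F v) \<le> Lf * norm (u - v)"
proof (rule power2_le_imp_le)
  have "(norm (stacked_grad F u - stacked_grad F v))\<^sup>2
      = (\<Sum>i\<in>UNIV. (norm (grad (F i) (u $ i) - grad (F i) (v $ i)))\<^sup>2)"
    by (simp add: norm_vec_power2[where 'a="real^'d"] stacked_grad_def)
  also have "\<dots> \<le> (\<Sum>i\<in>UNIV. (Lf * norm (u $ i - v $ i))\<^sup>2)"
    by (intro sum_mono power_mono Lipschitz) auto
  also have "\<dots> = (Lf * norm (u - v))\<^sup>2"
    by (simp add: norm_vec_power2[where 'a="real^'d"] power_mult_distrib sum_distrib_left)
  finally show "(norm (stacked_grad F u - stacked_grad F v))\<^sup>2 \<le> (Lf * norm (u - v))\<^sup>2" .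
qed (use Lf in simp)

text \<open>The factor \<open>n\<close> costs nothing: \<open>n\<close> times the squared mean is
  the squared norm of the orthogonal projection onto consensus.\<close>

lemma norm_average_stacked_grad_diff_le:
  "real CARD('n) * (norm (average (stacked_grad F u) - average (stacked_grad F v)))\<^sup>2
    \<le> Lf\<^sup>2 * (norm (u - v))\<^sup>2"
proof -
  have "real CARD('n) * (norm (average (stacked_grad F u) - average (stacked_grad F v)))\<^sup>2
      = (norm (consensus (stacked_grad F u - stacked_grad F v)))\<^sup>2"
    by (simp add: norm_consensus_power2 average_diff)
  also have "\<dots> \<le> (Lf * norm (u - v))\<^sup>2"
    using norm_consensus_le norm_stacked_grad_diff_le by (intro power_mono) (auto intro: order_trans)
  finally show ?thesis by (simp add: power_mult_distrib)
qed

lemma grad_avg_cost_average: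
  "grad (avg_cost F) (average v) = average (stacked_grad F (consensus v))"
  by (simp add: grad_avg_cost stacked_grad_def consensus_def)

lemma avg_cost_Lipschitz:
  "norm (grad (avg_cost F) x - grad (avg_cost F) y) \<le> Lf * norm (x - y)"
proof (rule power2_le_imp_le)
  let ?c = "\<lambda>x. (\<chi> i. x) :: real^'d^'n"
  have g: "grad (avg_cost F) z = average (stacked_grad F (?c z))" for z
    by (simp add: grad_avg_cost stacked_grad_def)
  have "real CARD('n) * (norm (grad (avg_cost F) x - grad (avg_cost F) y))\<^sup>2
      \<le> Lf\<^sup>2 * (norm (?c x - ?c y))\<^sup>2"
    unfolding g by (rule norm_average_stacked_grad_diff_le)
  also have "\<dots> = real CARD('n) * (Lf * norm (x - y))\<^sup>2"
    by (simp add: norm_vec_power2[where 'a="real^'d"] power_mult_distrib)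
  finally show "(norm (grad (avg_cost F) x - grad (avg_cost F) y))\<^sup>2 \<le> (Lf * norm (x - y))\<^sup>2"
    by simp
qed (use Lf in simp)

text \<open>Polarization expresses \<open>inner ?G ?y\<close> by the squares of \<open>?G\<close>,
  \<open>?y\<close> and \<open>?y - ?G\<close>, the last being a consensus error by Lipschitz
  continuity. Half of the negative square of \<open>?y\<close> pays for the quadratic term of the
  descent inequality, since \<open>\<eta> * Lf \<le> 1 / 2\<close>; the other half will absorb the
  mean of \<open>Y\<close> in the increment of \<open>X\<close>.\<close>

lemma average_gradient_descent:
  assumes \<eta>: "0 < \<eta>" "\<eta> \<le> 1 / (2 * Lf)"
  shows "real CARD('n) * avg_cost F (average v - \<eta> *\<^sub>R average (stacked_grad F v))
    \<le> real CARD('n) * avg_cost F (average v)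
      - \<eta> / 2 * (real CARD('n) * (norm (grad (avg_cost F) (average v)))\<^sup>2)
      - \<eta> / 4 * (norm (consensus (stacked_grad F v)))\<^sup>2
      + \<eta> / 2 * Lf\<^sup>2 * (norm (v - consensus v))\<^sup>2"
proof -
  let ?n = "real CARD('n)" and ?x = "average v" and ?y = "average (stacked_grad F v)"
  let ?G = "grad (avg_cost F) ?x"
  have "avg_cost F (?x + (- \<eta>) *\<^sub>R ?y)
      \<le> avg_cost F ?x + inner ?G ((- \<eta>) *\<^sub>R ?y) + Lf / 2 * (norm ((- \<eta>) *\<^sub>R ?y))\<^sup>2"
    by (rule descent_inequality[OF avg_cost_differentiable avg_cost_Lipschitz])
  then have 1: "avg_cost F (?x - \<eta> *\<^sub>R ?y)
      \<le> avg_cost F ?x - \<eta> * inner ?G ?y + Lf / 2 * \<eta>\<^sup>2 * (norm ?y)\<^sup>2"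
    by (simp add: power_mult_distrib)
  have 2: "inner ?G ?y = ((norm ?G)\<^sup>2 + (norm ?y)\<^sup>2 - (norm (?y - ?G))\<^sup>2) / 2"
    by (simp add: power2_norm_eq_inner inner_diff_left inner_diff_right inner_commute)
  have 3: "Lf / 2 * \<eta>\<^sup>2 * (norm ?y)\<^sup>2 \<le> \<eta> / 4 * (norm ?y)\<^sup>2"
  proof (rule mult_right_mono)
    have "\<eta> * Lf \<le> 1 / 2" using \<eta> Lf by (simp add: field_simps)
    then have "\<eta> / 2 * (\<eta> * Lf) \<le> \<eta> / 2 * (1 / 2)" using \<eta> by (intro mult_left_mono) auto
    then show "Lf / 2 * \<eta>\<^sup>2 \<le> \<eta> / 4" by (simp add: power2_eq_square mult_ac)
  qed simp
  have 4: "avg_cost F (?x - \<eta> *\<^sub>R ?y)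
      \<le> avg_cost F ?x - \<eta> / 2 * (norm ?G)\<^sup>2 - \<eta> / 4 * (norm ?y)\<^sup>2 + \<eta> / 2 * (norm (?y - ?G))\<^sup>2"
    using 1 3 unfolding 2 by (simp add: field_simps)
  have "?n * avg_cost F (?x - \<eta> *\<^sub>R ?y) \<le> ?n * avg_cost F ?x - \<eta> / 2 * (?n * (norm ?G)\<^sup>2)
      - \<eta> / 4 * (?n * (norm ?y)\<^sup>2) + \<eta> / 2 * (?n * (norm (?y - ?G))\<^sup>2)"
    using mult_left_mono[OF 4, of ?n] by (simp add: algebra_simps)
  moreover have "?n * (norm (?y - ?G))\<^sup>2 \<le> Lf\<^sup>2 * (norm (v - consensus v))\<^sup>2"
    unfolding grad_avg_cost_average by (rule norm_average_stacked_grad_diff_le)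
  then have "\<eta> / 2 * (?n * (norm (?y - ?G))\<^sup>2) \<le> \<eta> / 2 * (Lf\<^sup>2 * (norm (v - consensus v))\<^sup>2)"
    using \<eta> by (intro mult_left_mono) auto
  ultimately show ?thesis
    by (simp add: norm_consensus_power2)
qed

end

section \<open>The one-step inequality\<close>

text \<open>\<open>a\<close> stands for \<open>1 - \<sigma>\<close> and \<open>K\<close> for the
  constant \<open>C\<close> of the compressor. The conditions are consequences of the parameter
  bounds with denominators cleared. The bounds \<open>1 / 2\<close> on \<open>c1\<close> and
  \<open>c2\<close> come from \<open>p * r < 1\<close> and \<open>\<psi> \<le> 1\<close>.\<close>

locale step_sizes =
  fixes a L c1 c2 K \<phi> \<phi>h \<gamma> \<eta> :: real
  assumes a: "0 < a" "a < 1" and L: "0 < L"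
    and c1: "0 < c1" "c1 \<le> 1 / 2" and c2: "0 < c2" "c2 \<le> 1 / 2" and K: "0 < K"
    and phi: "\<phi> = a\<^sup>2 / (320 * L\<^sup>2)"
    and phih: "0 < \<phi>h" "10 * \<phi>h * K \<le> c1 * (1 + 2 * c1)" "10 * \<phi>h * K \<le> c2 * (1 + 2 * c2)"
    and gamma: "0 < \<gamma>"
      "160 * K * \<gamma> \<le> c1 * a"
      "4 * K * \<gamma> \<le> c2 * L\<^sup>2"
      "64 * \<gamma> \<le> a * \<phi>h"
      "5 * (1 + 1 / c2) * \<gamma> \<le> 1"
      "32 * \<gamma> * (2 * \<phi> + a) \<le> a * \<phi>h"
      "160 * (1 + 1 / c1) * \<gamma> \<le> a"
      "40000 * (1 + 1 / c2) * L\<^sup>2 * \<gamma> \<le> a"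
    and eta: "0 < \<eta>" "40 * L * \<eta> \<le> a\<^sup>2 * \<gamma>" "L\<^sup>2 * \<eta> \<le> 4 / 10 * a * \<gamma>" "\<eta> \<le> \<gamma>"
begin

abbreviation "\<alpha> \<equiv> \<gamma> * a"
abbreviation "m1 \<equiv> 1 + 1 / c1"
abbreviation "m2 \<equiv> 1 + 1 / c2"
abbreviation "\<kappa>1 \<equiv> c1 * (1 + 2 * c1)"
abbreviation "\<kappa>2 \<equiv> c2 * (1 + 2 * c2)"

lemma phi_pos: "0 < \<phi>"
  using a L by (simp add: phi)

text \<open>This is the smallness that \<open>gossip_contraction\<close> requires; it follows from
  \<open>m1 \<ge> 3\<close>.\<close>

lemma gamma_le: "\<gamma> \<le> 1 / 400"
proof -
  have "2 \<le> 1 / c1" using c1 by (simp add: field_simps)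
  then have "160 * 3 * \<gamma> \<le> 160 * m1 * \<gamma>" using gamma by (intro mult_right_mono) auto
  then show ?thesis using gamma(7) a by linarith
qed

lemma alpha_pos: "0 < \<alpha>"
  using a gamma by simp

lemma m2_ge: "3 \<le> m2"
  using c2 by (simp add: field_simps)

lemma m2_gamma: "m2 * \<gamma> \<le> 1 / 5" "0 < m2 * \<gamma>"
proof -
  show "m2 * \<gamma> \<le> 1 / 5" using gamma(5) by (simp add: algebra_simps)
  show "0 < m2 * \<gamma>" using gamma(1) m2_ge by (intro mult_pos_pos) auto
qed

lemma gamma_le_c2: "5 * \<gamma> \<le> c2"
proof -
  have "5 * \<gamma> * (1 / c2) \<le> 5 * m2 * \<gamma>" using gamma c2 by (simp add: algebra_simps)
  then have "5 * \<gamma> / c2 \<le> 1" using gamma(5) by simp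
  then show ?thesis using c2 by (simp add: field_simps)
qed

text \<open>The square of \<open>40 * L * \<eta> \<le> a\<^sup>2 * \<gamma>\<close>, with
  \<open>1600 = 5 * 320\<close> matched to the constant in \<open>\<phi>\<close>. It pays for the
  effect of \<open>y\<close> on \<open>x'\<close> out of the contraction of
  \<open>\<phi> * y\<close>.\<close>

lemma eta_power2_le: "5 * \<eta>\<^sup>2 \<le> \<alpha> * (\<alpha> * \<phi>)"
proof -
  have "(40 * L * \<eta>)\<^sup>2 \<le> (a\<^sup>2 * \<gamma>)\<^sup>2"
    using eta L by (intro power_mono) auto
  then have "5 * \<eta>\<^sup>2 * (320 * L\<^sup>2) \<le> a\<^sup>2 * (\<gamma> * a)\<^sup>2"
    by (simp add: power_mult_distrib power2_eq_square mult_ac)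
  then have "5 * \<eta>\<^sup>2 \<le> a\<^sup>2 * (\<gamma> * a)\<^sup>2 / (320 * L\<^sup>2)"
    using L by (simp add: pos_le_divide_eq)
  also have "\<dots> = \<alpha> * (\<alpha> * \<phi>)"
    by (simp add: phi power2_eq_square)
  finally show ?thesis .
qed

text \<open>\<open>Kd\<close> is the total coefficient of \<open>\<Delta>\<close>, which enters
  through \<open>y'\<close>, \<open>pX'\<close> and \<open>pY'\<close>. As \<open>\<Delta>\<close>
  is of second order in the step sizes, only \<open>\<gamma> * Kd\<close> has to be small. The
  summand \<open>4 / 10000\<close> lacks the factor \<open>a\<close> because it comes from the extra
  weight \<open>s\<close>.\<close>

lemma drift_coeff_le:
  assumes s: "0 \<le> s" "s \<le> 8 * (m2 * \<gamma>)" and wp: "0 \<le> wp" "wp \<le> 1"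
    and Kd: "Kd = (\<phi> + s) * (2 * L\<^sup>2 / \<alpha>) + m1 + 3 * wp * m2 * L\<^sup>2"
  shows "\<gamma> * Kd \<le> 126 / 10000 * a + 4 / 10000" "0 \<le> Kd"
proof -
  have 1: "\<gamma> * (\<phi> * (2 * L\<^sup>2 / \<alpha>)) = a / 160"
    using a L gamma by (simp add: phi field_simps power2_eq_square)
  have "\<gamma> * (s * (2 * L\<^sup>2 / \<alpha>)) = s * (2 * L\<^sup>2 / a)"
    using a gamma by simp
  also have "\<dots> \<le> 8 * (m2 * \<gamma>) * (2 * L\<^sup>2 / a)"
    using s a by (intro mult_right_mono) auto
  also have "\<dots> = 16 * (m2 * L\<^sup>2 * \<gamma>) / a" by simp
  also have "\<dots> \<le> 16 * (a / 40000) / a"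
    using gamma(8) a by (intro divide_right_mono) (auto simp: algebra_simps)
  also have "\<dots> = 4 / 10000" using a by simp
  finally have 2: "\<gamma> * (s * (2 * L\<^sup>2 / \<alpha>)) \<le> 4 / 10000" .
  have 3: "\<gamma> * m1 \<le> a / 160"
    using gamma(7) by (simp add: algebra_simps)
  have m2: "0 \<le> m2" using m2_ge by simp
  have "wp * (\<gamma> * (3 * m2 * L\<^sup>2)) \<le> 1 * (\<gamma> * (3 * m2 * L\<^sup>2))"
    using wp gamma m2 by (intro mult_right_mono) auto
  also have "\<dots> = 3 * (m2 * L\<^sup>2 * \<gamma>)" by simp
  also have "\<dots> \<le> 3 * a / 40000" using gamma(8) by linarith
  finally have 4: "\<gamma> * (3 * wp * m2 * L\<^sup>2) \<le> 3 * a / 40000" by (simp add: mult_ac)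
  have "\<gamma> * Kd = \<gamma> * (\<phi> * (2 * L\<^sup>2 / \<alpha>)) + \<gamma> * (s * (2 * L\<^sup>2 / \<alpha>)) + \<gamma> * m1 + \<gamma> * (3 * wp * m2 * L\<^sup>2)"
    unfolding Kd by (simp only: distrib_left distrib_right)
  then show "\<gamma> * Kd \<le> 126 / 10000 * a + 4 / 10000"
    using 1 2 3 4 a by linarith
  have "0 \<le> (\<phi> + s) * (2 * L\<^sup>2 / \<alpha>)"
    using phi_pos s alpha_pos by simp
  moreover have "0 \<le> 3 * wp * m2 * L\<^sup>2" using wp m2 by simp
  ultimately show "0 \<le> Kd" using c1 unfolding Kd by simp
qed

end

text \<open>
  Primed variables are the expectations at time \<open>k + 1\<close>, unprimed ones those at time \<open>k\<close>. With
  \<open>R v = (I - W) v\<close> they stand for the expected squared norms of: \<open>x\<close>, \<open>y\<close> the consensus errors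
  of \<open>X\<close>, \<open>Y\<close>; \<open>NX = R X\<close>, \<open>NY = R Y\<close>; \<open>pX = X - A\<close>, \<open>pY = Y - C\<close>; \<open>eX\<close>, \<open>eY\<close> the accumulated
  errors; \<open>h\<close> the mean of \<open>Y\<close>; \<open>\<rho>X\<close>, \<open>\<rho>Y\<close> the compression errors in the update; \<open>\<Delta>\<close> the increment of
  \<open>X\<close>; \<open>g\<close> the gradient at the mean. The optimality gap is \<open>f\<close>.
\<close>

locale one_step = step_sizes +
  fixes x y NX NY pX pY eX eY h g f \<rho>X \<rho>Y \<Delta> x' y' pX' pY' eX' eY' f' :: real
  assumes nonneg: "0 \<le> x" "0 \<le> y" "0 \<le> NX" "0 \<le> NY" "0 \<le> pX" "0 \<le> pY" "0 \<le> eX" "0 \<le> eY"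
      "0 \<le> h" "0 \<le> \<rho>X" "0 \<le> \<rho>Y"
    and NX: "NX \<le> 4 * x" and NY: "NY \<le> 4 * y"
    and \<rho>X: "\<rho>X \<le> 2 * eX + 4 * K * pX" and \<rho>Y: "\<rho>Y \<le> 2 * eY + 4 * K * pY"
    and \<Delta>: "\<Delta> \<le> 4 * \<gamma>\<^sup>2 * NX + 16 * \<gamma>\<^sup>2 * \<rho>X + 4 * \<eta>\<^sup>2 * y + 4 * \<eta>\<^sup>2 * h"
    and x': "x' \<le> (1 - 8995 / 10000 * (\<gamma> * a)) * x - 495 / 10000 * \<gamma> * NX + 8 * \<gamma> / a * \<rho>X
      + 2 * \<eta>\<^sup>2 / (\<gamma> * a) * y"
    and y1: "y' \<le> (1 - 8995 / 10000 * (\<gamma> * a)) * y - 495 / 10000 * \<gamma> * NY + 8 * \<gamma> / a * \<rho>Y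
      + 2 * L\<^sup>2 / (\<gamma> * a) * \<Delta>"
    and y2: "y' \<le> y - 396 / 1000 * \<gamma> * NY + 8 * \<gamma> / a * \<rho>Y + 2 * L\<^sup>2 / (\<gamma> * a) * \<Delta>"
    and pX': "pX' \<le> (1 - c1 * (1 + 2 * c1)) * pX + (1 + 1 / c1) * \<Delta>"
    and pY': "pY' \<le> (1 - c2 * (1 + 2 * c2)) * pY
      + 3 * (1 + 1 / c2) * (\<gamma>\<^sup>2 * NY + 4 * \<gamma>\<^sup>2 * \<rho>Y + L\<^sup>2 * \<Delta>)"
    and eX': "eX' \<le> eX / 2 + 2 * K * pX" and eY': "eY' \<le> eY / 2 + 2 * K * pY"
    and f': "f' \<le> f - \<eta> / 2 * g - \<eta> / 4 * h + \<eta> / 2 * L\<^sup>2 * x"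
begin

text \<open>
  \<open>wp\<close> is the weight of \<open>pY\<close> and \<open>\<phi> + s\<close> the one of \<open>y\<close>. The additional weight \<open>s\<close> produces the
  dissipation of \<open>NY\<close> that absorbs the noise which \<open>y\<close> injects into \<open>pY\<close>.
\<close>

lemma weighted_step:
  assumes s: "0 \<le> s" "s \<le> 8 * (m2 * \<gamma>)" "s \<le> 1" and wp: "0 \<le> wp" "wp \<le> 1"
  shows "x' + (\<phi> + s) * y' + pX' + wp * pY' + \<phi>h * (eX' + eY') + f'
    \<le> (1 - 49 / 100 * \<alpha>) * x + (1 - 47 / 100 * \<alpha>) * (\<phi> * y) + s * y + (1 - 1 / 2 * \<kappa>1) * pX
      + (wp - wp * \<kappa>2 + 23 / 100 * \<kappa>2) * pY + \<phi>h * (eX + eY) + f - \<eta> / 2 * g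
      + (3 * wp * m2 * \<gamma>\<^sup>2 - 396 / 1000 * \<gamma> * s) * NY"
proof -
  \<comment> \<open>\<open>u\<close>, \<open>w\<close> and \<open>v\<close> are the coefficients
    with which compression errors, \<open>\<Delta>\<close> and \<open>y\<close> enter the consensus
    errors; \<open>Kd\<close> and \<open>RY\<close> collect all contributions of
    \<open>\<Delta>\<close> and \<open>\<rho>Y\<close>.\<close>
  define u where "u = 8 * \<gamma> / a"
  define w where "w = 2 * L\<^sup>2 / \<alpha>"
  define v where "v = 2 * \<eta>\<^sup>2 / \<alpha>"
  define n1 where "n1 = m1"
  define n2 where "n2 = m2"
  define Kd where "Kd = (\<phi> + s) * w + n1 + 3 * wp * n2 * L\<^sup>2"
  define RY where "RY = (\<phi> + s) * u + 12 * wp * n2 * \<gamma>\<^sup>2"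
  have Kd: "\<gamma> * Kd \<le> 126 / 10000 * a + 4 / 10000" "0 \<le> Kd"
    using drift_coeff_le[OF s(1,2) wp] by (simp_all add: Kd_def w_def n1_def n2_def)
  have Kd13: "\<gamma> * Kd \<le> 13 / 1000" using Kd a by linarith
  have n2: "3 \<le> n2" using m2_ge by (simp add: n2_def)
  note phi0 = phi_pos and gamma0 = gamma(1) and eta0 = eta(1) and a0 = a(1)
  have n2g: "n2 * \<gamma> \<le> 1 / 5" using gamma(5) by (simp add: n2_def algebra_simps)
  have u8: "8 * u \<le> \<phi>h"
    unfolding u_def using gamma(4) a by (simp add: field_simps)
  have ug: "8 * \<gamma> \<le> u"
    unfolding u_def using a gamma0 by (simp add: field_simps)
  have u0: "0 \<le> u" using ug gamma0 by linarith
  have \<phi>u: "2 * (\<phi> * u) + 8 * \<gamma> \<le> \<phi>h / 4"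
    unfolding u_def using gamma(6) a by (simp add: field_simps)
  have Ku: "20 * (K * u) \<le> c1"
    unfolding u_def using gamma(2) a by (simp add: field_simps)
  have Kg: "160 * (K * \<gamma>) \<le> c1"
  proof -
    have "c1 * a \<le> c1 * 1" using c1 a by (intro mult_left_mono) auto
    then show ?thesis using gamma(2) by simp
  qed

  \<comment> \<open>The two bounds on \<open>y'\<close> serve different shares of its weight: the
    share \<open>\<phi>\<close> uses the contracting \<open>y1\<close>, whose decrease pays for the
    \<open>\<eta>\<close> terms, and the share \<open>s\<close> uses \<open>y2\<close>, which keeps
    \<open>y\<close> but dissipates \<open>NY\<close> strongly.\<close>
  have \<phi>y': "\<phi> * y' \<le> \<phi> * ((1 - 8995 / 10000 * \<alpha>) * y - 495 / 10000 * \<gamma> * NY + u * \<rho>Y + w * \<Delta>)"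
    using y1 phi0 unfolding u_def w_def by (intro mult_left_mono) auto
  have sy': "s * y' \<le> s * (y - 396 / 1000 * \<gamma> * NY + u * \<rho>Y + w * \<Delta>)"
    using y2 s(1) unfolding u_def w_def by (intro mult_left_mono) auto
  have wpY': "wp * pY' \<le> wp * ((1 - \<kappa>2) * pY + 3 * n2 * (\<gamma>\<^sup>2 * NY + 4 * \<gamma>\<^sup>2 * \<rho>Y + L\<^sup>2 * \<Delta>))"
    using pY' wp unfolding n2_def by (intro mult_left_mono) auto
  have \<phi>he': "\<phi>h * (eX' + eY') \<le> \<phi>h * ((eX + eY) / 2 + 2 * K * (pX + pY))"
  proof (rule mult_left_mono)
    show "eX' + eY' \<le> (eX + eY) / 2 + 2 * K * (pX + pY)"
      using eX' eY' unfolding distrib_left add_divide_distrib by linarith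
  qed (use phih in simp)
  have sum: "x' + (\<phi> + s) * y' + pX' + wp * pY' + \<phi>h * (eX' + eY') + f' \<le>
      f - \<eta> / 2 * g - \<eta> / 4 * h + \<eta> / 2 * L\<^sup>2 * x
      + (1 - 8995 / 10000 * \<alpha>) * x - 495 / 10000 * \<gamma> * NX + u * \<rho>X + v * y
      + (1 - 8995 / 10000 * \<alpha>) * (\<phi> * y) - 495 / 10000 * \<gamma> * \<phi> * NY
      + s * y - 396 / 1000 * \<gamma> * s * NY
      + (1 - \<kappa>1) * pX + wp * (1 - \<kappa>2) * pY + 3 * wp * n2 * \<gamma>\<^sup>2 * NY
      + RY * \<rho>Y + Kd * \<Delta> + \<phi>h * ((eX + eY) / 2 + 2 * K * (pX + pY))"
  proof -
    have "x' + (\<phi> + s) * y' + pX' + wp * pY' + \<phi>h * (eX' + eY') + f'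
        = x' + \<phi> * y' + s * y' + pX' + wp * pY' + \<phi>h * (eX' + eY') + f'"
      by (simp add: algebra_simps)
    also have "\<dots> \<le> ((1 - 8995 / 10000 * \<alpha>) * x - 495 / 10000 * \<gamma> * NX + u * \<rho>X + v * y)
       + \<phi> * ((1 - 8995 / 10000 * \<alpha>) * y - 495 / 10000 * \<gamma> * NY + u * \<rho>Y + w * \<Delta>)
       + s * (y - 396 / 1000 * \<gamma> * NY + u * \<rho>Y + w * \<Delta>)
       + ((1 - \<kappa>1) * pX + n1 * \<Delta>)
       + wp * ((1 - \<kappa>2) * pY + 3 * n2 * (\<gamma>\<^sup>2 * NY + 4 * \<gamma>\<^sup>2 * \<rho>Y + L\<^sup>2 * \<Delta>))
       + \<phi>h * ((eX + eY) / 2 + 2 * K * (pX + pY))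
       + (f - \<eta> / 2 * g - \<eta> / 4 * h + \<eta> / 2 * L\<^sup>2 * x)"
      using x' pX' f' \<phi>y' sy' wpY' \<phi>he' unfolding u_def v_def n1_def
      by (intro add_mono) auto
    also have "\<dots> = f - \<eta> / 2 * g - \<eta> / 4 * h + \<eta> / 2 * L\<^sup>2 * x
      + (1 - 8995 / 10000 * \<alpha>) * x - 495 / 10000 * \<gamma> * NX + u * \<rho>X + v * y
      + (1 - 8995 / 10000 * \<alpha>) * (\<phi> * y) - 495 / 10000 * \<gamma> * \<phi> * NY
      + s * y - 396 / 1000 * \<gamma> * s * NY
      + (1 - \<kappa>1) * pX + wp * (1 - \<kappa>2) * pY + 3 * wp * n2 * \<gamma>\<^sup>2 * NY
      + RY * \<rho>Y + Kd * \<Delta> + \<phi>h * ((eX + eY) / 2 + 2 * K * (pX + pY))"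
      unfolding Kd_def RY_def by algebra
    finally show ?thesis .
  qed

  have "Kd * \<Delta> \<le> Kd * (4 * \<gamma>\<^sup>2 * NX + 16 * \<gamma>\<^sup>2 * \<rho>X + 4 * \<eta>\<^sup>2 * y + 4 * \<eta>\<^sup>2 * h)"
    using \<Delta> Kd(2) by (rule mult_left_mono)
  also have "\<dots> = (\<gamma> * Kd) * (4 * \<gamma> * NX) + (\<gamma> * Kd) * (16 * \<gamma> * \<rho>X)
      + Kd * \<eta>\<^sup>2 * (4 * y) + Kd * \<eta>\<^sup>2 * (4 * h)"
    by (simp add: algebra_simps power2_eq_square)
  finally have Kd\<Delta>: "Kd * \<Delta> \<le> (\<gamma> * Kd) * (4 * \<gamma> * NX) + (\<gamma> * Kd) * (16 * \<gamma> * \<rho>X)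
      + Kd * \<eta>\<^sup>2 * (4 * y) + Kd * \<eta>\<^sup>2 * (4 * h)" .
  \<comment> \<open>The part of \<open>\<gamma> * Kd\<close> proportional to \<open>a\<close>
    becomes a multiple of \<open>\<alpha> * x\<close> by \<open>NX \<le> 4 * x\<close>. The constant
    part cannot be compared with \<open>\<alpha> * x\<close>; it stays on \<open>NX\<close> and is
    later covered by the dissipation \<open>495 / 10000 * \<gamma> * NX\<close>.\<close>
  have dNX: "(\<gamma> * Kd) * (4 * \<gamma> * NX) \<le> 2016 / 10000 * \<alpha> * x + 16 / 10000 * \<gamma> * NX"
  proof -
    have "(\<gamma> * Kd) * (4 * \<gamma> * NX) \<le> (126 / 10000 * a + 4 / 10000) * (4 * \<gamma> * NX)"
      using Kd gamma0 nonneg by (intro mult_right_mono) auto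
    also have "\<dots> = 504 / 10000 * \<alpha> * NX + 16 / 10000 * \<gamma> * NX" by (simp add: algebra_simps)
    also have "504 / 10000 * \<alpha> * NX \<le> 504 / 10000 * \<alpha> * (4 * x)"
      using NX alpha_pos by (intro mult_left_mono) auto
    finally show ?thesis by simp
  qed
  have d\<rho>X: "(\<gamma> * Kd) * (16 * \<gamma> * \<rho>X) \<le> 208 / 1000 * \<gamma> * \<rho>X"
    using mult_right_mono[OF Kd13, of "16 * \<gamma> * \<rho>X"] gamma0 nonneg by simp
  have dy: "Kd * \<eta>\<^sup>2 * (4 * y) \<le> 2 / 100 * \<alpha> * (\<phi> * y)"
  proof -
    have "Kd * \<eta>\<^sup>2 \<le> Kd * (\<alpha> * (\<alpha> * \<phi>) / 5)"
      using eta_power2_le Kd(2) by (intro mult_left_mono) auto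
    also have "\<dots> = (\<gamma> * Kd) * (a * (\<alpha> * \<phi>) / 5)" by simp
    also have "\<dots> \<le> 13 / 1000 * (a * (\<alpha> * \<phi>) / 5)"
      using Kd13 a0 gamma0 phi0 by (intro mult_right_mono) auto
    also have "\<dots> \<le> 13 / 1000 * (1 * (\<alpha> * \<phi>) / 5)"
      using a gamma0 phi0 by (intro mult_left_mono divide_right_mono mult_right_mono) auto
    also have "\<dots> \<le> 5 / 1000 * (\<alpha> * \<phi>)" using a0 gamma0 phi0 by simp
    finally have "Kd * \<eta>\<^sup>2 * (4 * y) \<le> 5 / 1000 * (\<alpha> * \<phi>) * (4 * y)"
      using nonneg by (intro mult_right_mono) auto
    then show ?thesis by (simp add: mult_ac)
  qed
  \<comment> \<open>The mean of \<open>Y\<close> is in no consensus error; it is absorbed entirely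
    by the term \<open>\<eta> / 4 * h\<close> of the cost descent.\<close>
  have dh: "Kd * \<eta>\<^sup>2 * (4 * h) \<le> \<eta> / 4 * h"
  proof -
    have "Kd * \<eta>\<^sup>2 \<le> Kd * (\<gamma> * \<eta>)"
      using eta Kd(2) by (intro mult_left_mono) (auto simp: power2_eq_square)
    also have "\<dots> = (\<gamma> * Kd) * \<eta>" by simp
    also have "\<dots> \<le> 13 / 1000 * \<eta>" using Kd13 eta0 by (intro mult_right_mono) auto
    also have "\<dots> \<le> \<eta> / 16" using eta0 by simp
    finally have "Kd * \<eta>\<^sup>2 * (4 * h) \<le> \<eta> / 16 * (4 * h)"
      using nonneg by (intro mult_right_mono) auto
    then show ?thesis by simp
  qed
  have vy: "v * y \<le> 4 / 10 * \<alpha> * (\<phi> * y)"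
  proof -
    have "v \<le> 4 / 10 * (\<alpha> * \<phi>)"
      unfolding v_def using eta_power2_le alpha_pos by (simp add: field_simps)
    then show ?thesis using mult_right_mono[of v "4 / 10 * (\<alpha> * \<phi>)" y] nonneg by simp
  qed
  have fx: "\<eta> / 2 * L\<^sup>2 * x \<le> 2 / 10 * \<alpha> * x"
    using eta(3) nonneg by (intro mult_right_mono) (auto simp: mult_ac)
  \<comment> \<open>The halving of \<open>eX\<close> in one step frees
    \<open>\<phi>h / 2 * eX\<close>, which covers the \<open>eX\<close> part of
    \<open>\<rho>X\<close>; the \<open>pX\<close> part is charged to the contraction of
    \<open>pX\<close>.\<close>
  have rX: "u * \<rho>X + 208 / 1000 * \<gamma> * \<rho>X \<le> \<phi>h / 2 * eX + 21 / 100 * \<kappa>1 * pX"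
  proof -
    have "u * \<rho>X + 208 / 1000 * \<gamma> * \<rho>X = (u + 208 / 1000 * \<gamma>) * \<rho>X" by (simp add: algebra_simps)
    also have "\<dots> \<le> (u + 208 / 1000 * \<gamma>) * (2 * eX + 4 * K * pX)"
      using \<rho>X u0 gamma0 by (intro mult_left_mono) auto
    also have "\<dots> = (2 * u + 416 / 1000 * \<gamma>) * eX + (4 * (K * u) + 832 / 1000 * (K * \<gamma>)) * pX"
      by (simp add: algebra_simps)
    also have "\<dots> \<le> \<phi>h / 2 * eX + 21 / 100 * \<kappa>1 * pX"
    proof (intro add_mono mult_right_mono)
      show "2 * u + 416 / 1000 * \<gamma> \<le> \<phi>h / 2" using u8 ug gamma0 by linarith
      have "c1 \<le> \<kappa>1" using c1 by (simp add: algebra_simps)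
      then show "4 * (K * u) + 832 / 1000 * (K * \<gamma>) \<le> 21 / 100 * \<kappa>1"
        using Ku Kg c1 by linarith
    qed (use nonneg in auto)
    finally show ?thesis .
  qed
  have rY: "RY * \<rho>Y \<le> \<phi>h / 2 * eY + 3 / 100 * \<kappa>2 * pY"
  proof -
    have RY0: "0 \<le> RY"
      unfolding RY_def using phi0 s u0 wp n2 by simp
    have "wp * (n2 * \<gamma>\<^sup>2) \<le> 1 * (n2 * \<gamma>\<^sup>2)"
      using wp n2 by (intro mult_right_mono) auto
    then have wn: "wp * (n2 * \<gamma>\<^sup>2) \<le> (n2 * \<gamma>) * \<gamma>" by (simp add: power2_eq_square)
    have su: "s * u \<le> u" using s u0 by (simp add: mult_left_le_one_le)
    have RYe: "2 * RY \<le> \<phi>h / 2"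
    proof -
      have "(n2 * \<gamma>) * \<gamma> \<le> 1 / 5 * \<gamma>" using n2g gamma0 by (intro mult_right_mono) auto
      then have "24 * (wp * (n2 * \<gamma>\<^sup>2)) \<le> 8 * \<gamma>" using wn gamma0 by linarith
      moreover have "2 * RY = 2 * (\<phi> * u) + 2 * (s * u) + 24 * (wp * (n2 * \<gamma>\<^sup>2))"
        by (simp add: RY_def algebra_simps)
      ultimately show ?thesis using \<phi>u su u8 by linarith
    qed
    have RYp: "4 * (K * RY) \<le> 3 / 100 * \<kappa>2"
    proof -
      have Ku2: "K * u \<le> 2 * c2 * L\<^sup>2 / a"
        unfolding u_def using gamma(3) a by (simp add: field_simps)
      have "4 * (\<phi> * (K * u)) \<le> 4 * (\<phi> * (2 * c2 * L\<^sup>2 / a))"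
        using Ku2 phi0 by (intro mult_left_mono) auto
      also have "\<dots> = 25 / 1000 * (c2 * a)" using a L by (simp add: phi power2_eq_square)
      also have "\<dots> \<le> 25 / 1000 * (c2 * 1)" using a c2 by (intro mult_left_mono) auto
      finally have 1: "4 * (\<phi> * (K * u)) \<le> 25 / 1000 * c2" by simp
      have n2L: "L\<^sup>2 * (n2 * \<gamma>) \<le> a / 40000"
        using gamma(8) by (simp add: n2_def algebra_simps)
      have "s * (K * u) \<le> 8 * (n2 * \<gamma>) * (2 * c2 * L\<^sup>2 / a)"
        using Ku2 s K u0 n2 gamma0 unfolding n2_def by (intro mult_mono) auto
      also have "\<dots> = 16 * c2 / a * (L\<^sup>2 * (n2 * \<gamma>))" by simp
      also have "\<dots> \<le> 16 * c2 / a * (a / 40000)"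
        using n2L c2 a by (intro mult_left_mono) auto
      also have "\<dots> = 4 / 10000 * c2" using a by simp
      finally have 2: "4 * (s * (K * u)) \<le> 16 / 10000 * c2" by simp
      have "48 * (K * (wp * (n2 * \<gamma>\<^sup>2))) \<le> 48 * (K * ((n2 * \<gamma>) * \<gamma>))"
        using wn K by (intro mult_left_mono) auto
      also have "\<dots> = 12 * (4 * K * \<gamma>) * (n2 * \<gamma>)" by simp
      also have "\<dots> \<le> 12 * (c2 * L\<^sup>2) * (n2 * \<gamma>)"
        using gamma(3) n2 gamma0 by (intro mult_right_mono mult_left_mono) auto
      also have "\<dots> = 12 * c2 * (L\<^sup>2 * (n2 * \<gamma>))" by simp
      also have "\<dots> \<le> 12 * c2 * (1 / 40000)"
        using n2L c2 a by (intro mult_left_mono) auto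
      finally have 3: "48 * (K * (wp * (n2 * \<gamma>\<^sup>2))) \<le> 3 / 10000 * c2" by simp
      have "4 * (K * RY) = 4 * (\<phi> * (K * u)) + 4 * (s * (K * u)) + 48 * (K * (wp * (n2 * \<gamma>\<^sup>2)))"
        by (simp add: RY_def algebra_simps)
      moreover have "c2 \<le> \<kappa>2" using c2 by (simp add: algebra_simps)
      ultimately show ?thesis using 1 2 3 c2 by linarith
    qed
    have "RY * \<rho>Y \<le> RY * (2 * eY + 4 * K * pY)"
      using \<rho>Y RY0 by (rule mult_left_mono)
    also have "\<dots> = 2 * RY * eY + 4 * (K * RY) * pY" by (simp add: algebra_simps)
    also have "\<dots> \<le> \<phi>h / 2 * eY + 3 / 100 * \<kappa>2 * pY"
      using RYe RYp nonneg by (intro add_mono mult_right_mono) auto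
    finally show ?thesis .
  qed
  \<comment> \<open>The factor \<open>0.1 / C\<close> in \<open>\<phi>h\<close> is chosen here: the
    compression noise fed into the accumulated errors costs only a fifth of
    \<open>\<kappa>1 * pX\<close> and \<open>\<kappa>2 * pY\<close>.\<close>
  have eP: "\<phi>h * ((eX + eY) / 2 + 2 * K * (pX + pY))
      \<le> \<phi>h / 2 * eX + \<phi>h / 2 * eY + 2 / 10 * \<kappa>1 * pX + 2 / 10 * \<kappa>2 * pY"
  proof -
    have "2 * (\<phi>h * K) * pX \<le> 2 / 10 * \<kappa>1 * pX" "2 * (\<phi>h * K) * pY \<le> 2 / 10 * \<kappa>2 * pY"
      using mult_right_mono[OF phih(2) nonneg(5)] mult_right_mono[OF phih(3) nonneg(6)] by simp_all
    then show ?thesis by (simp add: algebra_simps add_divide_distrib)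
  qed
  have NXneg: "16 / 10000 * \<gamma> * NX \<le> 495 / 10000 * \<gamma> * NX"
    using gamma0 nonneg by simp
  have NYpos: "0 \<le> 495 / 10000 * \<gamma> * \<phi> * NY" using gamma0 phi0 nonneg by simp
  have pXc: "41 / 100 * \<kappa>1 * pX \<le> 1 / 2 * \<kappa>1 * pX" using c1 nonneg by simp
  have xc: "0 \<le> \<alpha> * x" and yc: "0 \<le> \<alpha> * (\<phi> * y)"
    using alpha_pos phi0 nonneg by auto
  \<comment> \<open>The balance: \<open>0.8995 - 0.2016 - 0.2\<close> exceeds \<open>0.49\<close>
    for \<open>x\<close>, \<open>0.8995 - 0.4 - 0.02\<close> exceeds \<open>0.47\<close> for
    \<open>\<phi> * y\<close>, \<open>0.21 + 0.2\<close> stays below \<open>1 / 2\<close> for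
    \<open>pX\<close>, and \<open>pY\<close> is charged \<open>0.03 + 0.2\<close>.\<close>
  have "x' + (\<phi> + s) * y' + pX' + wp * pY' + \<phi>h * (eX' + eY') + f' \<le>
      f - \<eta> / 2 * g
      + (1 - 8995 / 10000 * \<alpha>) * x + 2016 / 10000 * \<alpha> * x + 2 / 10 * \<alpha> * x
      + (1 - 8995 / 10000 * \<alpha>) * (\<phi> * y) + 4 / 10 * \<alpha> * (\<phi> * y) + 2 / 100 * \<alpha> * (\<phi> * y)
      + s * y - 396 / 1000 * \<gamma> * s * NY
      + (1 - \<kappa>1) * pX + wp * (1 - \<kappa>2) * pY + 3 * wp * n2 * \<gamma>\<^sup>2 * NY
      + \<phi>h * eX + \<phi>h * eY + 41 / 100 * \<kappa>1 * pX + 23 / 100 * \<kappa>2 * pY"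
    using sum Kd\<Delta> dNX d\<rho>X dy dh vy fx rX rY eP NXneg NYpos by linarith
  also have "\<dots> \<le> (1 - 49 / 100 * \<alpha>) * x + (1 - 47 / 100 * \<alpha>) * (\<phi> * y) + s * y + (1 - 1 / 2 * \<kappa>1) * pX
      + (wp - wp * \<kappa>2 + 23 / 100 * \<kappa>2) * pY + \<phi>h * (eX + eY) + f - \<eta> / 2 * g
      + (3 * wp * n2 * \<gamma>\<^sup>2 - 396 / 1000 * \<gamma> * s) * NY"
    using pXc xc yc by (simp add: algebra_simps)
  finally show ?thesis unfolding n2_def .
qed

text \<open>Of the available \<open>49 / 100 * \<alpha> * x\<close>, the share
  \<open>7 / 100\<close> is set aside as the rate of the stationarity sum. The coefficient
  \<open>1 / 10\<close> of \<open>\<kappa>2 * pY\<close> is what both Lyapunov functions can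
  afford.\<close>

abbreviation "dissipation \<equiv> 42 / 100 * \<alpha> * x + 47 / 100 * \<alpha> * (\<phi> * y) + 1 / 2 * \<kappa>1 * pX + 1 / 10 * \<kappa>2 * pY"

text \<open>Without extra weight nothing cancels \<open>NY\<close>, so it is bounded by
  \<open>4 * y\<close>. Subtracting the same multiple of \<open>pY\<close> is affordable: it is at
  most \<open>48 / 100 * \<kappa>2 * pY\<close>, and \<open>0.23 + 0.48 + 0.1\<close> is below
  1.\<close>

lemma plain_step:
  "x' + \<phi> * y' + pX' + pY' + \<phi>h * (eX' + eY') + f'
    \<le> x + \<phi> * y + pX + pY + \<phi>h * (eX + eY) + f + 12 * (m2 * \<gamma>) * \<gamma> * (y - pY)
      - 7 / 100 * \<alpha> * x - \<eta> / 2 * g - dissipation"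
proof -
  have m2g: "m2 * \<gamma> \<le> 1 / 5" "0 \<le> m2 * \<gamma>"
    using m2_gamma by auto
  have step: "x' + \<phi> * y' + pX' + pY' + \<phi>h * (eX' + eY') + f' \<le>
      (1 - 49 / 100 * \<alpha>) * x + (1 - 47 / 100 * \<alpha>) * (\<phi> * y) + (1 - 1 / 2 * \<kappa>1) * pX
      + (1 - \<kappa>2 + 23 / 100 * \<kappa>2) * pY + \<phi>h * (eX + eY) + f - \<eta> / 2 * g + 3 * m2 * \<gamma>\<^sup>2 * NY"
    using weighted_step[of 0 1] m2g by simp
  have "3 * m2 * \<gamma>\<^sup>2 * NY \<le> 3 * m2 * \<gamma>\<^sup>2 * (4 * y)"
    using NY m2_ge by (intro mult_left_mono) auto
  then have NYy: "3 * m2 * \<gamma>\<^sup>2 * NY \<le> 12 * (m2 * \<gamma>) * \<gamma> * y" by (simp add: power2_eq_square mult_ac)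
  have "(m2 * \<gamma>) * \<gamma> \<le> 1 / 5 * \<gamma>" using m2g gamma by (intro mult_right_mono) auto
  then have "12 * ((m2 * \<gamma>) * \<gamma>) \<le> 48 / 100 * c2" using gamma_le_c2 by linarith
  also have "\<dots> \<le> 48 / 100 * \<kappa>2" using c2 by (simp add: algebra_simps)
  finally have "12 * (m2 * \<gamma>) * \<gamma> * pY \<le> 48 / 100 * \<kappa>2 * pY"
    using nonneg by (intro mult_right_mono) auto
  moreover have "0 \<le> \<kappa>2 * pY" using c2 nonneg by simp
  ultimately have "(1 - \<kappa>2 + 23 / 100 * \<kappa>2) * pY \<le> pY - 12 * (m2 * \<gamma>) * \<gamma> * pY - 1 / 10 * \<kappa>2 * pY"
    unfolding left_diff_distrib distrib_right by linarith
  with step NYy show ?thesis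
    unfolding left_diff_distrib right_diff_distrib by linarith
qed

lemma shifted_step:
  defines "t \<equiv> 8 * (m2 * \<gamma>) / (1 + 8 * (m2 * \<gamma>))"
  shows "x' + \<phi> * y' + pX' + pY' + \<phi>h * (eX' + eY') + f' + t * (y' - pY')
    \<le> x + \<phi> * y + pX + pY + \<phi>h * (eX + eY) + f + t * (y - pY)
      - 7 / 100 * \<alpha> * x - \<eta> / 2 * g - dissipation"
proof -
  let ?m = "m2 * \<gamma>"
  note m = m2_gamma
  have t: "0 \<le> t" "t \<le> 8 * ?m" "t \<le> 1"
  proof -
    have "0 \<le> 8 * x / (1 + 8 * x)" "8 * x / (1 + 8 * x) \<le> 8 * x" "8 * x / (1 + 8 * x) \<le> 1"
      if "0 < x" for x :: real
      using that by (auto simp: pos_divide_le_eq algebra_simps)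
    from this[OF m(2)] show "0 \<le> t" "t \<le> 8 * ?m" "t \<le> 1" unfolding t_def by auto
  qed
  have wp: "1 - t = 1 / (1 + 8 * ?m)"
  proof -
    have "1 - 8 * x / (1 + 8 * x) = 1 / (1 + 8 * x)" if "0 < x" for x :: real
      using that by (simp add: field_simps)
    from this[OF m(2)] show ?thesis unfolding t_def .
  qed
  \<comment> \<open>From \<open>m2 * \<gamma> \<le> 1 / 5\<close> one has
    \<open>1 - t \<ge> 5 / 13\<close>; \<open>33 / 100\<close> suffices, leaving
    \<open>0.33 - 0.23 = 0.1\<close> of the contraction of \<open>pY\<close>.\<close>
  have wp3: "33 / 100 \<le> 1 - t"
    unfolding wp using m by (simp add: pos_le_divide_eq)
  have step: "x' + (\<phi> + t) * y' + pX' + (1 - t) * pY' + \<phi>h * (eX' + eY') + f' \<le>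
      (1 - 49 / 100 * \<alpha>) * x + (1 - 47 / 100 * \<alpha>) * (\<phi> * y) + t * y + (1 - 1 / 2 * \<kappa>1) * pX
      + (1 - t - (1 - t) * \<kappa>2 + 23 / 100 * \<kappa>2) * pY + \<phi>h * (eX + eY) + f - \<eta> / 2 * g
      + (3 * (1 - t) * m2 * \<gamma>\<^sup>2 - 396 / 1000 * \<gamma> * t) * NY"
    using t by (intro weighted_step) auto
  \<comment> \<open>The factor 8 in \<open>t\<close> makes the sign right:
    \<open>3 - 8 * 0.396 = -0.168\<close>.\<close>
  have "3 * (1 - t) * m2 * \<gamma>\<^sup>2 - 396 / 1000 * \<gamma> * t
      = 3 * ?m * \<gamma> / (1 + 8 * ?m) - 396 / 1000 * \<gamma> * (8 * ?m / (1 + 8 * ?m))"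
    unfolding wp by (simp add: t_def power2_eq_square)
  also have "\<dots> = - (168 / 1000 * ?m * \<gamma> / (1 + 8 * ?m))"
  proof -
    have "3 * x * \<gamma> / d - 396 / 1000 * \<gamma> * (8 * x / d) = - (168 / 1000 * x * \<gamma> / d)" for x d
      by (simp add: algebra_simps)
    then show ?thesis .
  qed
  also have "\<dots> \<le> 0" using m gamma by simp
  finally have NYc: "(3 * (1 - t) * m2 * \<gamma>\<^sup>2 - 396 / 1000 * \<gamma> * t) * NY \<le> 0"
    using nonneg by (intro mult_nonpos_nonneg)
  have "33 / 100 * (\<kappa>2 * pY) \<le> (1 - t) * (\<kappa>2 * pY)"
    using wp3 c2 nonneg by (intro mult_right_mono) auto
  then have "(1 - t - (1 - t) * \<kappa>2 + 23 / 100 * \<kappa>2) * pY \<le> (1 - t) * pY - 1 / 10 * \<kappa>2 * pY"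
    unfolding left_diff_distrib distrib_right by linarith
  with step NYc show ?thesis
    unfolding left_diff_distrib right_diff_distrib distrib_right by linarith
qed

end

section \<open>Random compression\<close>

lemma borel_measurable_vec_lambda:
  fixes f :: "'w \<Rightarrow> 'n::finite \<Rightarrow> 'a::euclidean_space"
  assumes "\<And>i. (\<lambda>w. f w i) \<in> borel_measurable N"
  shows "(\<lambda>w. \<chi> i. f w i) \<in> borel_measurable N"
  unfolding borel_measurable_euclidean_space[of "\<lambda>w. \<chi> i. f w i"]
  using assms by (auto simp: Basis_vec_def inner_axis)

lemma borel_measurable_vec_nth:
  fixes f :: "'w \<Rightarrow> ('a::euclidean_space) ^ 'n"
  assumes "f \<in> borel_measurable N"
  shows "(\<lambda>w. f w $ i) \<in> borel_measurable N"
proof -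
  have "(\<lambda>v::'a^'n. v $ i) \<in> borel_measurable borel"
    by (intro borel_measurable_continuous_onI continuous_intros)
  from measurable_compose[OF assms this] show ?thesis .
qed

lemma linear_consensus: "linear consensus"
  by (intro linearI consensus_add consensus_scaleR)

lemma linear_disagreement: "linear (disagreement W)"
  by (intro linearI disagreement_add disagreement_scaleR)

lemma borel_measurable_linear:
  fixes L :: "'a::euclidean_space \<Rightarrow> 'b::euclidean_space"
  assumes "linear L" "f \<in> borel_measurable N"
  shows "(\<lambda>w. L (f w)) \<in> borel_measurable N"
proof -
  have "L \<in> borel_measurable borel"
    using assms(1) by (intro borel_measurable_continuous_onI linear_continuous_on)
      (simp add: linear_conv_bounded_linear)
  from measurable_compose[OF assms(2) this] show ?thesis .
qed

lemma (in costs) continuous_on_stacked_grad: "continuous_on UNIV (stacked_grad F)"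
proof (rule lipschitz_on_continuous_on)
  show "Lf-lipschitz_on UNIV (stacked_grad F)"
    using norm_stacked_grad_diff_le Lf by (intro lipschitz_onI) (auto simp: dist_norm)
qed

lemma (in costs) borel_measurable_stacked_grad:
  assumes "f \<in> borel_measurable N"
  shows "(\<lambda>w. stacked_grad F (f w)) \<in> borel_measurable N"
  using measurable_compose[OF assms borel_measurable_continuous_onI[OF continuous_on_stacked_grad]] .

lemma borel_measurable_compress:
  assumes C: "(\<lambda>(s, x). \<C> s x) \<in> S \<Otimes>\<^sub>M borel \<rightarrow>\<^sub>M borel"
    and u: "\<And>i. (\<lambda>w. u w i) \<in> N \<rightarrow>\<^sub>M S"
    and f: "f \<in> borel_measurable N"
  shows "(\<lambda>w. compress \<C> (u w) (f w)) \<in> borel_measurable N"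
  unfolding compress_def
proof (rule borel_measurable_vec_lambda)
  fix i
  have "(\<lambda>w. (u w i, f w $ i)) \<in> N \<rightarrow>\<^sub>M S \<Otimes>\<^sub>M borel"
    using u borel_measurable_vec_nth[OF f] by (rule measurable_Pair)
  from measurable_compose[OF this C] show "(\<lambda>w. \<C> (u w i) (f w $ i)) \<in> borel_measurable N"
    by simp
qed

lemma norm_add_power2_le: "(norm (u + v))\<^sup>2 \<le> 2 * (norm u)\<^sup>2 + 2 * (norm (v::'b::real_inner))\<^sup>2"
proof -
  have "(norm (u + v))\<^sup>2 + (norm (u - v))\<^sup>2 = 2 * (norm u)\<^sup>2 + 2 * (norm v)\<^sup>2"
    by (simp add: power2_norm_eq_inner inner_diff_left inner_diff_right inner_add_left
        inner_add_right inner_commute)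
  then show ?thesis by (smt (verit) zero_le_power2)
qed

context prob_space
begin

text \<open>The library's \<open>indep_var\<close> forces both random variables to take values in the same type.\<close>

definition indep_pair :: "'b measure \<Rightarrow> ('a \<Rightarrow> 'b) \<Rightarrow> 'c measure \<Rightarrow> ('a \<Rightarrow> 'c) \<Rightarrow> bool" where
  "indep_pair N V S s \<longleftrightarrow> V \<in> M \<rightarrow>\<^sub>M N \<and> s \<in> M \<rightarrow>\<^sub>M S \<and>
     distr M N V \<Otimes>\<^sub>M distr M S s = distr M (N \<Otimes>\<^sub>M S) (\<lambda>\<omega>. (V \<omega>, s \<omega>))"

lemma indep_pair_compose:
  assumes ind: "indep_pair N V S s" and f: "f \<in> N \<rightarrow>\<^sub>M N'" and g: "g \<in> S \<rightarrow>\<^sub>M S'"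
  shows "indep_pair N' (\<lambda>\<omega>. f (V \<omega>)) S' (\<lambda>\<omega>. g (s \<omega>))"
proof -
  have V: "V \<in> M \<rightarrow>\<^sub>M N" and s: "s \<in> M \<rightarrow>\<^sub>M S"
    and eq: "distr M N V \<Otimes>\<^sub>M distr M S s = distr M (N \<Otimes>\<^sub>M S) (\<lambda>\<omega>. (V \<omega>, s \<omega>))"
    using ind by (auto simp: indep_pair_def)
  have fV: "(\<lambda>\<omega>. f (V \<omega>)) \<in> M \<rightarrow>\<^sub>M N'" and gs: "(\<lambda>\<omega>. g (s \<omega>)) \<in> M \<rightarrow>\<^sub>M S'"
    using measurable_compose[OF V f] measurable_compose[OF s g] by auto
  have "distr M N' (\<lambda>\<omega>. f (V \<omega>)) \<Otimes>\<^sub>M distr M S' (\<lambda>\<omega>. g (s \<omega>))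
      = distr (distr M N V) N' f \<Otimes>\<^sub>M distr (distr M S s) S' g"
    using V s f g by (simp add: distr_distr comp_def)
  also have "\<dots> = distr (distr M N V \<Otimes>\<^sub>M distr M S s) (N' \<Otimes>\<^sub>M S') (\<lambda>(x, y). (f x, g y))"
  proof (rule pair_measure_distr)
    show "sigma_finite_measure (distr (distr M S s) S' g)"
      using s g gs by (simp add: distr_distr comp_def prob_space_distr prob_space_imp_sigma_finite)
  qed (use f g in auto)
  also have "\<dots> = distr M (N' \<Otimes>\<^sub>M S') (\<lambda>\<omega>. (f (V \<omega>), g (s \<omega>)))"
    unfolding eq using V s f g by (subst distr_distr) (auto simp: comp_def)
  finally show ?thesis
    using fV gs by (simp add: indep_pair_def)
qed

text \<open>By independence the joint law of \<open>V\<close> and the seed is a product, so Tonelli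
  integrates the pointwise compressor bound over the law of \<open>V\<close>. Nonnegative integrals
  yield the integrability and the bound together.\<close>

lemma compressor_expectation:
  fixes V :: "'a \<Rightarrow> real^'d"
  assumes C: "compressor S \<C> r \<psi>" and law: "distr M S s = S"
    and indep: "indep_pair borel V S s"
    and int: "integrable M (\<lambda>\<omega>. (norm (V \<omega>))\<^sup>2)"
  shows "integrable M (\<lambda>\<omega>. (norm (\<C> (s \<omega>) (V \<omega>) /\<^sub>R r - V \<omega>))\<^sup>2)"
    and "(\<integral>\<omega>. (norm (\<C> (s \<omega>) (V \<omega>) /\<^sub>R r - V \<omega>))\<^sup>2 \<partial>M) \<le> (1 - \<psi>) * (\<integral>\<omega>. (norm (V \<omega>))\<^sup>2 \<partial>M)"
proof -
  have S: "prob_space S" and Cm: "(\<lambda>(s, x). \<C> s x) \<in> S \<Otimes>\<^sub>M borel \<rightarrow>\<^sub>M borel"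
    and Ci: "\<And>x. integrable S (\<lambda>s. (norm (\<C> s x /\<^sub>R r - x))\<^sup>2)"
    and Cb: "\<And>x. (\<integral>s. (norm (\<C> s x /\<^sub>R r - x))\<^sup>2 \<partial>S) \<le> (1 - \<psi>) * (norm x)\<^sup>2"
    using C by (auto simp: compressor_def)
  interpret S: prob_space S by fact
  have Vm: "V \<in> borel_measurable M" and sm: "s \<in> M \<rightarrow>\<^sub>M S"
    and pair: "distr M borel V \<Otimes>\<^sub>M S = distr M (borel \<Otimes>\<^sub>M S) (\<lambda>\<omega>. (V \<omega>, s \<omega>))"
    using indep law unfolding indep_pair_def by auto
  let ?g = "\<lambda>p. ennreal ((norm (\<C> (snd p) (fst p) /\<^sub>R r - fst p))\<^sup>2)"
  have Cm': "(\<lambda>p. \<C> (snd p) (fst p)) \<in> borel \<Otimes>\<^sub>M S \<rightarrow>\<^sub>M borel"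
    using measurable_compose[OF measurable_Pair[OF measurable_snd measurable_fst] Cm] by simp
  have gm: "?g \<in> borel_measurable (borel \<Otimes>\<^sub>M S)"
    using Cm' by measurable
  have meas: "(\<lambda>\<omega>. (norm (\<C> (s \<omega>) (V \<omega>) /\<^sub>R r - V \<omega>))\<^sup>2) \<in> borel_measurable M"
  proof -
    have "(\<lambda>\<omega>. \<C> (s \<omega>) (V \<omega>)) \<in> borel_measurable M"
      using measurable_compose[OF measurable_Pair[OF Vm sm] Cm'] by simp
    then show ?thesis using Vm by measurable
  qed
  \<comment> \<open>\<open>compressor\<close> itself does not bound \<open>\<psi>\<close>; its
    inequality at a unit vector does. The sign is needed for the passage to
    \<open>ennreal\<close>.\<close>
  have psi: "0 \<le> 1 - \<psi>"
  proof -
    have "0 \<le> (1 - \<psi>) * (norm (axis undefined 1 :: real^'d))\<^sup>2"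
      using Cb[of "axis undefined 1"]
      by (rule order_trans[rotated]) (simp add: integral_nonneg_AE)
    then show ?thesis by simp
  qed
  have "(\<integral>\<^sup>+\<omega>. ennreal ((norm (\<C> (s \<omega>) (V \<omega>) /\<^sub>R r - V \<omega>))\<^sup>2) \<partial>M)
      = (\<integral>\<^sup>+p. ?g p \<partial>distr M (borel \<Otimes>\<^sub>M S) (\<lambda>\<omega>. (V \<omega>, s \<omega>)))"
    using gm Vm sm by (subst nn_integral_distr) auto
  also have "\<dots> = (\<integral>\<^sup>+v. \<integral>\<^sup>+s. ?g (v, s) \<partial>S \<partial>distr M borel V)"
    unfolding pair[symmetric] using gm by (subst S.nn_integral_fst[symmetric]) auto
  also have "\<dots> \<le> (\<integral>\<^sup>+v. ennreal ((1 - \<psi>) * (norm v)\<^sup>2) \<partial>distr M borel V)"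
    using Cb Ci by (intro nn_integral_mono) (simp add: nn_integral_eq_integral ennreal_leI)
  also have "\<dots> = (\<integral>\<^sup>+\<omega>. ennreal ((1 - \<psi>) * (norm (V \<omega>))\<^sup>2) \<partial>M)"
    using Vm by (subst nn_integral_distr) auto
  also have "\<dots> = ennreal ((1 - \<psi>) * (\<integral>\<omega>. (norm (V \<omega>))\<^sup>2 \<partial>M))"
    using int psi by (subst nn_integral_eq_integral) auto
  finally have le: "(\<integral>\<^sup>+\<omega>. ennreal ((norm (\<C> (s \<omega>) (V \<omega>) /\<^sub>R r - V \<omega>))\<^sup>2) \<partial>M)
      \<le> ennreal ((1 - \<psi>) * (\<integral>\<omega>. (norm (V \<omega>))\<^sup>2 \<partial>M))" .
  show i: "integrable M (\<lambda>\<omega>. (norm (\<C> (s \<omega>) (V \<omega>) /\<^sub>R r - V \<omega>))\<^sup>2)"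
    using meas le by (intro integrableI_bounded) (auto simp: top.extremum_strict
        intro: le_less_trans)
  show "(\<integral>\<omega>. (norm (\<C> (s \<omega>) (V \<omega>) /\<^sub>R r - V \<omega>))\<^sup>2 \<partial>M) \<le> (1 - \<psi>) * (\<integral>\<omega>. (norm (V \<omega>))\<^sup>2 \<partial>M)"
    using le nn_integral_eq_integral[OF i] psi by (simp add: ennreal_le_iff)
qed

section \<open>Square-integrable random vectors\<close>

definition sq_integrable :: "('a \<Rightarrow> 'b::euclidean_space) \<Rightarrow> bool" where
  "sq_integrable f \<longleftrightarrow> f \<in> borel_measurable M \<and> integrable M (\<lambda>\<omega>. (norm (f \<omega>))\<^sup>2)"

lemma sq_integrableD:
  assumes "sq_integrable f"
  shows "f \<in> borel_measurable M" "integrable M (\<lambda>\<omega>. (norm (f \<omega>))\<^sup>2)"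
  using assms by (auto simp: sq_integrable_def)

lemma sq_integrable_bound:
  assumes "f \<in> borel_measurable M" "integrable M g" "\<And>\<omega>. (norm (f \<omega>))\<^sup>2 \<le> g \<omega>"
  shows "sq_integrable f"
  unfolding sq_integrable_def
proof
  show "integrable M (\<lambda>\<omega>. (norm (f \<omega>))\<^sup>2)"
    using assms(1) assms(3)
    by (intro Bochner_Integration.integrable_bound[OF assms(2)])
      (auto intro: order_trans[OF _ abs_ge_self])
qed fact

lemma sq_integrable_const: "sq_integrable (\<lambda>_. c)"
  by (simp add: sq_integrable_def)

lemma sq_integrable_scaleR: "sq_integrable f \<Longrightarrow> sq_integrable (\<lambda>\<omega>. c *\<^sub>R f \<omega>)"
  by (auto simp: sq_integrable_def power_mult_distrib)

lemma sq_integrable_add: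
  assumes "sq_integrable f" "sq_integrable g"
  shows "sq_integrable (\<lambda>\<omega>. f \<omega> + g \<omega>)"
  by (rule sq_integrable_bound[of _ "\<lambda>\<omega>. 2 * (norm (f \<omega>))\<^sup>2 + 2 * (norm (g \<omega>))\<^sup>2"])
    (use assms norm_add_power2_le in \<open>auto simp: sq_integrable_def\<close>)

lemma sq_integrable_diff:
  assumes "sq_integrable f" "sq_integrable g"
  shows "sq_integrable (\<lambda>\<omega>. f \<omega> - g \<omega>)"
  using sq_integrable_add[OF assms(1) sq_integrable_scaleR[OF assms(2), of "-1"]] by simp

lemma sq_integrable_linear:
  fixes L :: "'b::euclidean_space \<Rightarrow> 'c::euclidean_space"
  assumes "linear L" "sq_integrable f"
  shows "sq_integrable (\<lambda>\<omega>. L (f \<omega>))"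
proof -
  have "(norm (L (f \<omega>)))\<^sup>2 \<le> (onorm L)\<^sup>2 * (norm (f \<omega>))\<^sup>2" for \<omega>
    using power_mono[OF onorm[of L "f \<omega>"], of 2] assms(1)
    by (simp add: linear_conv_bounded_linear power_mult_distrib)
  then show ?thesis
    using assms borel_measurable_linear[OF assms(1)]
    by (intro sq_integrable_bound[of _ "\<lambda>\<omega>. (onorm L)\<^sup>2 * (norm (f \<omega>))\<^sup>2"])
      (auto simp: sq_integrable_def)
qed

text \<open>The squared norm is a sum over agents, so it suffices that each single seed is
  independent of the whole vector \<open>V\<close>.\<close>

lemma compress_expectation:
  fixes V :: "'a \<Rightarrow> real^'d^'n::finite"
  assumes C: "compressor S \<C> r \<psi>" and r: "0 < r" and law: "\<And>i. distr M S (s i) = S"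
    and indep: "\<And>i. indep_pair borel V S (s i)"
    and V: "sq_integrable V"
  shows "sq_integrable (\<lambda>\<omega>. compress \<C> (\<lambda>i. s i \<omega>) (V \<omega>))"
    and "integrable M (\<lambda>\<omega>. (norm (compress \<C> (\<lambda>i. s i \<omega>) (V \<omega>) /\<^sub>R r - V \<omega>))\<^sup>2)"
    and "(\<integral>\<omega>. (norm (compress \<C> (\<lambda>i. s i \<omega>) (V \<omega>) /\<^sub>R r - V \<omega>))\<^sup>2 \<partial>M)
      \<le> (1 - \<psi>) * (\<integral>\<omega>. (norm (V \<omega>))\<^sup>2 \<partial>M)"
proof -
  let ?Q = "\<lambda>\<omega>. compress \<C> (\<lambda>i. s i \<omega>) (V \<omega>)"
  have Vi: "integrable M (\<lambda>\<omega>. (norm (V \<omega> $ i))\<^sup>2)" for i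
    using sq_integrable_linear[OF _ V, of "\<lambda>v. v $ i"]
    by (simp add: sq_integrable_def linearI)
  have "indep_pair borel (\<lambda>\<omega>. V \<omega> $ i) S (s i)" for i
    by (rule indep_pair_compose[OF indep, of _ borel "\<lambda>x. x"]) (auto intro: borel_measurable_vec_nth)
  note * = compressor_expectation[OF C law this Vi]
  have eq: "(norm (?Q \<omega> /\<^sub>R r - V \<omega>))\<^sup>2
      = (\<Sum>i\<in>UNIV. (norm (\<C> (s i \<omega>) (V \<omega> $ i) /\<^sub>R r - V \<omega> $ i))\<^sup>2)" for \<omega>
    by (simp add: norm_vec_power2[where 'a="real^'d"] compress_def)
  show int: "integrable M (\<lambda>\<omega>. (norm (?Q \<omega> /\<^sub>R r - V \<omega>))\<^sup>2)"
    unfolding eq using * by auto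
  have "(\<integral>\<omega>. (norm (?Q \<omega> /\<^sub>R r - V \<omega>))\<^sup>2 \<partial>M)
      \<le> (\<Sum>i\<in>UNIV. (1 - \<psi>) * (\<integral>\<omega>. (norm (V \<omega> $ i))\<^sup>2 \<partial>M))"
    unfolding eq using * by (simp add: sum_mono)
  also have "\<dots> = (1 - \<psi>) * (\<integral>\<omega>. (norm (V \<omega>))\<^sup>2 \<partial>M)"
    unfolding norm_vec_power2[where 'a="real^'d"] using Vi by (simp add: sum_distrib_left)
  finally show "(\<integral>\<omega>. (norm (?Q \<omega> /\<^sub>R r - V \<omega>))\<^sup>2 \<partial>M) \<le> (1 - \<psi>) * (\<integral>\<omega>. (norm (V \<omega>))\<^sup>2 \<partial>M)" .
  have meas: "?Q \<in> borel_measurable M"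
  proof (rule borel_measurable_compress[where S = S])
    show "s i \<in> M \<rightarrow>\<^sub>M S" for i using indep by (simp add: indep_pair_def)
  qed (use C V in \<open>auto simp: compressor_def sq_integrable_def\<close>)
  have "sq_integrable (\<lambda>\<omega>. ?Q \<omega> /\<^sub>R r - V \<omega>)"
    unfolding sq_integrable_def using meas V int by (auto simp: sq_integrable_def)
  from sq_integrable_scaleR[OF sq_integrable_add[OF this V], of r]
  show "sq_integrable ?Q" using r by simp
qed

end

lemma (in costs) sq_integrable_stacked_grad:
  assumes "prob_space M" "prob_space.sq_integrable M f"
  shows "prob_space.sq_integrable M (\<lambda>\<omega>. stacked_grad F (f \<omega>))"
proof -
  interpret prob_space M by fact
  have "(norm (stacked_grad F (f \<omega>)))\<^sup>2
      \<le> 2 * (Lf\<^sup>2 * (norm (f \<omega>))\<^sup>2) + 2 * (norm (stacked_grad F 0))\<^sup>2" for \<omega>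
    using norm_add_power2_le[of "stacked_grad F (f \<omega>) - stacked_grad F 0" "stacked_grad F 0"]
      power_mono[OF norm_stacked_grad_diff_le[of "f \<omega>" 0], of 2]
    by (simp add: power_mult_distrib)
  then show ?thesis
    using assms(2) borel_measurable_stacked_grad
    by (intro sq_integrable_bound[of _
          "\<lambda>\<omega>. 2 * (Lf\<^sup>2 * (norm (f \<omega>))\<^sup>2) + 2 * (norm (stacked_grad F 0))\<^sup>2"])
      (auto simp: sq_integrable_def)
qed

section \<open>The algorithm as a stochastic process\<close>

locale ef_algorithm = mixing E W \<sigma> + costs F Lf + prob_space M
  for E :: "('n::finite \<times> 'n) set" and W :: "real^'n^'n" and \<sigma> :: real
    and F :: "'n \<Rightarrow> real^'d \<Rightarrow> real" and Lf :: real and M :: "'w measure" +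
  fixes S :: "'s measure" and \<C> :: "'s \<Rightarrow> real^'d \<Rightarrow> real^'d"
    and \<xi> :: "nat \<times> channel \<times> 'n \<Rightarrow> 'w \<Rightarrow> 's" and x0 :: "real^'d^'n"
    and r \<psi> \<phi>X \<phi>Y \<gamma> \<eta> vs :: real
  assumes r: "0 < r" and compressor: "compressor S \<C> r \<psi>"
    and seeds_indep: "indep_vars (\<lambda>_. S) \<xi> UNIV"
    and seeds_law: "\<And>j. distr M S (\<xi> j) = S"
begin

abbreviation "run \<equiv> ef_run \<C> F W \<gamma> \<eta> \<phi>X \<phi>Y vs x0"

text \<open>At time 0 the hatted variables reuse the seeds of the unhatted ones. Since the
  accumulated errors vanish then, this reindexing gives \<open>run_Q\<close> one form for all
  times.\<close>

definition hat_channel :: "nat \<Rightarrow> channel \<Rightarrow> channel \<Rightarrow> channel" where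
  "hat_channel k c c' = (if k = 0 then c else c')"

lemma run_0:
  "stX (run u 0) = x0" "stY (run u 0) = stacked_grad F x0"
  "stA (run u 0) = 0" "stC (run u 0) = 0" "stEX (run u 0) = 0" "stEY (run u 0) = 0"
  by (simp_all add: ef_init_def Let_def)

text \<open>\<open>B\<close> and \<open>D\<close> accumulate \<open>I - W\<close> applied to the
  increments of \<open>A\<close> and \<open>C\<close>, all starting at 0. This eliminates them from
  the analysis.\<close>

lemma run_B_D:
  "stB (run u k) = disagreement W (stA (run u k))"
  "stD (run u k) = disagreement W (stC (run u k))"
  by (induction k)
    (simp_all add: ef_init_def ef_step_def Let_def disagreement_add disagreement_scaleR)

lemma run_Q:
  "stQX (run u k) = compress \<C> (\<lambda>i. u (k, ChQX, i)) (stX (run u k) - stA (run u k))"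
  "stQY (run u k) = compress \<C> (\<lambda>i. u (k, ChQY, i)) (stY (run u k) - stC (run u k))"
  "stQhX (run u k) = compress \<C> (\<lambda>i. u (k, hat_channel k ChQX ChQhX, i))
     (vs *\<^sub>R stEX (run u k) + stX (run u k) - stA (run u k))"
  "stQhY (run u k) = compress \<C> (\<lambda>i. u (k, hat_channel k ChQY ChQhY, i))
     (vs *\<^sub>R stEY (run u k) + stY (run u k) - stC (run u k))"
  by (cases k; simp add: ef_init_def ef_step_def Let_def hat_channel_def)+

lemma run_Suc:
  "stA (run u (Suc k)) = stA (run u k) + \<phi>X *\<^sub>R stQX (run u k)"
  "stC (run u (Suc k)) = stC (run u k) + \<phi>Y *\<^sub>R stQY (run u k)"
  "stEX (run u (Suc k)) = vs *\<^sub>R stEX (run u k) + stX (run u k) - stA (run u k) - stQhX (run u k)"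
  "stEY (run u (Suc k)) = vs *\<^sub>R stEY (run u k) + stY (run u k) - stC (run u k) - stQhY (run u k)"
  "stX (run u (Suc k)) = stX (run u k)
     - \<gamma> *\<^sub>R disagreement W (stA (run u k) + stQhX (run u k)) - \<eta> *\<^sub>R stY (run u k)"
  "stY (run u (Suc k)) = stY (run u k)
     - \<gamma> *\<^sub>R disagreement W (stC (run u k) + stQhY (run u k))
     + stacked_grad F (stX (run u (Suc k))) - stacked_grad F (stX (run u k))"
  by (simp_all add: ef_step_def Let_def run_B_D disagreement_add)

declare ef_run.simps [simp del]

text \<open>The compressed variables are left out because they already consume the seeds of time
  \<open>k\<close>; the six listed ones see earlier seeds only.\<close>

lemma run_cong:
  assumes "\<And>t c i. t < k \<Longrightarrow> u (t, c, i) = u' (t, c, i)"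
  shows "stX (run u k) = stX (run u' k) \<and> stY (run u k) = stY (run u' k) \<and>
    stA (run u k) = stA (run u' k) \<and> stC (run u k) = stC (run u' k) \<and>
    stEX (run u k) = stEX (run u' k) \<and> stEY (run u k) = stEY (run u' k)"
  using assms
proof (induction k)
  case 0
  show ?case by (simp add: run_0)
next
  case (Suc k)
  then show ?case by (simp add: run_Suc run_Q)
qed

lemma compressor_measurable: "(\<lambda>(s, x). \<C> s x) \<in> S \<Otimes>\<^sub>M borel \<rightarrow>\<^sub>M borel"
  using compressor by (simp add: compressor_def)

text \<open>The seeds may be measurable functions on any space \<open>N\<close>, so that the product
  space of the past seeds is covered.\<close>

lemma run_measurable:
  assumes "\<And>t c i. t < k \<Longrightarrow> (\<lambda>w. u w (t, c, i)) \<in> N \<rightarrow>\<^sub>M S"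
  shows "(\<lambda>w. stX (run (u w) k)) \<in> borel_measurable N \<and>
    (\<lambda>w. stY (run (u w) k)) \<in> borel_measurable N \<and>
    (\<lambda>w. stA (run (u w) k)) \<in> borel_measurable N \<and>
    (\<lambda>w. stC (run (u w) k)) \<in> borel_measurable N \<and>
    (\<lambda>w. stEX (run (u w) k)) \<in> borel_measurable N \<and>
    (\<lambda>w. stEY (run (u w) k)) \<in> borel_measurable N"
  using assms
proof (induction k)
  case 0
  show ?case by (simp add: run_0)
next
  case (Suc k)
  have IH: "(\<lambda>w. stX (run (u w) k)) \<in> borel_measurable N"
    "(\<lambda>w. stY (run (u w) k)) \<in> borel_measurable N"
    "(\<lambda>w. stA (run (u w) k)) \<in> borel_measurable N"
    "(\<lambda>w. stC (run (u w) k)) \<in> borel_measurable N"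
    "(\<lambda>w. stEX (run (u w) k)) \<in> borel_measurable N"
    "(\<lambda>w. stEY (run (u w) k)) \<in> borel_measurable N"
    using Suc by auto
  note intros = borel_measurable_add borel_measurable_diff borel_measurable_scaleR
    borel_measurable_const borel_measurable_stacked_grad
    borel_measurable_linear[OF linear_disagreement] IH
  have Q: "(\<lambda>w. compress \<C> (\<lambda>i. u w (k, c, i)) (f w)) \<in> borel_measurable N"
    if "f \<in> borel_measurable N" for c f
    using Suc.prems that by (intro borel_measurable_compress[OF compressor_measurable]) auto
  have Qs: "(\<lambda>w. stQX (run (u w) k)) \<in> borel_measurable N"
    "(\<lambda>w. stQY (run (u w) k)) \<in> borel_measurable N"
    "(\<lambda>w. stQhX (run (u w) k)) \<in> borel_measurable N"
    "(\<lambda>w. stQhY (run (u w) k)) \<in> borel_measurable N"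
    unfolding run_Q by (intro Q intros)+
  have X: "(\<lambda>w. stX (run (u w) (Suc k))) \<in> borel_measurable N"
    unfolding run_Suc(5) by (intro intros Qs)
  have "(\<lambda>w. stY (run (u w) (Suc k))) \<in> borel_measurable N"
    unfolding run_Suc(6) by (intro intros Qs X)
  moreover have "(\<lambda>w. stA (run (u w) (Suc k))) \<in> borel_measurable N"
    "(\<lambda>w. stC (run (u w) (Suc k))) \<in> borel_measurable N"
    "(\<lambda>w. stEX (run (u w) (Suc k))) \<in> borel_measurable N"
    "(\<lambda>w. stEY (run (u w) (Suc k))) \<in> borel_measurable N"
    unfolding run_Suc(1-4) by (intro intros Qs)+
  ultimately show ?case using X by blast
qed

section \<open>Independence of the fresh seeds and second moments of the iterates\<close>

abbreviation "X k \<omega> \<equiv> stX (run (\<lambda>j. \<xi> j \<omega>) k)"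
abbreviation "Y k \<omega> \<equiv> stY (run (\<lambda>j. \<xi> j \<omega>) k)"
abbreviation "A k \<omega> \<equiv> stA (run (\<lambda>j. \<xi> j \<omega>) k)"
abbreviation "C k \<omega> \<equiv> stC (run (\<lambda>j. \<xi> j \<omega>) k)"
abbreviation "ErX k \<omega> \<equiv> stEX (run (\<lambda>j. \<xi> j \<omega>) k)"
abbreviation "ErY k \<omega> \<equiv> stEY (run (\<lambda>j. \<xi> j \<omega>) k)"
abbreviation "QX k \<omega> \<equiv> stQX (run (\<lambda>j. \<xi> j \<omega>) k)"
abbreviation "QY k \<omega> \<equiv> stQY (run (\<lambda>j. \<xi> j \<omega>) k)"
abbreviation "QhX k \<omega> \<equiv> stQhX (run (\<lambda>j. \<xi> j \<omega>) k)"
abbreviation "QhY k \<omega> \<equiv> stQhY (run (\<lambda>j. \<xi> j \<omega>) k)"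

text \<open>The seeds of times before \<open>k\<close> and one seed of time \<open>k\<close> form
  disjoint subfamilies of an independent family.\<close>

lemma seeds_fresh:
  assumes f: "f \<in> borel_measurable (PiM {(t, c, i). t < k} (\<lambda>_. S))"
  shows "indep_pair borel (\<lambda>\<omega>. f (\<lambda>j\<in>{(t, c, i). t < k}. \<xi> j \<omega>)) S (\<xi> (k, c, i))"
proof -
  let ?A = "{(t, c, i). t < k} :: (nat \<times> channel \<times> 'n) set" and ?B = "{(k, c, i)}"
  have "indep_var (PiM ?A (\<lambda>_. S)) (\<lambda>\<omega>. restrict (\<lambda>j. \<xi> j \<omega>) ?A)
      (PiM ?B (\<lambda>_. S)) (\<lambda>\<omega>. restrict (\<lambda>j. \<xi> j \<omega>) ?B)"
    by (rule indep_var_restrict[OF seeds_indep]) auto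
  then have "indep_pair (PiM ?A (\<lambda>_. S)) (\<lambda>\<omega>. restrict (\<lambda>j. \<xi> j \<omega>) ?A)
      (PiM ?B (\<lambda>_. S)) (\<lambda>\<omega>. restrict (\<lambda>j. \<xi> j \<omega>) ?B)"
    unfolding indep_var_distribution_eq indep_pair_def by blast
  from indep_pair_compose[OF this f, of "\<lambda>w. w (k, c, i)" S]
  show ?thesis by simp
qed

lemma state_fresh:
  shows "indep_pair borel (\<lambda>\<omega>. X k \<omega> - A k \<omega>) S (\<xi> (k, c, i))"
    and "indep_pair borel (\<lambda>\<omega>. Y k \<omega> - C k \<omega>) S (\<xi> (k, c, i))"
    and "indep_pair borel (\<lambda>\<omega>. vs *\<^sub>R ErX k \<omega> + X k \<omega> - A k \<omega>) S (\<xi> (k, c, i))"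
    and "indep_pair borel (\<lambda>\<omega>. vs *\<^sub>R ErY k \<omega> + Y k \<omega> - C k \<omega>) S (\<xi> (k, c, i))"
proof -
  let ?A = "{(t, c, i). t < k} :: (nat \<times> channel \<times> 'n) set"
  have meas: "(\<lambda>w. stX (run w k)) \<in> borel_measurable (PiM ?A (\<lambda>_. S))"
    "(\<lambda>w. stY (run w k)) \<in> borel_measurable (PiM ?A (\<lambda>_. S))"
    "(\<lambda>w. stA (run w k)) \<in> borel_measurable (PiM ?A (\<lambda>_. S))"
    "(\<lambda>w. stC (run w k)) \<in> borel_measurable (PiM ?A (\<lambda>_. S))"
    "(\<lambda>w. stEX (run w k)) \<in> borel_measurable (PiM ?A (\<lambda>_. S))"
    "(\<lambda>w. stEY (run w k)) \<in> borel_measurable (PiM ?A (\<lambda>_. S))"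
    using run_measurable[of k "\<lambda>w. w" "PiM ?A (\<lambda>_. S)"] by auto
  note intros = borel_measurable_add borel_measurable_diff borel_measurable_scaleR
    borel_measurable_const meas
  \<comment> \<open>Forgetting the seeds of time \<open>k\<close> and later does not change the
    state, which exhibits it as a measurable function of the past seeds.\<close>
  have cong: "stX (run (restrict (\<lambda>j. \<xi> j \<omega>) ?A) k) = X k \<omega>"
    "stY (run (restrict (\<lambda>j. \<xi> j \<omega>) ?A) k) = Y k \<omega>"
    "stA (run (restrict (\<lambda>j. \<xi> j \<omega>) ?A) k) = A k \<omega>"
    "stC (run (restrict (\<lambda>j. \<xi> j \<omega>) ?A) k) = C k \<omega>"
    "stEX (run (restrict (\<lambda>j. \<xi> j \<omega>) ?A) k) = ErX k \<omega>"
    "stEY (run (restrict (\<lambda>j. \<xi> j \<omega>) ?A) k) = ErY k \<omega>" for \<omega>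
    using run_cong[of k "restrict (\<lambda>j. \<xi> j \<omega>) ?A" "\<lambda>j. \<xi> j \<omega>"] by auto
  show "indep_pair borel (\<lambda>\<omega>. X k \<omega> - A k \<omega>) S (\<xi> (k, c, i))"
    by (rule seeds_fresh[of "\<lambda>w. stX (run w k) - stA (run w k)" k c i, unfolded cong]) (intro intros)
  show "indep_pair borel (\<lambda>\<omega>. Y k \<omega> - C k \<omega>) S (\<xi> (k, c, i))"
    by (rule seeds_fresh[of "\<lambda>w. stY (run w k) - stC (run w k)" k c i, unfolded cong]) (intro intros)
  show "indep_pair borel (\<lambda>\<omega>. vs *\<^sub>R ErX k \<omega> + X k \<omega> - A k \<omega>) S (\<xi> (k, c, i))"
    by (rule seeds_fresh[of "\<lambda>w. vs *\<^sub>R stEX (run w k) + stX (run w k) - stA (run w k)" k c i, unfolded cong])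
      (intro intros)
  show "indep_pair borel (\<lambda>\<omega>. vs *\<^sub>R ErY k \<omega> + Y k \<omega> - C k \<omega>) S (\<xi> (k, c, i))"
    by (rule seeds_fresh[of "\<lambda>w. vs *\<^sub>R stEY (run w k) + stY (run w k) - stC (run w k)" k c i, unfolded cong])
      (intro intros)
qed

lemma sq_integrable_state:
  "sq_integrable (X k) \<and> sq_integrable (Y k) \<and> sq_integrable (A k) \<and> sq_integrable (C k) \<and>
    sq_integrable (ErX k) \<and> sq_integrable (ErY k)"
proof (induction k)
  case 0
  show ?case by (simp add: run_0 sq_integrable_const)
next
  case (Suc k)
  note sqi = sq_integrable_add sq_integrable_diff sq_integrable_scaleR
    sq_integrable_linear[OF linear_disagreement] sq_integrable_stacked_grad[OF prob_space_axioms]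
  note comp = compress_expectation(1)[OF compressor r seeds_law]
  have IH: "sq_integrable (X k)" "sq_integrable (Y k)" "sq_integrable (A k)"
    "sq_integrable (C k)" "sq_integrable (ErX k)" "sq_integrable (ErY k)"
    using Suc by auto
  have Q: "sq_integrable (QX k)" "sq_integrable (QY k)" "sq_integrable (QhX k)"
    "sq_integrable (QhY k)"
    unfolding run_Q by (intro comp state_fresh sqi IH)+
  have X: "sq_integrable (X (Suc k))"
    unfolding run_Suc(5) by (intro sqi IH Q)
  have Y: "sq_integrable (Y (Suc k))"
    unfolding run_Suc(6) by (intro sqi IH Q X)
  have "sq_integrable (A (Suc k))" "sq_integrable (C (Suc k))" "sq_integrable (ErX (Suc k))"
    "sq_integrable (ErY (Suc k))"
    unfolding run_Suc(1-4) by (intro sqi IH Q)+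
  with X Y show ?case by simp
qed

lemmas sq_integrable_X = sq_integrable_state[THEN conjunct1]
lemmas sq_integrable_Y = sq_integrable_state[THEN conjunct2, THEN conjunct1]
lemmas sq_integrable_A = sq_integrable_state[THEN conjunct2, THEN conjunct2, THEN conjunct1]
lemmas sq_integrable_C =
  sq_integrable_state[THEN conjunct2, THEN conjunct2, THEN conjunct2, THEN conjunct1]
lemmas sq_integrable_EX =
  sq_integrable_state[THEN conjunct2, THEN conjunct2, THEN conjunct2, THEN conjunct2, THEN conjunct1]
lemmas sq_integrable_EY =
  sq_integrable_state[THEN conjunct2, THEN conjunct2, THEN conjunct2, THEN conjunct2, THEN conjunct2]

lemmas sq_integrable_intros =
  sq_integrable_X sq_integrable_Y sq_integrable_A sq_integrable_C sq_integrable_EX sq_integrable_EY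
  sq_integrable_add sq_integrable_diff sq_integrable_scaleR
  sq_integrable_linear[OF linear_disagreement] sq_integrable_linear[OF linear_consensus]
  sq_integrable_stacked_grad[OF prob_space_axioms]

lemma sq_integrable_Q:
  "sq_integrable (QX k)" "sq_integrable (QY k)" "sq_integrable (QhX k)" "sq_integrable (QhY k)"
  unfolding run_Q
  by (intro compress_expectation(1)[OF compressor r seeds_law] state_fresh sq_integrable_intros)+

lemma compression_error:
  "(\<integral>\<omega>. (norm (QX k \<omega> /\<^sub>R r - (X k \<omega> - A k \<omega>)))\<^sup>2 \<partial>M)
    \<le> (1 - \<psi>) * (\<integral>\<omega>. (norm (X k \<omega> - A k \<omega>))\<^sup>2 \<partial>M)"
  "(\<integral>\<omega>. (norm (QY k \<omega> /\<^sub>R r - (Y k \<omega> - C k \<omega>)))\<^sup>2 \<partial>M)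
    \<le> (1 - \<psi>) * (\<integral>\<omega>. (norm (Y k \<omega> - C k \<omega>))\<^sup>2 \<partial>M)"
  "(\<integral>\<omega>. (norm (QhX k \<omega> /\<^sub>R r - (vs *\<^sub>R ErX k \<omega> + X k \<omega> - A k \<omega>)))\<^sup>2 \<partial>M)
    \<le> (1 - \<psi>) * (\<integral>\<omega>. (norm (vs *\<^sub>R ErX k \<omega> + X k \<omega> - A k \<omega>))\<^sup>2 \<partial>M)"
  "(\<integral>\<omega>. (norm (QhY k \<omega> /\<^sub>R r - (vs *\<^sub>R ErY k \<omega> + Y k \<omega> - C k \<omega>)))\<^sup>2 \<partial>M)
    \<le> (1 - \<psi>) * (\<integral>\<omega>. (norm (vs *\<^sub>R ErY k \<omega> + Y k \<omega> - C k \<omega>))\<^sup>2 \<partial>M)"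
  unfolding run_Q
  by (intro compress_expectation(3)[OF compressor r seeds_law] state_fresh sq_integrable_intros)+

end

section \<open>Pathwise estimates\<close>

lemma linear_average: "linear average"
  by (intro linearI average_add average_scaleR)

lemma norm_convex_power2_le:
  fixes u w :: "'a::real_inner"
  assumes "0 \<le> t" "t \<le> 1"
  shows "(norm ((1 - t) *\<^sub>R u + t *\<^sub>R w))\<^sup>2 \<le> (1 - t) * (norm u)\<^sup>2 + t * (norm w)\<^sup>2"
proof -
  have "(1 - t) * (norm u)\<^sup>2 + t * (norm w)\<^sup>2 - (norm ((1 - t) *\<^sub>R u + t *\<^sub>R w))\<^sup>2
      = t * (1 - t) * (norm (u - w))\<^sup>2"
    unfolding power2_norm_eq_inner
    unfolding inner_diff_left inner_diff_right inner_add_left inner_add_right inner_scaleR_left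
      inner_scaleR_right inner_commute[of w u] by algebra
  also have "\<dots> \<ge> 0" using assms by simp
  finally show ?thesis by simp
qed

lemma norm_add_power2_le_young:
  fixes u v :: "'a::real_inner"
  assumes "0 < c"
  shows "(norm (u + v))\<^sup>2 \<le> (1 + c) * (norm u)\<^sup>2 + (1 + 1 / c) * (norm v)\<^sup>2"
proof -
  have "1 - c / (1 + c) = 1 / (1 + c)" using assms by (simp add: field_simps)
  moreover have "1 / (c / (1 + c)) = 1 + 1 / c" using assms by (simp add: field_simps)
  ultimately show ?thesis
    using norm_add_power2_le_weighted[of "c / (1 + c)" u v] assms
    by (simp add: field_simps)
qed

lemma norm_add3_power2_le:
  fixes u v w :: "'a::real_inner"
  shows "(norm (u + v + w))\<^sup>2 \<le> 3 * ((norm u)\<^sup>2 + (norm v)\<^sup>2 + (norm w)\<^sup>2)"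
  using norm_add_power2_le_young[of "1 / 2" "u + v" w] norm_add_power2_le[of u v] by simp

lemma norm_add4_power2_le:
  fixes u v w z :: "'a::real_inner"
  shows "(norm (u + v + w + z))\<^sup>2 \<le> 4 * ((norm u)\<^sup>2 + (norm v)\<^sup>2 + (norm w)\<^sup>2 + (norm z)\<^sup>2)"
  using norm_add_power2_le_young[of "1 / 3" "u + v + w" z] norm_add3_power2_le[of u v w] by simp

context ef_algorithm
begin

abbreviation "errX k \<omega> \<equiv> X k \<omega> - A k \<omega> - QhX k \<omega>"
abbreviation "errY k \<omega> \<equiv> Y k \<omega> - C k \<omega> - QhY k \<omega>"
abbreviation "dX k \<omega> \<equiv> X (Suc k) \<omega> - X k \<omega>"
abbreviation "dY k \<omega> \<equiv> Y (Suc k) \<omega> - Y k \<omega>"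

text \<open>Since \<open>B\<close> is \<open>I - W\<close> applied to \<open>A\<close>, gossip acts
  on \<open>A + QhX = X - errX\<close>: the update is exact gossip on \<open>X\<close> perturbed by
  a compression error.\<close>

lemma X_Suc:
  "X (Suc k) \<omega> = X k \<omega> - \<gamma> *\<^sub>R disagreement W (X k \<omega>) + \<gamma> *\<^sub>R disagreement W (errX k \<omega>)
     - \<eta> *\<^sub>R Y k \<omega>"
  unfolding run_Suc(5) by (simp add: disagreement_diff disagreement_add algebra_simps)

lemma Y_Suc:
  "Y (Suc k) \<omega> = Y k \<omega> - \<gamma> *\<^sub>R disagreement W (Y k \<omega>) + \<gamma> *\<^sub>R disagreement W (errY k \<omega>)
     + (stacked_grad F (X (Suc k) \<omega>) - stacked_grad F (X k \<omega>))"
  unfolding run_Suc(6) by (simp add: disagreement_diff disagreement_add algebra_simps)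

text \<open>The gradient tracking invariant: gossip terms have zero mean, and the gradient
  increments telescope from \<open>Y(0)\<close>.\<close>

lemma average_Y: "average (Y k \<omega>) = average (stacked_grad F (X k \<omega>))"
proof (induction k)
  case 0
  show ?case by (simp add: run_0)
next
  case (Suc k)
  then show ?case
    unfolding Y_Suc by (simp add: average_add average_diff average_scaleR)
qed

lemma average_X_Suc:
  "average (X (Suc k) \<omega>) = average (X k \<omega>) - \<eta> *\<^sub>R average (stacked_grad F (X k \<omega>))"
  unfolding X_Suc
  by (simp add: average_add average_diff average_scaleR average_Y)

lemma norm_scaled_disagreement_le:
  "(norm (\<gamma> *\<^sub>R disagreement W v))\<^sup>2 \<le> 4 * \<gamma>\<^sup>2 * (norm v)\<^sup>2"
  using mult_left_mono[OF norm_disagreement_power2_le[of v], of "\<gamma>\<^sup>2"]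
  by (simp add: power_mult_distrib)

text \<open>\<open>Y\<close> is split into deviation and mean because they are absorbed differently:
  the deviation by the consensus error of \<open>Y\<close>, the mean by the cost descent.\<close>

lemma dX_bound:
  "(norm (dX k \<omega>))\<^sup>2 \<le> 4 * \<gamma>\<^sup>2 * (norm (disagreement W (X k \<omega>)))\<^sup>2 + 16 * \<gamma>\<^sup>2 * (norm (errX k \<omega>))\<^sup>2
    + 4 * \<eta>\<^sup>2 * (norm (Y k \<omega> - consensus (Y k \<omega>)))\<^sup>2 + 4 * \<eta>\<^sup>2 * (norm (consensus (Y k \<omega>)))\<^sup>2"
proof -
  let ?D = "disagreement W (X k \<omega>)" and ?R = "disagreement W (errX k \<omega>)"
  have "dX k \<omega> = - (\<gamma> *\<^sub>R ?D) + \<gamma> *\<^sub>R ?R + - (\<eta> *\<^sub>R (Y k \<omega> - consensus (Y k \<omega>)))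
      + - (\<eta> *\<^sub>R consensus (Y k \<omega>))"
    unfolding X_Suc by (simp add: algebra_simps)
  then have "(norm (dX k \<omega>))\<^sup>2 \<le> 4 * ((norm (- (\<gamma> *\<^sub>R ?D)))\<^sup>2 + (norm (\<gamma> *\<^sub>R ?R))\<^sup>2
      + (norm (- (\<eta> *\<^sub>R (Y k \<omega> - consensus (Y k \<omega>)))))\<^sup>2 + (norm (- (\<eta> *\<^sub>R consensus (Y k \<omega>))))\<^sup>2)"
    by (simp only: norm_add4_power2_le)
  also have "\<dots> = 4 * \<gamma>\<^sup>2 * (norm ?D)\<^sup>2 + 4 * (norm (\<gamma> *\<^sub>R ?R))\<^sup>2
      + 4 * \<eta>\<^sup>2 * (norm (Y k \<omega> - consensus (Y k \<omega>)))\<^sup>2 + 4 * \<eta>\<^sup>2 * (norm (consensus (Y k \<omega>)))\<^sup>2"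
    unfolding norm_minus_cancel norm_scaleR power_mult_distrib power2_abs by simp
  finally show ?thesis
    using norm_scaled_disagreement_le[of "errX k \<omega>"] by linarith
qed

lemma dY_bound:
  "(norm (dY k \<omega>))\<^sup>2 \<le> 3 * (\<gamma>\<^sup>2 * (norm (disagreement W (Y k \<omega>)))\<^sup>2
    + 4 * \<gamma>\<^sup>2 * (norm (errY k \<omega>))\<^sup>2 + Lf\<^sup>2 * (norm (dX k \<omega>))\<^sup>2)"
proof -
  let ?D = "disagreement W (Y k \<omega>)" and ?R = "disagreement W (errY k \<omega>)"
  let ?G = "stacked_grad F (X (Suc k) \<omega>) - stacked_grad F (X k \<omega>)"
  have "dY k \<omega> = - (\<gamma> *\<^sub>R ?D) + \<gamma> *\<^sub>R ?R + ?G"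
    unfolding Y_Suc by (simp add: algebra_simps)
  then have "(norm (dY k \<omega>))\<^sup>2 \<le> 3 * ((norm (- (\<gamma> *\<^sub>R ?D)))\<^sup>2 + (norm (\<gamma> *\<^sub>R ?R))\<^sup>2 + (norm ?G)\<^sup>2)"
    by (simp only: norm_add3_power2_le)
  also have "\<dots> \<le> 3 * (\<gamma>\<^sup>2 * (norm ?D)\<^sup>2 + 4 * \<gamma>\<^sup>2 * (norm (errY k \<omega>))\<^sup>2 + Lf\<^sup>2 * (norm (dX k \<omega>))\<^sup>2)"
  proof (intro mult_left_mono add_mono norm_scaled_disagreement_le)
    show "(norm (- (\<gamma> *\<^sub>R ?D)))\<^sup>2 \<le> \<gamma>\<^sup>2 * (norm ?D)\<^sup>2"
      unfolding norm_minus_cancel norm_scaleR power_mult_distrib power2_abs by simp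
    show "(norm ?G)\<^sup>2 \<le> Lf\<^sup>2 * (norm (dX k \<omega>))\<^sup>2"
      using power_mono[OF norm_stacked_grad_diff_le, of "X (Suc k) \<omega>" "X k \<omega>" 2]
      by (simp add: power_mult_distrib)
  qed simp
  finally show ?thesis .
qed

text \<open>Subtracting the consensus part removes the mean of \<open>Y\<close> from the
  perturbation of the gossip step. The factor \<open>8\<close> is 2 from splitting the perturbation
  times 4 from the norm of \<open>I - W\<close>.\<close>

lemma consensus_X_Suc:
  assumes \<gamma>: "0 < \<gamma>" "\<gamma> \<le> 1 / 400" and \<nu>: "0 \<le> \<nu>" "\<nu> \<le> 1"
  shows "(norm (X (Suc k) \<omega> - consensus (X (Suc k) \<omega>)))\<^sup>2 \<le>
    (1 - (1 - 201 / 100 * \<nu>) * (\<gamma> * (1 - \<sigma>))) * (norm (X k \<omega> - consensus (X k \<omega>)))\<^sup>2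
    - 99 / 100 * \<nu> * \<gamma> * (norm (disagreement W (X k \<omega>)))\<^sup>2
    + 8 * \<gamma> / (1 - \<sigma>) * (norm (errX k \<omega>))\<^sup>2
    + 2 * \<eta>\<^sup>2 / (\<gamma> * (1 - \<sigma>)) * (norm (Y k \<omega> - consensus (Y k \<omega>)))\<^sup>2"
proof -
  let ?v = "X k \<omega> - consensus (X k \<omega>)"
  let ?y = "Y k \<omega> - consensus (Y k \<omega>)"
  let ?z = "\<gamma> *\<^sub>R disagreement W (errX k \<omega>) + - (\<eta> *\<^sub>R ?y)"
  have eq: "X (Suc k) \<omega> - consensus (X (Suc k) \<omega>) = ?v - \<gamma> *\<^sub>R disagreement W ?v + ?z"
    unfolding X_Suc disagreement_diff_consensus
    by (simp add: consensus_add consensus_diff consensus_scaleR consensus_eq_0 algebra_simps)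
  have "(norm ?z)\<^sup>2 \<le> 2 * (norm (\<gamma> *\<^sub>R disagreement W (errX k \<omega>)))\<^sup>2 + 2 * (norm (- (\<eta> *\<^sub>R ?y)))\<^sup>2"
    by (rule norm_add_power2_le)
  also have "\<dots> \<le> 8 * \<gamma>\<^sup>2 * (norm (errX k \<omega>))\<^sup>2 + 2 * \<eta>\<^sup>2 * (norm ?y)\<^sup>2"
    using norm_scaled_disagreement_le[of "errX k \<omega>"] unfolding norm_minus_cancel norm_scaleR
      power_mult_distrib power2_abs by linarith
  finally have "(norm ?z)\<^sup>2 / (\<gamma> * (1 - \<sigma>))
      \<le> (8 * \<gamma>\<^sup>2 * (norm (errX k \<omega>))\<^sup>2 + 2 * \<eta>\<^sup>2 * (norm ?y)\<^sup>2) / (\<gamma> * (1 - \<sigma>))"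
    using \<gamma> sigma by (intro divide_right_mono) auto
  also have "\<dots> = 8 * \<gamma> / (1 - \<sigma>) * (norm (errX k \<omega>))\<^sup>2 + 2 * \<eta>\<^sup>2 / (\<gamma> * (1 - \<sigma>)) * (norm ?y)\<^sup>2"
    using \<gamma> by (simp add: add_divide_distrib power2_eq_square)
  finally have z: "(norm ?z)\<^sup>2 / (\<gamma> * (1 - \<sigma>)) \<le> \<dots>" .
  have "average ?v = 0" by (simp add: average_diff)
  from gossip_contraction[OF this \<gamma> \<nu> refl, of ?z, folded eq, unfolded disagreement_diff_consensus]
  show ?thesis using z by linarith
qed

lemma consensus_Y_Suc:
  assumes \<gamma>: "0 < \<gamma>" "\<gamma> \<le> 1 / 400" and \<nu>: "0 \<le> \<nu>" "\<nu> \<le> 1"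
  shows "(norm (Y (Suc k) \<omega> - consensus (Y (Suc k) \<omega>)))\<^sup>2 \<le>
    (1 - (1 - 201 / 100 * \<nu>) * (\<gamma> * (1 - \<sigma>))) * (norm (Y k \<omega> - consensus (Y k \<omega>)))\<^sup>2
    - 99 / 100 * \<nu> * \<gamma> * (norm (disagreement W (Y k \<omega>)))\<^sup>2
    + 8 * \<gamma> / (1 - \<sigma>) * (norm (errY k \<omega>))\<^sup>2
    + 2 * Lf\<^sup>2 / (\<gamma> * (1 - \<sigma>)) * (norm (dX k \<omega>))\<^sup>2"
proof -
  let ?v = "Y k \<omega> - consensus (Y k \<omega>)"
  let ?G = "stacked_grad F (X (Suc k) \<omega>) - stacked_grad F (X k \<omega>)"
  let ?z = "\<gamma> *\<^sub>R disagreement W (errY k \<omega>) + (?G - consensus ?G)"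
  have eq: "Y (Suc k) \<omega> - consensus (Y (Suc k) \<omega>) = ?v - \<gamma> *\<^sub>R disagreement W ?v + ?z"
    unfolding Y_Suc disagreement_diff_consensus
    by (simp add: consensus_add consensus_diff consensus_scaleR consensus_eq_0 algebra_simps)
  have "norm (?G - consensus ?G) \<le> Lf * norm (dX k \<omega>)"
    using norm_diff_consensus_le norm_stacked_grad_diff_le by (rule order_trans)
  from power_mono[OF this, of 2]
  have G: "(norm (?G - consensus ?G))\<^sup>2 \<le> Lf\<^sup>2 * (norm (dX k \<omega>))\<^sup>2"
    by (simp add: power_mult_distrib)
  have "(norm ?z)\<^sup>2 \<le> 2 * (norm (\<gamma> *\<^sub>R disagreement W (errY k \<omega>)))\<^sup>2 + 2 * (norm (?G - consensus ?G))\<^sup>2"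
    by (rule norm_add_power2_le)
  also have "\<dots> \<le> 8 * \<gamma>\<^sup>2 * (norm (errY k \<omega>))\<^sup>2 + 2 * Lf\<^sup>2 * (norm (dX k \<omega>))\<^sup>2"
    using norm_scaled_disagreement_le[of "errY k \<omega>"] G by linarith
  finally have "(norm ?z)\<^sup>2 / (\<gamma> * (1 - \<sigma>))
      \<le> (8 * \<gamma>\<^sup>2 * (norm (errY k \<omega>))\<^sup>2 + 2 * Lf\<^sup>2 * (norm (dX k \<omega>))\<^sup>2) / (\<gamma> * (1 - \<sigma>))"
    using \<gamma> sigma by (intro divide_right_mono) auto
  also have "\<dots> = 8 * \<gamma> / (1 - \<sigma>) * (norm (errY k \<omega>))\<^sup>2 + 2 * Lf\<^sup>2 / (\<gamma> * (1 - \<sigma>)) * (norm (dX k \<omega>))\<^sup>2"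
    using \<gamma> by (simp add: add_divide_distrib power2_eq_square)
  finally have z: "(norm ?z)\<^sup>2 / (\<gamma> * (1 - \<sigma>)) \<le> \<dots>" .
  have "average ?v = 0" by (simp add: average_diff)
  from gossip_contraction[OF this \<gamma> \<nu> refl, of ?z, folded eq, unfolded disagreement_diff_consensus]
  show ?thesis using z by linarith
qed

text \<open>\<open>V - p *\<^sub>R Q\<close> is a convex combination, with weight
  \<open>p * r\<close>, of \<open>V\<close> and the error of the rescaled compressor.\<close>

lemma norm_residual_le:
  fixes V Q :: "real^'d^'n"
  assumes "0 \<le> p" "p * r \<le> 1"
  shows "(norm (V - p *\<^sub>R Q))\<^sup>2 \<le> (1 - p * r) * (norm V)\<^sup>2 + p * r * (norm (Q /\<^sub>R r - V))\<^sup>2"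
proof -
  have "V - p *\<^sub>R Q = (1 - p * r) *\<^sub>R V + (p * r) *\<^sub>R (V - Q /\<^sub>R r)"
    using r by (simp add: algebra_simps)
  then show ?thesis
    using norm_convex_power2_le[of "p * r" V "V - Q /\<^sub>R r"] assms r
    by (simp add: norm_minus_commute)
qed

text \<open>The unscaled error mixes the rescaled one with the bias \<open>1 - r\<close>. Together
  with the compressor bound this is the origin of \<open>K\<close>.\<close>

lemma norm_compression_error_le:
  fixes V Q :: "real^'d^'n"
  shows "(norm (V - Q))\<^sup>2 \<le> 2 * r\<^sup>2 * (norm (Q /\<^sub>R r - V))\<^sup>2 + 2 * (1 - r)\<^sup>2 * (norm V)\<^sup>2"
proof -
  have "V - Q = r *\<^sub>R (V - Q /\<^sub>R r) + (1 - r) *\<^sub>R V"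
    using r by (simp add: algebra_simps)
  then show ?thesis
    using norm_add_power2_le[of "r *\<^sub>R (V - Q /\<^sub>R r)" "(1 - r) *\<^sub>R V"]
    by (simp add: norm_minus_commute power_mult_distrib)
qed

lemma sq_integrable_gradient:
  "sq_integrable (\<lambda>\<omega>. grad (avg_cost F) (average (X k \<omega>)))"
  unfolding grad_avg_cost_average
  by (intro sq_integrable_intros sq_integrable_linear[OF linear_average])

text \<open>The optimal value bounds the cost from below and the descent inequality at 0 bounds it
  from above by a quadratic.\<close>

lemma integrable_gap:
  "integrable M (\<lambda>\<omega>. avg_cost F (average (X k \<omega>)))"
proof -
  have sq: "sq_integrable (\<lambda>\<omega>. average (X k \<omega>))"
    by (intro sq_integrable_intros sq_integrable_linear[OF linear_average])
  have "continuous_on UNIV (avg_cost F)"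
    by (intro continuous_at_imp_continuous_on ballI differentiable_imp_continuous_within
        avg_cost_differentiable)
  from measurable_compose[OF sq_integrableD(1)[OF sq] borel_measurable_continuous_onI[OF this]]
  have meas: "(\<lambda>\<omega>. avg_cost F (average (X k \<omega>))) \<in> borel_measurable M" .
  let ?G = "grad (avg_cost F) 0"
  let ?b = "\<lambda>x. \<bar>opt_value F\<bar> + \<bar>avg_cost F 0\<bar> + (norm ?G)\<^sup>2 + (1 + Lf) * (norm x)\<^sup>2"
  have "\<bar>avg_cost F x\<bar> \<le> ?b x" for x
  proof -
    have "avg_cost F (0 + x) \<le> avg_cost F 0 + inner ?G x + Lf / 2 * (norm x)\<^sup>2"
      by (rule descent_inequality[OF avg_cost_differentiable avg_cost_Lipschitz])
    then have "avg_cost F x \<le> avg_cost F 0 + inner ?G x + Lf / 2 * (norm x)\<^sup>2" by simp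
    moreover have "2 * inner ?G x \<le> (norm ?G)\<^sup>2 + (norm x)\<^sup>2"
    proof -
      have "(norm ?G)\<^sup>2 + (norm x)\<^sup>2 - 2 * inner ?G x = (norm (?G - x))\<^sup>2"
        by (simp add: power2_norm_eq_inner inner_diff_left inner_diff_right inner_commute)
      also have "\<dots> \<ge> 0" by simp
      finally show ?thesis by simp
    qed
    moreover have "0 \<le> Lf * (norm x)\<^sup>2" "0 \<le> (norm ?G)\<^sup>2" "0 \<le> (norm x)\<^sup>2" using Lf by auto
    ultimately show ?thesis
      using opt_value_le[of x] unfolding distrib_right by linarith
  qed
  then have le: "norm (avg_cost F (average (X k \<omega>))) \<le> norm (?b (average (X k \<omega>)))" for \<omega>
    unfolding real_norm_def by (rule order_trans[OF _ abs_ge_self])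
  have "integrable M (\<lambda>\<omega>. ?b (average (X k \<omega>)))"
    using sq_integrableD(2)[OF sq] by simp
  from Bochner_Integration.integrable_bound[OF this meas AE_I2[OF le]] show ?thesis .
qed

end

section \<open>Estimates in expectation\<close>

context prob_space
begin

abbreviation msq :: "('a \<Rightarrow> 'b::euclidean_space) \<Rightarrow> real" where
  "msq f \<equiv> (\<integral>\<omega>. (norm (f \<omega>))\<^sup>2 \<partial>M)"

lemma msq_nonneg: "0 \<le> msq f"
  by (simp add: integral_nonneg_AE)

lemma msq_bound4:
  assumes "sq_integrable f" "sq_integrable g1" "sq_integrable g2" "sq_integrable g3" "sq_integrable g4"
    and le: "\<And>\<omega>. (norm (f \<omega>))\<^sup>2 \<le> a1 * (norm (g1 \<omega>))\<^sup>2 + a2 * (norm (g2 \<omega>))\<^sup>2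
      + a3 * (norm (g3 \<omega>))\<^sup>2 + a4 * (norm (g4 \<omega>))\<^sup>2"
  shows "msq f \<le> a1 * msq g1 + a2 * msq g2 + a3 * msq g3 + a4 * msq g4"
proof -
  note int = assms(1-5)[THEN sq_integrableD(2)]
  have "msq f \<le> (\<integral>\<omega>. a1 * (norm (g1 \<omega>))\<^sup>2 + a2 * (norm (g2 \<omega>))\<^sup>2
      + a3 * (norm (g3 \<omega>))\<^sup>2 + a4 * (norm (g4 \<omega>))\<^sup>2 \<partial>M)"
    using int by (intro integral_mono le) auto
  also have "\<dots> = a1 * msq g1 + a2 * msq g2 + a3 * msq g3 + a4 * msq g4"
    using int by simp
  finally show ?thesis .
qed

lemma msq_bound3:
  assumes "sq_integrable f" "sq_integrable g1" "sq_integrable g2" "sq_integrable g3"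
    and le: "\<And>\<omega>. (norm (f \<omega>))\<^sup>2 \<le> a1 * (norm (g1 \<omega>))\<^sup>2 + a2 * (norm (g2 \<omega>))\<^sup>2
      + a3 * (norm (g3 \<omega>))\<^sup>2"
  shows "msq f \<le> a1 * msq g1 + a2 * msq g2 + a3 * msq g3"
  using msq_bound4[OF assms(1-4) assms(4), of a1 a2 a3 0] le by simp

lemma msq_bound2:
  assumes "sq_integrable f" "sq_integrable g1" "sq_integrable g2"
    and le: "\<And>\<omega>. (norm (f \<omega>))\<^sup>2 \<le> a1 * (norm (g1 \<omega>))\<^sup>2 + a2 * (norm (g2 \<omega>))\<^sup>2"
  shows "msq f \<le> a1 * msq g1 + a2 * msq g2"
  using msq_bound3[OF assms(1-3) assms(3), of a1 a2 0] le by simp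

end

locale ef_tuned =
  ef_algorithm E W \<sigma> F Lf M S \<C> \<xi> x0 r \<psi> \<phi>X \<phi>Y \<gamma> \<eta> vs +
  step_sizes "1 - \<sigma>" Lf c1 c2 K \<phi> \<phi>h \<gamma> \<eta>
  for E :: "('n::finite \<times> 'n) set" and W :: "real^'n^'n" and \<sigma> :: real
    and F :: "'n \<Rightarrow> real^'d \<Rightarrow> real" and Lf :: real and M :: "'w measure"
    and S :: "'s measure" and \<C> :: "'s \<Rightarrow> real^'d \<Rightarrow> real^'d"
    and \<xi> :: "nat \<times> channel \<times> 'n \<Rightarrow> 'w \<Rightarrow> 's" and x0 :: "real^'d^'n"
    and r \<psi> \<phi>X \<phi>Y \<gamma> \<eta> vs c1 c2 K \<phi> \<phi>h :: real +
  assumes phiX: "0 < \<phi>X" "\<phi>X * r < 1" "c1 = \<phi>X * \<psi> * r / 2"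
    and phiY: "0 < \<phi>Y" "\<phi>Y * r < 1" "c2 = \<phi>Y * \<psi> * r / 2"
    and K_eq: "K = 2 * r\<^sup>2 * (1 - \<psi>) + 2 * (1 - r)\<^sup>2"
    and vs: "4 * K * vs\<^sup>2 \<le> 1" "(2 * K + 1) * vs\<^sup>2 \<le> 1"
    and eta_le: "\<eta> \<le> 1 / (2 * Lf)"
begin

text \<open>\<open>vs *\<^sub>R Er + P - Q\<close> is the next accumulated error. Its bound costs
  \<open>2 * K * vs\<^sup>2\<close>, at most \<open>1 / 2\<close>; removing the feedback
  \<open>vs *\<^sub>R Er\<close> costs \<open>2 * (2 * K + 1) * vs\<^sup>2\<close>, at most 2. These
  are the two conditions on \<open>vs\<close>.\<close>

lemma accumulated_error_moments:
  fixes Er P Q :: "'w \<Rightarrow> real^'d^'n"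
  assumes sq: "sq_integrable Er" "sq_integrable P" "sq_integrable Q"
    and err: "msq (\<lambda>\<omega>. Q \<omega> /\<^sub>R r - (vs *\<^sub>R Er \<omega> + P \<omega>)) \<le> (1 - \<psi>) * msq (\<lambda>\<omega>. vs *\<^sub>R Er \<omega> + P \<omega>)"
  shows "msq (\<lambda>\<omega>. vs *\<^sub>R Er \<omega> + P \<omega> - Q \<omega>) \<le> msq Er / 2 + 2 * K * msq P"
    and "msq (\<lambda>\<omega>. P \<omega> - Q \<omega>) \<le> 2 * msq Er + 4 * K * msq P"
proof -
  let ?V = "\<lambda>\<omega>. vs *\<^sub>R Er \<omega> + P \<omega>"
  note intros = sq_integrable_add sq_integrable_diff sq_integrable_scaleR sq
  have "msq ?V \<le> 2 * vs\<^sup>2 * msq Er + 2 * msq P"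
  proof (rule msq_bound2)
    show "(norm (?V \<omega>))\<^sup>2 \<le> 2 * vs\<^sup>2 * (norm (Er \<omega>))\<^sup>2 + 2 * (norm (P \<omega>))\<^sup>2" for \<omega>
      using norm_add_power2_le[of "vs *\<^sub>R Er \<omega>" "P \<omega>"] by (simp add: power_mult_distrib)
  qed (intro intros)+
  then have V: "K * msq ?V \<le> K * (2 * vs\<^sup>2 * msq Er + 2 * msq P)"
    using K by (intro mult_left_mono) auto
  have "msq (\<lambda>\<omega>. ?V \<omega> - Q \<omega>) \<le> 2 * r\<^sup>2 * msq (\<lambda>\<omega>. Q \<omega> /\<^sub>R r - ?V \<omega>) + 2 * (1 - r)\<^sup>2 * msq ?V"
    by (rule msq_bound2[OF _ _ _ norm_compression_error_le]) (intro intros)+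
  also have "\<dots> \<le> 2 * r\<^sup>2 * ((1 - \<psi>) * msq ?V) + 2 * (1 - r)\<^sup>2 * msq ?V"
    using err by (intro add_right_mono mult_left_mono) auto
  also have "\<dots> = K * msq ?V"
    unfolding K_eq by (simp add: distrib_right)
  finally have 1: "msq (\<lambda>\<omega>. ?V \<omega> - Q \<omega>) \<le> 2 * (K * vs\<^sup>2) * msq Er + 2 * K * msq P"
    using V by (simp add: algebra_simps)
  have "4 * K * vs\<^sup>2 * msq Er \<le> 1 * msq Er"
    by (rule mult_right_mono[OF vs(1) msq_nonneg])
  then show "msq (\<lambda>\<omega>. ?V \<omega> - Q \<omega>) \<le> msq Er / 2 + 2 * K * msq P"
    using 1 by simp
  have "msq (\<lambda>\<omega>. P \<omega> - Q \<omega>) \<le> 2 * msq (\<lambda>\<omega>. ?V \<omega> - Q \<omega>) + 2 * vs\<^sup>2 * msq Er"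
  proof (rule msq_bound2)
    show "(norm (P \<omega> - Q \<omega>))\<^sup>2 \<le> 2 * (norm (?V \<omega> - Q \<omega>))\<^sup>2 + 2 * vs\<^sup>2 * (norm (Er \<omega>))\<^sup>2" for \<omega>
      using norm_add_power2_le[of "?V \<omega> - Q \<omega>" "- (vs *\<^sub>R Er \<omega>)"] by (simp add: power_mult_distrib)
  qed (intro intros)+
  also have "\<dots> \<le> 2 * ((2 * K + 1) * vs\<^sup>2 * msq Er) + 4 * K * msq P"
    using 1 by (simp add: algebra_simps)
  also have "(2 * K + 1) * vs\<^sup>2 * msq Er \<le> 1 * msq Er"
    by (rule mult_right_mono[OF vs(2) msq_nonneg])
  finally show "msq (\<lambda>\<omega>. P \<omega> - Q \<omega>) \<le> 2 * msq Er + 4 * K * msq P"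
    by simp
qed

text \<open>Compression contracts by \<open>1 - p * r * \<psi> = 1 - 2 * c\<close>. Young's
  inequality with parameter \<open>c\<close> splits off the drift, and
  \<open>(1 + c) * (1 - 2 * c) = 1 - c * (1 + 2 * c)\<close>.\<close>

lemma residual_moments:
  fixes P Q d :: "'w \<Rightarrow> real^'d^'n"
  assumes sq: "sq_integrable P" "sq_integrable Q" "sq_integrable d"
    and err: "msq (\<lambda>\<omega>. Q \<omega> /\<^sub>R r - P \<omega>) \<le> (1 - \<psi>) * msq P"
    and p: "0 < p" "p * r < 1" and c: "c = p * \<psi> * r / 2" "0 < c"
  shows "msq (\<lambda>\<omega>. P \<omega> - p *\<^sub>R Q \<omega> + d \<omega>) \<le> (1 - c * (1 + 2 * c)) * msq P + (1 + 1 / c) * msq d"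
proof -
  note intros = sq_integrable_add sq_integrable_diff sq_integrable_scaleR sq
  have pr: "0 \<le> p * r" using p r by simp
  have "msq (\<lambda>\<omega>. P \<omega> - p *\<^sub>R Q \<omega>) \<le> (1 - p * r) * msq P + p * r * msq (\<lambda>\<omega>. Q \<omega> /\<^sub>R r - P \<omega>)"
    using p by (intro msq_bound2[OF _ _ _ norm_residual_le] intros) auto
  also have "\<dots> \<le> (1 - p * r) * msq P + p * r * ((1 - \<psi>) * msq P)"
    using err pr by (intro add_left_mono mult_left_mono)
  also have "\<dots> = (1 - 2 * c) * msq P"
    unfolding c(1) by (simp add: algebra_simps)
  finally have "(1 + c) * msq (\<lambda>\<omega>. P \<omega> - p *\<^sub>R Q \<omega>) \<le> (1 + c) * ((1 - 2 * c) * msq P)"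
    using c(2) by (intro mult_left_mono) auto
  also have "\<dots> = (1 - c * (1 + 2 * c)) * msq P"
    by (simp add: algebra_simps)
  finally have 1: "(1 + c) * msq (\<lambda>\<omega>. P \<omega> - p *\<^sub>R Q \<omega>) \<le> (1 - c * (1 + 2 * c)) * msq P" .
  have "msq (\<lambda>\<omega>. P \<omega> - p *\<^sub>R Q \<omega> + d \<omega>) \<le> (1 + c) * msq (\<lambda>\<omega>. P \<omega> - p *\<^sub>R Q \<omega>) + (1 + 1 / c) * msq d"
    by (rule msq_bound2[OF _ _ _ norm_add_power2_le_young[OF c(2)]]) (intro intros)+
  with 1 show ?thesis by linarith
qed

abbreviation "devX k \<omega> \<equiv> X k \<omega> - consensus (X k \<omega>)"
abbreviation "devY k \<omega> \<equiv> Y k \<omega> - consensus (Y k \<omega>)"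
abbreviation "resX k \<omega> \<equiv> X k \<omega> - A k \<omega>"
abbreviation "resY k \<omega> \<equiv> Y k \<omega> - C k \<omega>"
abbreviation "gradient k \<equiv> real CARD('n) * msq (\<lambda>\<omega>. grad (avg_cost F) (average (X k \<omega>)))"
abbreviation "gap k \<equiv>
  (\<integral>\<omega>. real CARD('n) * (avg_cost F (average (X k \<omega>)) - opt_value F) \<partial>M)"

lemma error_X_moments:
  "msq (ErX (Suc k)) \<le> msq (ErX k) / 2 + 2 * K * msq (resX k)"
  "msq (errX k) \<le> 2 * msq (ErX k) + 4 * K * msq (resX k)"
proof -
  have err: "msq (\<lambda>\<omega>. QhX k \<omega> /\<^sub>R r - (vs *\<^sub>R ErX k \<omega> + resX k \<omega>))
      \<le> (1 - \<psi>) * msq (\<lambda>\<omega>. vs *\<^sub>R ErX k \<omega> + resX k \<omega>)"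
    using compression_error(3)[of k] by (simp only: add_diff_eq)
  have res: "sq_integrable (resX k)"
    by (intro sq_integrable_intros)
  note * = accumulated_error_moments[where Er = "ErX k" and P = "resX k" and Q = "QhX k",
      OF sq_integrable_EX res sq_integrable_Q(3) err]
  show "msq (ErX (Suc k)) \<le> msq (ErX k) / 2 + 2 * K * msq (resX k)"
    unfolding run_Suc(3) using *(1) by (simp only: add_diff_eq)
  show "msq (errX k) \<le> 2 * msq (ErX k) + 4 * K * msq (resX k)"
    by (rule *(2))
qed

lemma error_Y_moments:
  "msq (ErY (Suc k)) \<le> msq (ErY k) / 2 + 2 * K * msq (resY k)"
  "msq (errY k) \<le> 2 * msq (ErY k) + 4 * K * msq (resY k)"
proof -
  have err: "msq (\<lambda>\<omega>. QhY k \<omega> /\<^sub>R r - (vs *\<^sub>R ErY k \<omega> + resY k \<omega>))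
      \<le> (1 - \<psi>) * msq (\<lambda>\<omega>. vs *\<^sub>R ErY k \<omega> + resY k \<omega>)"
    using compression_error(4)[of k] by (simp only: add_diff_eq)
  have res: "sq_integrable (resY k)"
    by (intro sq_integrable_intros)
  note * = accumulated_error_moments[where Er = "ErY k" and P = "resY k" and Q = "QhY k",
      OF sq_integrable_EY res sq_integrable_Q(4) err]
  show "msq (ErY (Suc k)) \<le> msq (ErY k) / 2 + 2 * K * msq (resY k)"
    unfolding run_Suc(4) using *(1) by (simp only: add_diff_eq)
  show "msq (errY k) \<le> 2 * msq (ErY k) + 4 * K * msq (resY k)"
    by (rule *(2))
qed

lemma residual_X_moments:
  "msq (resX (Suc k)) \<le> (1 - c1 * (1 + 2 * c1)) * msq (resX k) + (1 + 1 / c1) * msq (dX k)"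
proof -
  have eq: "resX (Suc k) \<omega> = resX k \<omega> - \<phi>X *\<^sub>R QX k \<omega> + dX k \<omega>" for \<omega>
    unfolding run_Suc(1) by simp
  show ?thesis
    unfolding eq
    by (rule residual_moments[OF _ _ _ compression_error(1) phiX(1,2,3) c1(1)])
      (intro sq_integrable_intros sq_integrable_Q)+
qed

lemma residual_Y_moments:
  "msq (resY (Suc k)) \<le> (1 - c2 * (1 + 2 * c2)) * msq (resY k) + (1 + 1 / c2) * msq (dY k)"
proof -
  have eq: "resY (Suc k) \<omega> = resY k \<omega> - \<phi>Y *\<^sub>R QY k \<omega> + dY k \<omega>" for \<omega>
    unfolding run_Suc(2) by simp
  show ?thesis
    unfolding eq
    by (rule residual_moments[OF _ _ _ compression_error(2) phiY(1,2,3) c2(1)])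
      (intro sq_integrable_intros sq_integrable_Q)+
qed

lemma gap_moments:
  "gap (Suc k) \<le> gap k - \<eta> / 2 * gradient k - \<eta> / 4 * msq (\<lambda>\<omega>. consensus (Y k \<omega>))
    + \<eta> / 2 * Lf\<^sup>2 * msq (devX k)"
proof -
  let ?n = "real CARD('n)"
  have cons: "consensus (Y k \<omega>) = consensus (stacked_grad F (X k \<omega>))" for \<omega>
    by (simp add: consensus_def average_Y)
  have path: "?n * (avg_cost F (average (X (Suc k) \<omega>)) - opt_value F)
      \<le> ?n * (avg_cost F (average (X k \<omega>)) - opt_value F)
        - \<eta> / 2 * (?n * (norm (grad (avg_cost F) (average (X k \<omega>))))\<^sup>2)
        - \<eta> / 4 * (norm (consensus (Y k \<omega>)))\<^sup>2 + \<eta> / 2 * Lf\<^sup>2 * (norm (devX k \<omega>))\<^sup>2" for \<omega>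
    using average_gradient_descent[OF eta(1) eta_le, of "X k \<omega>"]
    unfolding average_X_Suc cons right_diff_distrib by linarith
  have g: "integrable M (\<lambda>\<omega>. (norm (grad (avg_cost F) (average (X k \<omega>))))\<^sup>2)"
    by (rule sq_integrableD(2)[OF sq_integrable_gradient])
  have y: "integrable M (\<lambda>\<omega>. (norm (consensus (Y k \<omega>)))\<^sup>2)"
    and x: "integrable M (\<lambda>\<omega>. (norm (devX k \<omega>))\<^sup>2)"
    by (intro sq_integrableD(2) sq_integrable_intros)+
  have f: "integrable M (\<lambda>\<omega>. ?n * (avg_cost F (average (X k \<omega>)) - opt_value F))" for k
    using integrable_gap[of k] by simp
  have "gap (Suc k) \<le> (\<integral>\<omega>. ?n * (avg_cost F (average (X k \<omega>)) - opt_value F)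
        - \<eta> / 2 * (?n * (norm (grad (avg_cost F) (average (X k \<omega>))))\<^sup>2)
        - \<eta> / 4 * (norm (consensus (Y k \<omega>)))\<^sup>2 + \<eta> / 2 * Lf\<^sup>2 * (norm (devX k \<omega>))\<^sup>2 \<partial>M)"
    using f g x y by (intro integral_mono path) auto
  also have "\<dots> = gap k - \<eta> / 2 * gradient k - \<eta> / 4 * msq (\<lambda>\<omega>. consensus (Y k \<omega>))
    + \<eta> / 2 * Lf\<^sup>2 * msq (devX k)"
    using f[of k] g x y
    by (simp only: Bochner_Integration.integral_add Bochner_Integration.integral_diff
        integrable_mult_right Bochner_Integration.integrable_diff integral_mult_right_zero)
  finally show ?thesis .
qed

lemma one_step:
  "one_step (1 - \<sigma>) Lf c1 c2 K \<phi> \<phi>h \<gamma> \<eta> (msq (devX k)) (msq (devY k))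
    (msq (\<lambda>\<omega>. disagreement W (X k \<omega>))) (msq (\<lambda>\<omega>. disagreement W (Y k \<omega>)))
    (msq (resX k)) (msq (resY k)) (msq (ErX k)) (msq (ErY k))
    (msq (\<lambda>\<omega>. consensus (Y k \<omega>))) (gradient k) (gap k) (msq (errX k)) (msq (errY k)) (msq (dX k))
    (msq (devX (Suc k))) (msq (devY (Suc k))) (msq (resX (Suc k))) (msq (resY (Suc k)))
    (msq (ErX (Suc k))) (msq (ErY (Suc k))) (gap (Suc k))"
proof (intro one_step.intro one_step_axioms.intro step_sizes_axioms msq_nonneg
    error_X_moments error_Y_moments residual_X_moments gap_moments)
  note intros = sq_integrable_intros sq_integrable_Q
  have D: "(norm (disagreement W v))\<^sup>2 \<le> 4 * (norm (v - consensus v))\<^sup>2" for v :: "real^'d^'n"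
    using norm_disagreement_power2_le[of "v - consensus v"] by (simp add: disagreement_diff_consensus)
  show "msq (\<lambda>\<omega>. disagreement W (X k \<omega>)) \<le> 4 * msq (devX k)"
    using msq_bound2[of "\<lambda>\<omega>. disagreement W (X k \<omega>)" "devX k" "devX k" 4 0] D
    by (simp add: intros)
  show "msq (\<lambda>\<omega>. disagreement W (Y k \<omega>)) \<le> 4 * msq (devY k)"
    using msq_bound2[of "\<lambda>\<omega>. disagreement W (Y k \<omega>)" "devY k" "devY k" 4 0] D
    by (simp add: intros)
  show "msq (dX k) \<le> 4 * \<gamma>\<^sup>2 * msq (\<lambda>\<omega>. disagreement W (X k \<omega>)) + 16 * \<gamma>\<^sup>2 * msq (errX k)
      + 4 * \<eta>\<^sup>2 * msq (devY k) + 4 * \<eta>\<^sup>2 * msq (\<lambda>\<omega>. consensus (Y k \<omega>))"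
    by (rule msq_bound4[OF _ _ _ _ _ dX_bound]) (intro intros)+
  \<comment> \<open>Interpolation with \<open>\<nu> = 1 / 20\<close>:
    \<open>1 - 2.01 / 20 = 0.8995\<close> and \<open>0.99 / 20 = 0.0495\<close>. A little
    contraction is traded for the dissipation of \<open>NX\<close>.\<close>
  have "msq (devX (Suc k)) \<le> (1 - 8995 / 10000 * \<alpha>) * msq (devX k)
      + (- (495 / 10000 * \<gamma>)) * msq (\<lambda>\<omega>. disagreement W (X k \<omega>))
      + 8 * \<gamma> / (1 - \<sigma>) * msq (errX k) + 2 * \<eta>\<^sup>2 / \<alpha> * msq (devY k)"
  proof (rule msq_bound4)
    show "(norm (devX (Suc k) \<omega>))\<^sup>2 \<le> (1 - 8995 / 10000 * \<alpha>) * (norm (devX k \<omega>))\<^sup>2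
      + (- (495 / 10000 * \<gamma>)) * (norm (disagreement W (X k \<omega>)))\<^sup>2
      + 8 * \<gamma> / (1 - \<sigma>) * (norm (errX k \<omega>))\<^sup>2 + 2 * \<eta>\<^sup>2 / \<alpha> * (norm (devY k \<omega>))\<^sup>2" for \<omega>
      using consensus_X_Suc[OF gamma(1) gamma_le, of "1 / 20" \<omega> k] by simp
  qed (intro intros)+
  then show "msq (devX (Suc k)) \<le> (1 - 8995 / 10000 * \<alpha>) * msq (devX k)
      - 495 / 10000 * \<gamma> * msq (\<lambda>\<omega>. disagreement W (X k \<omega>))
      + 8 * \<gamma> / (1 - \<sigma>) * msq (errX k) + 2 * \<eta>\<^sup>2 / \<alpha> * msq (devY k)"
    by simp
  have "msq (devY (Suc k)) \<le> (1 - 8995 / 10000 * \<alpha>) * msq (devY k)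
      + (- (495 / 10000 * \<gamma>)) * msq (\<lambda>\<omega>. disagreement W (Y k \<omega>))
      + 8 * \<gamma> / (1 - \<sigma>) * msq (errY k) + 2 * Lf\<^sup>2 / \<alpha> * msq (dX k)"
  proof (rule msq_bound4)
    show "(norm (devY (Suc k) \<omega>))\<^sup>2 \<le> (1 - 8995 / 10000 * \<alpha>) * (norm (devY k \<omega>))\<^sup>2
      + (- (495 / 10000 * \<gamma>)) * (norm (disagreement W (Y k \<omega>)))\<^sup>2
      + 8 * \<gamma> / (1 - \<sigma>) * (norm (errY k \<omega>))\<^sup>2 + 2 * Lf\<^sup>2 / \<alpha> * (norm (dX k \<omega>))\<^sup>2" for \<omega>
      using consensus_Y_Suc[OF gamma(1) gamma_le, of "1 / 20" \<omega> k] by simp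
  qed (intro intros)+
  then show "msq (devY (Suc k)) \<le> (1 - 8995 / 10000 * \<alpha>) * msq (devY k)
      - 495 / 10000 * \<gamma> * msq (\<lambda>\<omega>. disagreement W (Y k \<omega>))
      + 8 * \<gamma> / (1 - \<sigma>) * msq (errY k) + 2 * Lf\<^sup>2 / \<alpha> * msq (dX k)"
    by simp
  \<comment> \<open>Interpolation with \<open>\<nu> = 2 / 5\<close>: the factor
    \<open>1 - 0.196 * \<alpha>\<close> still does not exceed 1, and the dissipation is
    \<open>0.99 * 2 / 5 = 0.396\<close>.\<close>
  have "msq (devY (Suc k)) \<le> (1 - 196 / 1000 * \<alpha>) * msq (devY k)
      + (- (396 / 1000 * \<gamma>)) * msq (\<lambda>\<omega>. disagreement W (Y k \<omega>))
      + 8 * \<gamma> / (1 - \<sigma>) * msq (errY k) + 2 * Lf\<^sup>2 / \<alpha> * msq (dX k)"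
  proof (rule msq_bound4)
    show "(norm (devY (Suc k) \<omega>))\<^sup>2 \<le> (1 - 196 / 1000 * \<alpha>) * (norm (devY k \<omega>))\<^sup>2
      + (- (396 / 1000 * \<gamma>)) * (norm (disagreement W (Y k \<omega>)))\<^sup>2
      + 8 * \<gamma> / (1 - \<sigma>) * (norm (errY k \<omega>))\<^sup>2 + 2 * Lf\<^sup>2 / \<alpha> * (norm (dX k \<omega>))\<^sup>2" for \<omega>
      using consensus_Y_Suc[OF gamma(1) gamma_le, of "2 / 5" \<omega> k] by simp
  qed (intro intros)+
  moreover have "(1 - 196 / 1000 * \<alpha>) * msq (devY k) \<le> 1 * msq (devY k)"
    using alpha_pos by (intro mult_right_mono msq_nonneg) auto
  ultimately show "msq (devY (Suc k)) \<le> msq (devY k)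
      - 396 / 1000 * \<gamma> * msq (\<lambda>\<omega>. disagreement W (Y k \<omega>))
      + 8 * \<gamma> / (1 - \<sigma>) * msq (errY k) + 2 * Lf\<^sup>2 / \<alpha> * msq (dX k)"
    by simp
  have "msq (dY k) \<le> 3 * \<gamma>\<^sup>2 * msq (\<lambda>\<omega>. disagreement W (Y k \<omega>))
      + 12 * \<gamma>\<^sup>2 * msq (errY k) + 3 * Lf\<^sup>2 * msq (dX k)"
  proof (rule msq_bound3)
    show "(norm (dY k \<omega>))\<^sup>2 \<le> 3 * \<gamma>\<^sup>2 * (norm (disagreement W (Y k \<omega>)))\<^sup>2
      + 12 * \<gamma>\<^sup>2 * (norm (errY k \<omega>))\<^sup>2 + 3 * Lf\<^sup>2 * (norm (dX k \<omega>))\<^sup>2" for \<omega>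
      using dY_bound[of \<omega> k] by simp
  qed (intro intros)+
  then have "m2 * msq (dY k) \<le> m2 * (3 * \<gamma>\<^sup>2 * msq (\<lambda>\<omega>. disagreement W (Y k \<omega>))
      + 12 * \<gamma>\<^sup>2 * msq (errY k) + 3 * Lf\<^sup>2 * msq (dX k))"
    using m2_ge by (intro mult_left_mono) auto
  also have "\<dots> = 3 * m2 * (\<gamma>\<^sup>2 * msq (\<lambda>\<omega>. disagreement W (Y k \<omega>))
      + 4 * \<gamma>\<^sup>2 * msq (errY k) + Lf\<^sup>2 * msq (dX k))"
    by algebra
  finally show "msq (resY (Suc k)) \<le> (1 - c2 * (1 + 2 * c2)) * msq (resY k)
      + 3 * m2 * (\<gamma>\<^sup>2 * msq (\<lambda>\<omega>. disagreement W (Y k \<omega>))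
      + 4 * \<gamma>\<^sup>2 * msq (errY k) + Lf\<^sup>2 * msq (dX k))"
    using residual_Y_moments[of k] by simp
qed

end

section \<open>The two Lyapunov functions\<close>

context ef_tuned
begin

abbreviation "Uhat k \<equiv> (\<integral>\<omega>. lyap_Uhat F \<phi> \<phi>h (run (\<lambda>j. \<xi> j \<omega>) k) \<partial>M)"
abbreviation "V k \<equiv> (\<integral>\<omega>. lyap_V \<phi> (run (\<lambda>j. \<xi> j \<omega>) k) \<partial>M)"

lemma integrable_base:
  "integrable M (\<lambda>\<omega>. (norm (devX k \<omega>))\<^sup>2)" "integrable M (\<lambda>\<omega>. (norm (devY k \<omega>))\<^sup>2)"
  "integrable M (\<lambda>\<omega>. (norm (resX k \<omega>))\<^sup>2)" "integrable M (\<lambda>\<omega>. (norm (resY k \<omega>))\<^sup>2)"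
  "integrable M (\<lambda>\<omega>. (norm (ErX k \<omega>))\<^sup>2)" "integrable M (\<lambda>\<omega>. (norm (ErY k \<omega>))\<^sup>2)"
  "integrable M (\<lambda>\<omega>. (norm (grad (avg_cost F) (average (X k \<omega>))))\<^sup>2)"
  "integrable M (\<lambda>\<omega>. real CARD('n) * (avg_cost F (average (X k \<omega>)) - opt_value F))"
proof -
  show "integrable M (\<lambda>\<omega>. real CARD('n) * (avg_cost F (average (X k \<omega>)) - opt_value F))"
    using integrable_gap[of k] by simp
qed (intro sq_integrableD(2) sq_integrable_intros sq_integrable_gradient)+

lemma V_eq:
  "integrable M (\<lambda>\<omega>. lyap_V \<phi> (run (\<lambda>j. \<xi> j \<omega>) k))"
  "V k = msq (devX k) + \<phi> * msq (devY k) + msq (resX k) + msq (resY k)"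
  unfolding lyap_V_def using integrable_base[of k] by simp_all

lemma Uhat_eq:
  "integrable M (\<lambda>\<omega>. lyap_Uhat F \<phi> \<phi>h (run (\<lambda>j. \<xi> j \<omega>) k))"
  "Uhat k = msq (devX k) + \<phi> * msq (devY k) + msq (resX k) + msq (resY k)
    + \<phi>h * (msq (ErX k) + msq (ErY k)) + gap k"
proof -
  note int = integrable_base(5,6,8)[of k] V_eq[of k]
  show "integrable M (\<lambda>\<omega>. lyap_Uhat F \<phi> \<phi>h (run (\<lambda>j. \<xi> j \<omega>) k))"
    unfolding lyap_Uhat_def lyap_Vhat_def
    by (intro Bochner_Integration.integrable_add integrable_mult_right int)
  have "Uhat k = V k + \<phi>h * (msq (ErX k) + msq (ErY k)) + gap k"
    unfolding lyap_Uhat_def lyap_Vhat_def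
    by (simp only: Bochner_Integration.integral_add integral_mult_right_zero int
        Bochner_Integration.integrable_add integrable_mult_right)
  then show "Uhat k = msq (devX k) + \<phi> * msq (devY k) + msq (resX k) + msq (resY k)
    + \<phi>h * (msq (ErX k) + msq (ErY k)) + gap k"
    unfolding V_eq(2) .
qed

lemma gap_nonneg: "0 \<le> gap k"
  using opt_value_le by (intro integral_nonneg_AE AE_I2 mult_nonneg_nonneg) auto

lemma gap_le_Uhat: "gap k \<le> Uhat k"
  unfolding Uhat_eq using phi_pos phih(1) by (simp add: msq_nonneg)

definition shift :: real where
  "shift = 8 * (m2 * \<gamma>) / (1 + 8 * (m2 * \<gamma>))"

abbreviation "Qhat k \<equiv> Uhat k + shift * (msq (devY k) - msq (resY k))"
abbreviation "diss k \<equiv> 42 / 100 * \<alpha> * msq (devX k) + 47 / 100 * \<alpha> * (\<phi> * msq (devY k))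
  + 1 / 2 * \<kappa>1 * msq (resX k) + 1 / 10 * \<kappa>2 * msq (resY k)"

lemma shift_bounds: "0 < shift" "shift \<le> 1"
  unfolding shift_def using m2_gamma(2) by (auto intro!: divide_pos_pos simp: pos_divide_le_eq)

lemma Uhat_step:
  "Uhat (Suc k) \<le> Uhat k + 12 * (m2 * \<gamma>) * \<gamma> * (msq (devY k) - msq (resY k))
    - 7 / 100 * \<alpha> * msq (devX k) - \<eta> / 2 * gradient k - diss k"
  unfolding Uhat_eq(2) using one_step.plain_step[OF one_step[of k]] by linarith

lemma Qhat_step:
  "Qhat (Suc k) \<le> Qhat k - 7 / 100 * \<alpha> * msq (devX k) - \<eta> / 2 * gradient k - diss k"
  unfolding Uhat_eq(2) shift_def using one_step.shifted_step[OF one_step[of k]] by linarith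

lemma gradient_nonneg: "0 \<le> gradient k"
  by (simp add: msq_nonneg)

lemma diss_nonneg: "0 \<le> diss k"
  using alpha_pos phi_pos c1 c2 by (simp add: msq_nonneg)

lemma diss_pos:
  assumes "0 < V k"
  shows "0 < diss k"
proof (rule ccontr)
  assume "\<not> 0 < diss k"
  moreover have "0 \<le> 42 / 100 * \<alpha> * msq (devX k)" "0 \<le> 47 / 100 * \<alpha> * (\<phi> * msq (devY k))"
    "0 \<le> 1 / 2 * \<kappa>1 * msq (resX k)" "0 \<le> 1 / 10 * \<kappa>2 * msq (resY k)"
    using alpha_pos phi_pos c1 c2 by (simp_all add: msq_nonneg)
  ultimately have "42 / 100 * \<alpha> * msq (devX k) = 0" "47 / 100 * \<alpha> * (\<phi> * msq (devY k)) = 0"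
    "1 / 2 * \<kappa>1 * msq (resX k) = 0" "1 / 10 * \<kappa>2 * msq (resY k) = 0"
    by linarith+
  then have "msq (devX k) = 0" "msq (devY k) = 0" "msq (resX k) = 0" "msq (resY k) = 0"
    using alpha_pos phi_pos c1 c2 by auto
  with assms show False unfolding V_eq(2) by simp
qed

lemma descent_nonneg: "0 \<le> 7 / 100 * \<alpha> * msq (devX k) + \<eta> / 2 * gradient k"
  using gamma(1) a(1) eta(1) by (intro add_nonneg_nonneg mult_nonneg_nonneg msq_nonneg) auto

text \<open>\<open>Uhat\<close> may grow in a single step, so the decrease \<open>diss k\<close> is
  subtracted from a common bound \<open>B\<close> of both functions instead of from
  \<open>Uhat k\<close>.\<close>

lemma bounds_Suc:
  assumes "Uhat k \<le> B" "Qhat k \<le> B"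
  shows "Uhat (Suc k) \<le> B - diss k" "Qhat (Suc k) \<le> B - diss k"
proof -
  define q where "q = 12 * (m2 * \<gamma>) * \<gamma> / shift"
  have q: "q * shift = 12 * (m2 * \<gamma>) * \<gamma>" using shift_bounds by (simp add: q_def)
  have q0: "0 \<le> q" unfolding q_def using m2_gamma gamma shift_bounds by simp
  \<comment> \<open>The factor \<open>m2 * \<gamma>\<close> cancels between noise and shift, so
    \<open>q\<close> is of order \<open>\<gamma>\<close> and well below 1.\<close>
  have "q = 3 / 2 * \<gamma> * (1 + 8 * (m2 * \<gamma>))"
  proof -
    have "12 * x * \<gamma> / (8 * x / (1 + 8 * x)) = 3 / 2 * \<gamma> * (1 + 8 * x)" if "0 < x" for x
      using that by (simp add: field_simps)
    from this[OF m2_gamma(2)] show ?thesis unfolding q_def shift_def .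
  qed
  also have "\<dots> \<le> 3 / 2 * (1 / 400) * (1 + 8 * (1 / 5))"
    using gamma_le gamma(1) m2_gamma by (intro mult_mono) linarith+
  finally have q1: "q \<le> 1" by simp
  have "Uhat k + 12 * (m2 * \<gamma>) * \<gamma> * (msq (devY k) - msq (resY k)) = (1 - q) * Uhat k + q * Qhat k"
    unfolding q[symmetric] by (simp add: algebra_simps)
  also have "\<dots> \<le> (1 - q) * B + q * B"
    using assms q0 q1 by (intro add_mono mult_left_mono) auto
  finally show "Uhat (Suc k) \<le> B - diss k"
    using Uhat_step[of k] descent_nonneg[of k] by (simp add: algebra_simps)
  show "Qhat (Suc k) \<le> B - diss k"
    using Qhat_step[of k] descent_nonneg[of k] assms by linarith
qed

text \<open>The starting time is free because strictness restarts the induction at time 1 with a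
  smaller \<open>B\<close>.\<close>

lemma bounds_propagate:
  assumes "Uhat k0 \<le> B" "Qhat k0 \<le> B"
  shows "Uhat (k0 + k) \<le> B \<and> Qhat (k0 + k) \<le> B"
proof (induction k)
  case 0
  show ?case using assms by simp
next
  case (Suc k)
  then show ?case
    using bounds_Suc[of "k0 + k" B] diss_nonneg[of "k0 + k"] by simp
qed

lemma Qhat_0_le: "Qhat 0 \<le> Uhat 0"
proof -
  have "msq (devY 0) \<le> 1 * msq (resY 0) + 0 * msq (resY 0)"
  proof (rule msq_bound2)
    show "(norm (devY 0 \<omega>))\<^sup>2 \<le> 1 * (norm (resY 0 \<omega>))\<^sup>2 + 0 * (norm (resY 0 \<omega>))\<^sup>2" for \<omega>
      unfolding run_0 using norm_diff_consensus_le[of "stacked_grad F x0"] by (simp add: power_mono)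
  qed (intro sq_integrable_intros)+
  then show ?thesis
    using shift_bounds by (simp add: mult_nonneg_nonpos)
qed

lemma Uhat_le: "Uhat k \<le> Uhat 0"
  using bounds_propagate[of 0 "Uhat 0" k] Qhat_0_le by simp

text \<open>The first step lowers the common bound by \<open>diss 0\<close>, and later steps never
  exceed it. If \<open>V 0 = 0\<close>, then \<open>X(0)\<close> and \<open>Y(0)\<close> vanish, the
  compressor almost surely returns 0, and the run stays put; this is why strictness needs
  \<open>0 < V 0\<close>.\<close>

lemma Uhat_less:
  assumes "1 \<le> k" "0 < V 0"
  shows "Uhat k < Uhat 0"
proof -
  have "Uhat (Suc 0) \<le> Uhat 0 - diss 0" "Qhat (Suc 0) \<le> Uhat 0 - diss 0"
    using bounds_Suc[of 0 "Uhat 0"] Qhat_0_le by auto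
  then have "Uhat (Suc 0 + (k - 1)) \<le> Uhat 0 - diss 0"
    using bounds_propagate by blast
  then show ?thesis using assms diss_pos[OF assms(2)] by simp
qed

lemma Qhat_nonneg: "0 \<le> Qhat k"
proof -
  have "Qhat k = msq (devX k) + (\<phi> + shift) * msq (devY k) + msq (resX k)
    + (1 - shift) * msq (resY k) + \<phi>h * (msq (ErX k) + msq (ErY k)) + gap k"
    unfolding Uhat_eq(2) by (simp add: algebra_simps)
  also have "\<dots> \<ge> 0"
    using shift_bounds phi_pos phih(1) gap_nonneg[of k]
    by (intro add_nonneg_nonneg mult_nonneg_nonneg msq_nonneg) auto
  finally show ?thesis .
qed

text \<open>The sum telescopes along \<open>Qhat\<close>, which decreases at every step, is
  nonnegative and starts below \<open>Uhat 0\<close>.\<close>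

lemma stationarity_sum:
  assumes \<theta>: "0 < \<theta>" "\<theta> \<le> 7 / 100 * \<alpha>" "\<theta> \<le> \<eta> / 2"
  shows "(\<Sum>t=0..k. msq (devX t) + gradient t) \<le> Uhat 0 / \<theta>"
proof -
  have step: "\<theta> * (msq (devX t) + gradient t) \<le> Qhat t - Qhat (Suc t)" for t
  proof -
    have "\<theta> * msq (devX t) \<le> 7 / 100 * \<alpha> * msq (devX t)" "\<theta> * gradient t \<le> \<eta> / 2 * gradient t"
      by (intro mult_right_mono \<theta> msq_nonneg gradient_nonneg)+
    then show ?thesis
      using Qhat_step[of t] diss_nonneg[of t] unfolding distrib_left by linarith
  qed
  have "(\<Sum>t=0..k. \<theta> * (msq (devX t) + gradient t)) \<le> Qhat 0 - Qhat (Suc k)"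
  proof (induction k)
    case 0
    show ?case using step[of 0] by simp
  next
    case (Suc k)
    then show ?case using step[of "Suc k"] by simp
  qed
  then have "\<theta> * (\<Sum>t=0..k. msq (devX t) + gradient t) \<le> Uhat 0"
    using Qhat_nonneg[of "Suc k"] Qhat_0_le by (simp add: sum_distrib_left)
  then show ?thesis
    using \<theta> by (simp add: pos_le_divide_eq mult.commute)
qed

end

section \<open>From the minima bounding the parameters to the step-size conditions and the
  conclusion\<close>

lemma less_MinD: "x < Min A \<Longrightarrow> finite A \<Longrightarrow> b \<in> A \<Longrightarrow> x < b"
  by (meson Min_le less_le_trans)

lemma less_inverse_sqrt_imp:
  assumes "0 < v" "v < 1 / sqrt c" "0 < c"
  shows "c * v\<^sup>2 \<le> (1::real)"
proof -
  have "v * sqrt c \<le> 1" using assms by (simp add: pos_less_divide_eq less_imp_le)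
  then have "(v * sqrt c)\<^sup>2 \<le> 1" using assms by (intro power_le_one) auto
  then show ?thesis using assms by (simp add: power_mult_distrib mult.commute)
qed

theorem theorem3:
  fixes E :: "('n::finite \<times> 'n) set"
    and W :: "real^'n^'n"
    and F :: "'n \<Rightarrow> real^'d \<Rightarrow> real"
    and S :: "'s measure"
    and \<C> :: "'s \<Rightarrow> real^'d \<Rightarrow> real^'d"
    and M :: "'w measure"
    and \<xi> :: "nat \<times> channel \<times> 'n \<Rightarrow> 'w \<Rightarrow> 's"
    and x0 :: "real^'d^'n"
    and st :: "nat \<Rightarrow> 'w \<Rightarrow> ('d, 'n) ef_state"
    and Lf r \<psi> \<sigma> \<phi>X \<phi>Y \<gamma> \<eta> vs c1 c2 Cc \<phi> \<phi>h Pi_bound :: real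
    and \<epsilon>1 \<epsilon>2 \<epsilon>3 \<theta>2 \<theta>h2 \<theta>h1 U0 V0 :: real
  assumes connected: "strongly_connected_graph E"
    and weights: "doubly_stochastic_weights E W"
    and sigma: "\<sigma> = mixing_norm W" "\<sigma> \<in> {0<..<1}"
    and differentiable: "\<And>i x. F i differentiable (at x)"
    and argmin: "\<exists>x. is_arg_min (avg_cost F) (\<lambda>_. True) x"
    and Lf: "0 < Lf"
    and Lipschitz: "\<And>i x y. norm (grad (F i) x - grad (F i) y) \<le> Lf * norm (x - y)"
    and r: "0 < r"
    and psi: "\<psi> \<in> {0<..1}"
    and compressor: "compressor S \<C> r \<psi>"
    and prob: "prob_space M"
    and seeds_indep: "prob_space.indep_vars M (\<lambda>_. S) \<xi> UNIV"
    and seeds_law: "\<And>j. distr M S (\<xi> j) = S"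
    and phiX: "\<phi>X \<in> {0<..<1 / r}"
    and phiY: "\<phi>Y \<in> {0<..<1 / r}"
    and c1: "c1 = \<phi>X * \<psi> * r / 2"
    and c2: "c2 = \<phi>Y * \<psi> * r / 2"
    and Cc: "Cc = 2 * r\<^sup>2 * (1 - \<psi>) + 2 * (1 - r)\<^sup>2"
    and phi: "\<phi> = (1 - \<sigma>)\<^sup>2 / (320 * Lf\<^sup>2)"
    and phih: "\<phi>h = 0.1 / Cc * min (c1 * (2 * c1 + 1)) (c2 * (2 * c2 + 1))"
    and Pi_bound: "Pi_bound = Min {
          (1 - \<sigma>) / (160 * (1 + inverse c1)),
          (1 - \<sigma>) / (40000 * (1 + inverse c2) * Lf\<^sup>2),
          c1 * (1 - \<sigma>) / (40 * Cc),
          c1 / (8 * sqrt Cc),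
          c1 / (10 * Lf * sqrt (Cc * (1 + inverse c2))),
          c2 * Lf\<^sup>2 / Cc,
          c2 / (10 * sqrt Cc)}"
    and gamma: "\<gamma> \<in> {0<..<Min {
          c1 * (1 - \<sigma>) / (160 * Cc),
          c1 / (16 * sqrt Cc),
          c1 / (20 * Lf * sqrt (Cc * (1 + inverse c2))),
          c2 * Lf\<^sup>2 / (4 * Cc),
          c2 / (20 * sqrt Cc),
          1 / (4 * (1 + inverse c1) + 5 * (1 + inverse c2) * Lf\<^sup>2),
          (1 - \<sigma>) * \<phi>h / (4 * (16 * (1 + 4 * \<phi> * Lf\<^sup>2) + 8 * (1 - \<sigma>))),
          1 / (5 * (1 + inverse c2)),
          (1 - \<sigma>) * \<phi>h / (32 * (2 * \<phi> + (1 - \<sigma>))),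
          Pi_bound}}"
    and eta: "\<eta> \<in> {0<..<Min {
          (1 - \<sigma>)\<^sup>2 * \<gamma> / (40 * Lf),
          0.4 * (1 - \<sigma>) * \<gamma> / Lf\<^sup>2,
          (1 - \<sigma>)\<^sup>2 / (80 * Lf) * sqrt (\<gamma> / (1 + inverse c1)),
          9 / (40 * (4 * (1 + inverse c1) + 5 * (1 + inverse c2))),
          1 / (2 * Lf),
          \<gamma>}}"
    and vs: "vs \<in> {0<..<min (1 / (2 * sqrt Cc)) (1 / sqrt (2 * Cc + 1))}"
    and eps1: "\<epsilon>1 = 8 * Lf\<^sup>2 / ((1 - \<sigma>) * \<gamma>) * \<eta>\<^sup>2"
    and eps2: "\<epsilon>2 = 4 * (1 + inverse c1) * \<eta>\<^sup>2"
    and eps3: "\<epsilon>3 = 5 * (1 + inverse c2) * \<eta>\<^sup>2"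
    and theta2: "\<theta>2 = \<eta> / 4 - (\<phi> * \<epsilon>1 + \<epsilon>2 + \<epsilon>3)"
    and thetah2: "\<theta>h2 = Min {0.07 * (1 - \<sigma>) * \<gamma>, 0.24 * c1 * (2 * c1 + 1),
                          0.57 * c2 * (2 * c2 + 1), 0.25}"
    and thetah1: "\<theta>h1 = min \<theta>2 \<theta>h2"
    and run: "\<And>k \<omega>. st k \<omega> = ef_run \<C> F W \<gamma> \<eta> \<phi>X \<phi>Y vs x0 (\<lambda>j. \<xi> j \<omega>) k"
    and U0: "\<And>\<omega>. U0 = lyap_Uhat F \<phi> \<phi>h (st 0 \<omega>)"
    and V0: "\<And>\<omega>. V0 = lyap_V \<phi> (st 0 \<omega>)"
  shows "\<forall>k.
      integrable M (\<lambda>\<omega>. (norm (stX (st k \<omega>) - consensus (stX (st k \<omega>))))\<^sup>2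
          + real CARD('n) * (norm (grad (avg_cost F) (average (stX (st k \<omega>)))))\<^sup>2) \<and>
      integrable M (\<lambda>\<omega>. real CARD('n) * (avg_cost F (average (stX (st k \<omega>))) - opt_value F)) \<and>
      integrable M (\<lambda>\<omega>. lyap_Uhat F \<phi> \<phi>h (st k \<omega>)) \<and>
      (\<Sum>t=0..k. \<integral>\<omega>. ((norm (stX (st t \<omega>) - consensus (stX (st t \<omega>))))\<^sup>2
          + real CARD('n) * (norm (grad (avg_cost F) (average (stX (st t \<omega>)))))\<^sup>2) \<partial>M)
        \<le> U0 / \<theta>h1 \<and>
      (\<integral>\<omega>. real CARD('n) * (avg_cost F (average (stX (st k \<omega>))) - opt_value F) \<partial>M)
        \<le> (\<integral>\<omega>. lyap_Uhat F \<phi> \<phi>h (st k \<omega>) \<partial>M) \<and>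
      (\<integral>\<omega>. lyap_Uhat F \<phi> \<phi>h (st k \<omega>) \<partial>M) \<le> U0 \<and>
      (1 \<le> k \<and> 0 < V0 \<longrightarrow> (\<integral>\<omega>. lyap_Uhat F \<phi> \<phi>h (st k \<omega>) \<partial>M) < U0)"
proof -
  have sigma01: "0 < \<sigma>" "\<sigma> < 1" and psi01: "0 < \<psi>" "\<psi> \<le> 1"
    using sigma psi by auto
  define a where "a = 1 - \<sigma>"
  have a01: "0 < a" "a < 1" using sigma01 by (auto simp: a_def)
  have pX: "0 < \<phi>X" "\<phi>X * r < 1" and pY: "0 < \<phi>Y" "\<phi>Y * r < 1"
    using phiX phiY r by (auto simp: pos_less_divide_eq)
  have c_bounds: "0 < p * \<psi> * r / 2 \<and> p * \<psi> * r / 2 \<le> 1 / 2" if "0 < p" "p * r < 1" for p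
  proof -
    have "p * r * \<psi> \<le> 1 * 1" using that psi01 r by (intro mult_mono) auto
    then show ?thesis using that psi01 r by (simp add: mult_ac)
  qed
  have c1b: "0 < c1" "c1 \<le> 1 / 2" and c2b: "0 < c2" "c2 \<le> 1 / 2"
    using c_bounds[OF pX] c_bounds[OF pY] by (auto simp: c1 c2)
  note gM = gamma[unfolded greaterThanLessThan_iff inverse_eq_divide a_def[symmetric], THEN conjunct2]
  have g0: "0 < \<gamma>"
    and g1: "\<gamma> < c1 * a / (160 * Cc)"
    and g4: "\<gamma> < c2 * Lf\<^sup>2 / (4 * Cc)"
    and g7: "\<gamma> < a * \<phi>h / (4 * (16 * (1 + 4 * \<phi> * Lf\<^sup>2) + 8 * a))"
    and g8: "\<gamma> < 1 / (5 * (1 + 1 / c2))"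
    and g9: "\<gamma> < a * \<phi>h / (32 * (2 * \<phi> + a))"
    and gP: "\<gamma> < Pi_bound"
    by (rule gamma[unfolded greaterThanLessThan_iff, THEN conjunct1],
        (rule less_MinD[OF gM]; (intro finite.intros | (rule insertI1 | rule insertI2)+))+)
  have g10: "\<gamma> < a / (160 * (1 + 1 / c1))" and g11: "\<gamma> < a / (40000 * (1 + 1 / c2) * Lf\<^sup>2)"
    by (rule less_MinD[OF gP[unfolded Pi_bound inverse_eq_divide a_def[symmetric]]];
        (intro finite.intros | (rule insertI1 | rule insertI2)+))+
  note eM = eta[unfolded greaterThanLessThan_iff inverse_eq_divide a_def[symmetric], THEN conjunct2]
  have e0: "0 < \<eta>" and e1: "\<eta> < a\<^sup>2 * \<gamma> / (40 * Lf)" and e2: "\<eta> < 0.4 * a * \<gamma> / Lf\<^sup>2"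
    and e4: "\<eta> < 9 / (40 * (4 * (1 + 1 / c1) + 5 * (1 + 1 / c2)))"
    and e5: "\<eta> < 1 / (2 * Lf)" and e6: "\<eta> < \<gamma>"
    by (rule eta[unfolded greaterThanLessThan_iff, THEN conjunct1],
        (rule less_MinD[OF eM]; (intro finite.intros | (rule insertI1 | rule insertI2)+))+)
  have "0 \<le> Cc" using psi01 by (simp add: Cc)
  \<comment> \<open>For \<open>Cc = 0\<close> the quotient bounding \<open>\<gamma>\<close> would be
    0 by the convention on division by zero, against \<open>0 < \<gamma>\<close>.\<close>
  moreover have "Cc \<noteq> 0" using g0 g1 by auto
  ultimately have Cc0: "0 < Cc" by simp
  have phi0: "0 < \<phi>" using a01 Lf by (simp add: phi a_def)
  have m: "0 < 1 + 1 / c1" "0 < 1 + 1 / c2" using c1b c2b by (auto intro: add_pos_pos)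
  define \<mu> where "\<mu> = min (c1 * (1 + 2 * c1)) (c2 * (1 + 2 * c2))"
  have mu: "0 < \<mu>" "\<mu> \<le> c1 * (1 + 2 * c1)" "\<mu> \<le> c2 * (1 + 2 * c2)"
    using c1b c2b by (auto simp: \<mu>_def)
  have phih': "\<phi>h = \<mu> / (10 * Cc)"
    by (simp add: phih \<mu>_def add.commute)
  have phih0: "0 < \<phi>h" "10 * \<phi>h * Cc = \<mu>"
    using mu Cc0 by (auto simp: phih')
  have vs0: "0 < vs" "vs < 1 / (2 * sqrt Cc)" "vs < 1 / sqrt (2 * Cc + 1)"
    using vs by auto
  interpret ef_tuned E W \<sigma> F Lf M S \<C> \<xi> x0 r \<psi> \<phi>X \<phi>Y \<gamma> \<eta> vs c1 c2 Cc \<phi> \<phi>h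
  proof (intro ef_tuned.intro ef_algorithm.intro ef_algorithm_axioms.intro mixing.intro costs.intro
      step_sizes.intro ef_tuned_axioms.intro; (fact assms | fact sigma01 pX pY c1b c2b Cc0 g0 e0)?)
    show "0 < 1 - \<sigma>" "1 - \<sigma> < 1" using sigma01 by auto
    show "0 < \<phi>h" by (fact phih0)
    show "10 * \<phi>h * Cc \<le> c1 * (1 + 2 * c1)" "10 * \<phi>h * Cc \<le> c2 * (1 + 2 * c2)"
      unfolding phih0(2) by (fact mu)+
    show "160 * Cc * \<gamma> \<le> c1 * (1 - \<sigma>)"
      using g1 Cc0 by (simp add: a_def field_simps)
    show "4 * Cc * \<gamma> \<le> c2 * Lf\<^sup>2"
      using g4 Cc0 by (simp add: field_simps)
    \<comment> \<open>Only the part \<open>4 * 16\<close> of the denominator is kept; its other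
      terms are nonnegative.\<close>
    show "64 * \<gamma> \<le> (1 - \<sigma>) * \<phi>h"
    proof -
      have "0 \<le> \<phi> * Lf\<^sup>2" using phi0 by simp
      then have d: "64 \<le> 4 * (16 * (1 + 4 * \<phi> * Lf\<^sup>2) + 8 * a)" using a01 by simp
      then have "\<gamma> * 64 \<le> \<gamma> * (4 * (16 * (1 + 4 * \<phi> * Lf\<^sup>2) + 8 * a))"
        using g0 by (intro mult_left_mono) auto
      also have "\<dots> \<le> a * \<phi>h" using g7 d by (simp add: pos_less_divide_eq less_imp_le)
      finally show ?thesis by (simp add: a_def)
    qed
    show "5 * (1 + 1 / c2) * \<gamma> \<le> 1"
    proof -
      have "0 < 5 * (1 + 1 / c2)" by (intro mult_pos_pos m) simp
      then have "\<gamma> * (5 * (1 + 1 / c2)) \<le> 1"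
        using g8 by (simp only: pos_less_divide_eq less_imp_le)
      then show ?thesis by (simp only: mult_ac)
    qed
    show "32 * \<gamma> * (2 * \<phi> + (1 - \<sigma>)) \<le> (1 - \<sigma>) * \<phi>h"
    proof -
      have "0 < 32 * (2 * \<phi> + a)" using phi0 a01 by simp
      then have "\<gamma> * (32 * (2 * \<phi> + a)) \<le> a * \<phi>h"
        using g9 by (simp only: pos_less_divide_eq less_imp_le)
      then show ?thesis unfolding a_def by (simp only: mult_ac)
    qed
    show "160 * (1 + 1 / c1) * \<gamma> \<le> 1 - \<sigma>"
    proof -
      have "0 < 160 * (1 + 1 / c1)" by (intro mult_pos_pos m) simp
      then have "\<gamma> * (160 * (1 + 1 / c1)) \<le> a"
        using g10 by (simp only: pos_less_divide_eq less_imp_le)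
      then show ?thesis unfolding a_def by (simp only: mult_ac)
    qed
    show "40000 * (1 + 1 / c2) * Lf\<^sup>2 * \<gamma> \<le> 1 - \<sigma>"
    proof -
      have "0 < 40000 * (1 + 1 / c2) * Lf\<^sup>2" using Lf by (intro mult_pos_pos m) simp_all
      then have "\<gamma> * (40000 * (1 + 1 / c2) * Lf\<^sup>2) \<le> a"
        using g11 by (simp only: pos_less_divide_eq less_imp_le)
      then show ?thesis unfolding a_def by (simp only: mult_ac)
    qed
    show "40 * Lf * \<eta> \<le> (1 - \<sigma>)\<^sup>2 * \<gamma>"
      using e1 Lf by (simp add: a_def pos_less_divide_eq mult_ac)
    show "Lf\<^sup>2 * \<eta> \<le> 4 / 10 * (1 - \<sigma>) * \<gamma>"
      using e2 Lf by (simp add: a_def pos_less_divide_eq mult_ac)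
    show "\<eta> \<le> \<gamma>" "\<eta> \<le> 1 / (2 * Lf)" using e5 e6 by auto
    show "(2 * Cc + 1) * vs\<^sup>2 \<le> 1"
      using Cc0 by (intro less_inverse_sqrt_imp vs0) auto
    have "2 * sqrt Cc = sqrt (4 * Cc)" by (simp add: real_sqrt_mult)
    then show "4 * Cc * vs\<^sup>2 \<le> 1"
      using Cc0 vs0 by (intro less_inverse_sqrt_imp) auto
  qed

  have st: "st k \<omega> = run (\<lambda>j. \<xi> j \<omega>) k" for k \<omega> by (rule run)
  \<comment> \<open>The losses add up to less than \<open>\<eta> / 4\<close>:
    \<open>\<phi> * \<epsilon>1\<close> is at most \<open>\<eta> / 40\<close> because
    \<open>8 / 320 = 1 / 40\<close> and \<open>\<eta> < \<gamma>\<close>, and the fourth bound on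
    \<open>\<eta>\<close> keeps \<open>\<epsilon>2 + \<epsilon>3\<close> below
    \<open>9 / 40 * \<eta>\<close>.\<close>
  have th2: "0 < \<theta>2" "\<theta>2 \<le> \<eta> / 4"
  proof -
    have "\<phi> * \<epsilon>1 = a * \<eta>\<^sup>2 / (40 * \<gamma>)"
      using a01 Lf g0 by (simp add: phi eps1 a_def[symmetric] field_simps power2_eq_square)
    also have "\<dots> \<le> 1 * \<eta>\<^sup>2 / (40 * \<gamma>)"
      using a01 g0 by (intro divide_right_mono mult_right_mono) auto
    also have "\<dots> \<le> \<eta> / 40"
      using e0 e6 g0 by (simp add: field_simps power2_eq_square)
    finally have p1: "\<phi> * \<epsilon>1 \<le> \<eta> / 40" .
    define d where "d = 4 * (1 + 1 / c1) + 5 * (1 + 1 / c2)"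
    have "0 < d" using c1b c2b unfolding d_def by (intro add_pos_pos mult_pos_pos) auto
    then have "\<eta> * d < 9 / 40" using e4 unfolding d_def[symmetric] by (simp add: pos_less_divide_eq)
    then have "\<eta> * (\<eta> * d) < \<eta> * (9 / 40)" using e0 by (rule mult_strict_left_mono)
    moreover have "\<epsilon>2 + \<epsilon>3 = \<eta> * (\<eta> * d)"
      by (simp add: eps2 eps3 d_def inverse_eq_divide power2_eq_square algebra_simps)
    ultimately show "0 < \<theta>2" using p1 unfolding theta2 by linarith
    have "0 \<le> \<phi> * \<epsilon>1" using phi0 a01 g0 by (simp add: eps1 a_def[symmetric])
    moreover have "0 \<le> \<epsilon>2" "0 \<le> \<epsilon>3" using m by (simp_all add: eps2 eps3 inverse_eq_divide)
    ultimately show "\<theta>2 \<le> \<eta> / 4" unfolding theta2 by linarith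
  qed
  have thh2: "0 < \<theta>h2" "\<theta>h2 \<le> 7 / 100 * (\<gamma> * (1 - \<sigma>))"
  proof -
    have "0 < 0.07 * (1 - \<sigma>) * \<gamma>" "0 < 0.24 * c1 * (2 * c1 + 1)" "0 < 0.57 * c2 * (2 * c2 + 1)"
      using sigma01 g0 c1b c2b by simp_all
    then show "0 < \<theta>h2" unfolding thetah2 by (subst Min_gr_iff) auto
    have "\<theta>h2 \<le> 0.07 * (1 - \<sigma>) * \<gamma>" unfolding thetah2 by (rule Min_le) auto
    then show "\<theta>h2 \<le> 7 / 100 * (\<gamma> * (1 - \<sigma>))" by (simp add: mult_ac)
  qed
  have th: "0 < \<theta>h1" "\<theta>h1 \<le> 7 / 100 * (\<gamma> * (1 - \<sigma>))" "\<theta>h1 \<le> \<eta> / 2"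
    using th2 thh2 e0 by (auto simp: thetah1)

  \<comment> \<open>The value at time 0 is the same for all outcomes, so it equals its expectation
    under a probability measure.\<close>
  have U0: "Uhat 0 = U0"
    using U0 by (simp add: st[symmetric] prob_space)
  have V0: "V 0 = V0"
    using V0 by (simp add: st[symmetric] prob_space)
  have msq_grad: "(\<integral>\<omega>. (norm (devX t \<omega>))\<^sup>2
      + real CARD('n) * (norm (grad (avg_cost F) (average (X t \<omega>))))\<^sup>2 \<partial>M)
      = msq (devX t) + gradient t" for t
    using integrable_base[of t] by simp
  show ?thesis
    unfolding st msq_grad
  proof (intro allI conjI impI)
    fix k
    show "integrable M (\<lambda>\<omega>. (norm (devX k \<omega>))\<^sup>2
        + real CARD('n) * (norm (grad (avg_cost F) (average (X k \<omega>))))\<^sup>2)"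
      using integrable_base[of k] by simp
    show "integrable M (\<lambda>\<omega>. real CARD('n) * (avg_cost F (average (X k \<omega>)) - opt_value F))"
      by (rule integrable_base)
    show "integrable M (\<lambda>\<omega>. lyap_Uhat F \<phi> \<phi>h (run (\<lambda>j. \<xi> j \<omega>) k))"
      by (rule Uhat_eq)
    show "(\<Sum>t=0..k. msq (devX t) + gradient t) \<le> U0 / \<theta>h1"
      using stationarity_sum[OF th] unfolding U0 .
    show "gap k \<le> Uhat k" by (rule gap_le_Uhat)
    show "Uhat k \<le> U0" using Uhat_le[of k] unfolding U0 .
    show "Uhat k < U0" if "1 \<le> k \<and> 0 < V0"
      using Uhat_less[of k] that unfolding U0 V0 by simp
  qed
qed

end
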